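(* Let $G$ be a compact Hausdorff right topological group. The following are equivalent: 1. $G$ has a (right) Haar measure; 2. $\mathcal{L}_c(G)$ contains a non-zero measure; 3. $\mathcal{M}_w(G)$ contains a non-zero measure.
   Context: A right topological group is a group $G$ with a topology such that for every $x\in G$ the map $g\mapsto gx$ is continuous. A (right) Haar measure on a compact right topological group $G$ is a Radon probability measure $\lambda$ with $\lambda(Eg)=\lambda(E)$ for all $g\in G$ and Borel $E\subset G$. $M(G)=C(G)^*$ is the space of complex Radon measures on $G$, with total variation norm. For $f\in C(G)$ and $\mu\in M(G)$, $(f\cdot\mu)(y)=\int f(xy)\,d\mu(x)$, and $\mathcal{M}(G)=\{\mu\in M(G): f\cdot\mu\in C(G)\text{ for all }f\in C(G)\}$. For $g\in G$, $\mu_g$ is the right translate $\mu_g(E)=\mu(Eg)$, and $\mu_G=\{\mu_g: g\in G\}$. Define $\mathcal{M}_w(G)=\{\mu\in\mathcal{M}(G):\mu_G\text{ is relatively weakly compact in }M(G)\}$ and $\mathcal{L}_c(G)=\{\mu\in M(G): x\mapsto\mu_{x^{-1}}\text{ is norm continuous from }G\text{ to }M(G)\}$ (which is contained in $\mathcal{M}_w(G)$). *)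

theory Defs
  imports "HOL-Probability.Probability"
begin

text \<open>
  Groups are written additively, as \<^class>\<open>group_add\<close> is the (not necessarily commutative)
  group class of the library: the product $gx$ reads \<open>g + x\<close> and $x^{-1}$ reads \<open>- x\<close>.
\<close>

class right_topological_group_add = topological_space + group_add +
  assumes continuous_right_translation: "open U \<Longrightarrow> open ((\<lambda>g. g + x) -` U)"

text \<open>
  Radon condition for a positive set function on the Borel sets. For finite measures on a
  compact Hausdorff space, inner regularity on all Borel sets implies outer regularity.
\<close>

definition radon :: "('a::topological_space set \<Rightarrow> ennreal) \<Rightarrow> bool" where
  "radon m \<longleftrightarrow>
     (\<forall>K. compact K \<longrightarrow> m K < \<infinity>) \<and>
     (\<forall>E\<in>sets borel. m E = (SUP K\<in>{K. compact K \<and> K \<subseteq> E}. m K))"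

definition right_haar_measure :: "'a::right_topological_group_add measure \<Rightarrow> bool" where
  "right_haar_measure M \<longleftrightarrow>
     sets M = sets borel \<and> prob_space M \<and> radon (emeasure M) \<and>
     (\<forall>g. \<forall>E\<in>sets borel. emeasure M ((\<lambda>x. x + g) ` E) = emeasure M E)"


text \<open>
  A complex Borel measure is a set function, normalised to \<open>0\<close> off the Borel sets so that
  equality of functions is equality of measures.
\<close>

definition complex_borel_measure :: "('a::topological_space set \<Rightarrow> complex) \<Rightarrow> bool" where
  "complex_borel_measure \<mu> \<longleftrightarrow>
     (\<forall>E. E \<notin> sets borel \<longrightarrow> \<mu> E = 0) \<and>
     (\<forall>A :: nat \<Rightarrow> 'a set. range A \<subseteq> sets borel \<longrightarrow> disjoint_family A \<longrightarrow>
        (\<lambda>n. \<mu> (A n)) sums \<mu> (\<Union>n. A n))"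

definition total_variation :: "('a::topological_space set \<Rightarrow> complex) \<Rightarrow> 'a set \<Rightarrow> ennreal" where
  "total_variation \<mu> E =
     (SUP P\<in>{P. finite P \<and> P \<subseteq> sets borel \<and> disjoint P \<and> \<Union>P = E}.
        \<Sum>A\<in>P. ennreal (cmod (\<mu> A)))"

definition tv_norm :: "('a::topological_space set \<Rightarrow> complex) \<Rightarrow> real" where
  "tv_norm \<mu> = enn2real (total_variation \<mu> UNIV)"

text \<open>The space $M(G)$.\<close>

definition radon_measures :: "('a::topological_space set \<Rightarrow> complex) set" where
  "radon_measures = {\<mu>. complex_borel_measure \<mu> \<and> radon (total_variation \<mu>)}"


text \<open>
  Integration against a complex measure through the Jordan decompositions of its real and
  imaginary parts. The upper variation is $\nu^+(E) = \sup\{\nu(F) : F \subseteq E\}$; the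
  coercion \<^const>\<open>ennreal\<close> truncates negative values to \<open>0\<close>, which does not affect the
  supremum because of $F = \emptyset$.
\<close>

definition upper_variation :: "('a::topological_space set \<Rightarrow> real) \<Rightarrow> 'a measure" where
  "upper_variation \<nu> =
     measure_of UNIV (sets borel) (\<lambda>E. SUP F\<in>{F\<in>sets borel. F \<subseteq> E}. ennreal (\<nu> F))"

definition signed_integral ::
    "('a::topological_space set \<Rightarrow> real) \<Rightarrow> ('a \<Rightarrow> complex) \<Rightarrow> complex" where
  "signed_integral \<nu> f =
     integral\<^sup>L (upper_variation \<nu>) f - integral\<^sup>L (upper_variation (\<lambda>E. - \<nu> E)) f"

definition complex_integral ::
    "('a::topological_space set \<Rightarrow> complex) \<Rightarrow> ('a \<Rightarrow> complex) \<Rightarrow> complex" where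
  "complex_integral \<mu> f =
     signed_integral (\<lambda>E. Re (\<mu> E)) f + \<i> * signed_integral (\<lambda>E. Im (\<mu> E)) f"


text \<open>
  The dual space of $M(G)$. Only the values of a functional on \<^const>\<open>radon_measures\<close> matter.
\<close>

definition radon_measures_dual ::
    "(('a::topological_space set \<Rightarrow> complex) \<Rightarrow> complex) set" where
  "radon_measures_dual = {\<phi>.
     (\<forall>\<mu>\<in>radon_measures. \<forall>\<nu>\<in>radon_measures. \<phi> (\<lambda>E. \<mu> E + \<nu> E) = \<phi> \<mu> + \<phi> \<nu>) \<and>
     (\<forall>c. \<forall>\<mu>\<in>radon_measures. \<phi> (\<lambda>E. c * \<mu> E) = c * \<phi> \<mu>) \<and>
     (\<exists>B. \<forall>\<mu>\<in>radon_measures. cmod (\<phi> \<mu>) \<le> B * tv_norm \<mu>)}"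

text \<open>The \<^const>\<open>topspace\<close> is all of $M(G)$, since $0$ is in the dual.\<close>

definition weak_topology :: "('a::topological_space set \<Rightarrow> complex) topology" where
  "weak_topology = topology_generated_by
     {{\<mu>\<in>radon_measures. \<phi> \<mu> \<in> U} | \<phi> U. \<phi> \<in> radon_measures_dual \<and> open U}"

definition relatively_weakly_compact ::
    "('a::topological_space set \<Rightarrow> complex) set \<Rightarrow> bool" where
  "relatively_weakly_compact S \<longleftrightarrow>
     S \<subseteq> radon_measures \<and> compactin weak_topology (weak_topology closure_of S)"


definition right_translate ::
    "'a::right_topological_group_add \<Rightarrow> ('a set \<Rightarrow> complex) \<Rightarrow> 'a set \<Rightarrow> complex" where
  "right_translate g \<mu> E = \<mu> ((\<lambda>x. x + g) ` E)"

definition convolve ::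
    "('a::right_topological_group_add \<Rightarrow> complex) \<Rightarrow> ('a set \<Rightarrow> complex) \<Rightarrow> 'a \<Rightarrow> complex" where
  "convolve f \<mu> y = complex_integral \<mu> (\<lambda>x. f (x + y))"

text \<open>The spaces $\mathcal{M}(G)$, $\mathcal{M}_w(G)$ and $\mathcal{L}_c(G)$.\<close>

definition M_cont :: "('a::right_topological_group_add set \<Rightarrow> complex) set" where
  "M_cont = {\<mu>\<in>radon_measures.
     \<forall>f. continuous_on UNIV f \<longrightarrow> continuous_on UNIV (convolve f \<mu>)}"

definition M_weak :: "('a::right_topological_group_add set \<Rightarrow> complex) set" where
  "M_weak = {\<mu>\<in>M_cont. relatively_weakly_compact (range (\<lambda>g. right_translate g \<mu>))}"

definition L_cont :: "('a::right_topological_group_add set \<Rightarrow> complex) set" where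
  "L_cont = {\<mu>\<in>radon_measures. \<forall>x.
     ((\<lambda>y. tv_norm (\<lambda>E. right_translate (- y) \<mu> E - right_translate (- x) \<mu> E)) \<longlongrightarrow> 0) (at x)}"

end

theory Submission imports Defs begin

text \<open>
  The hard implication produces a Haar measure from a non-zero $\mu \in \mathcal{M}_w(G)$. On the weak
  closure of the orbit of $\mu$ the weak topology agrees with the one induced by $C(G)$, so
  $y \mapsto \mu(Ey^{-1})$ is continuous for every Borel set $E$. This passes to the upper variations of
  the real and imaginary parts, so $\mu$ may be replaced by a probability measure $\kappa$ with
  translates $\kappa_y(E) = \kappa(Ey^{-1})$. By Dini's theorem the $\kappa_y$ are uniformly countably
  additive. The iterates $\int \kappa_y(E) \, d\kappa_z(y)$, for $z \in G$, are then totally bounded in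
  the uniform norm over $E$: from any sequence of Borel sets $E_k$ one extracts a subsequence along
  which $\kappa_y(E_k)$ converges for every $y$ (weak compactness in $L^\infty$ of a dominating measure),
  and Dini's theorem makes the integrals converge uniformly in $z$, as in Egorov's theorem. In the
  compact closed convex hull of the iterates, averaging over a finite net of an orbit decreases its
  diameter, so a point whose orbit has minimal diameter is invariant.
\<close>

section \<open>Complex Borel measures and their total variation\<close>

text \<open>Right translations act isometrically for the uniform norm over Borel sets, and the
  diameter argument needs finite nets for this norm. The orbit of \<kappa> is known to be compact
  only for weaker topologies, which is why it is integrated against itself once more. Write T h(y)
  for the integral of h against \<kappa>_y. Uniform countable additivity makes T weakly compact, and
  the iterate at z is the value at z of T applied twice to the indicator of E. By the Dunford-Pettis
  property the square of such an operator is compact; subsequences and the Egorov argument prove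
  this directly for indicators. Positivity has to come before averaging: the translates of a
  non-zero complex measure may average to 0, whereas the mass of a positive measure, once normalised
  to 1, is kept by iterating and averaging. The other implications are soft: a Haar measure has a
  constant orbit, and a norm continuous orbit is a weakly continuous image of a compact
  space.\<close>

lemma complex_borel_measure_not_borel:
  "complex_borel_measure \<mu> \<Longrightarrow> E \<notin> sets borel \<Longrightarrow> \<mu> E = 0"
  by (simp add: complex_borel_measure_def)

lemma complex_borel_measure_sums:
  "complex_borel_measure \<mu> \<Longrightarrow> range A \<subseteq> sets borel \<Longrightarrow> disjoint_family A \<Longrightarrow>
    (\<lambda>n. \<mu> (A n)) sums \<mu> (\<Union>n. A n)"
  by (simp add: complex_borel_measure_def)

lemma complex_borel_measure_empty:
  assumes "complex_borel_measure \<mu>"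
  shows "\<mu> {} = 0"
proof -
  have "(\<lambda>n::nat. \<mu> {}) sums \<mu> (\<Union>n::nat. {})"
    by (rule complex_borel_measure_sums[OF assms]) (auto simp: disjoint_family_on_def)
  then have "summable (\<lambda>n::nat. \<mu> {})"
    by (rule sums_summable)
  then show ?thesis
    by (simp add: summable_const_iff)
qed

lemma complex_borel_measure_Un:
  assumes "complex_borel_measure \<mu>" "A \<in> sets borel" "B \<in> sets borel" "A \<inter> B = {}"
  shows "\<mu> (A \<union> B) = \<mu> A + \<mu> B"
proof -
  have "(\<lambda>n. \<mu> (binaryset A B n)) sums \<mu> (\<Union>n. binaryset A B n)"
    using assms
    by (intro complex_borel_measure_sums)
       (auto simp: disjoint_family_on_def binaryset_def)
  moreover have "(\<lambda>n. \<mu> (binaryset A B n)) sums (\<mu> A + \<mu> B)"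
    using complex_borel_measure_empty[OF assms(1)] by (rule binaryset_sums)
  ultimately show ?thesis
    by (simp add: UN_binaryset_eq sums_iff)
qed

lemma complex_borel_measure_Diff:
  assumes "complex_borel_measure \<mu>" "A \<in> sets borel" "B \<in> sets borel" "B \<subseteq> A"
  shows "\<mu> (A - B) = \<mu> A - \<mu> B"
proof -
  have "\<mu> ((A - B) \<union> B) = \<mu> (A - B) + \<mu> B"
    using assms by (intro complex_borel_measure_Un) auto
  moreover have "(A - B) \<union> B = A"
    using assms by auto
  ultimately show ?thesis by simp
qed

definition borel_partitions :: "'a::topological_space set \<Rightarrow> 'a set set set" where
  "borel_partitions E = {P. finite P \<and> P \<subseteq> sets borel \<and> disjoint P \<and> \<Union>P = E}"

lemma total_variation_eq:
  "total_variation \<mu> E = (SUP P\<in>borel_partitions E. \<Sum>A\<in>P. ennreal (cmod (\<mu> A)))"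
  by (simp add: total_variation_def borel_partitions_def)

lemma borel_partitions_not_borel: "E \<notin> sets borel \<Longrightarrow> borel_partitions E = {}"
  by (auto simp: borel_partitions_def sets.finite_Union)

lemma singleton_borel_partition: "E \<in> sets borel \<Longrightarrow> {E} \<in> borel_partitions E"
  by (auto simp: borel_partitions_def)

lemma total_variation_upper:
  "P \<in> borel_partitions E \<Longrightarrow> (\<Sum>A\<in>P. ennreal (cmod (\<mu> A))) \<le> total_variation \<mu> E"
  unfolding total_variation_eq by (rule SUP_upper)

lemma norm_le_total_variation:
  "E \<in> sets borel \<Longrightarrow> ennreal (cmod (\<mu> E)) \<le> total_variation \<mu> E"
  using total_variation_upper[OF singleton_borel_partition] by fastforce

lemma total_variation_superadditive:
  assumes \<mu>: "complex_borel_measure \<mu>" and "A \<in> sets borel" "B \<in> sets borel" "A \<inter> B = {}"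
  shows "total_variation \<mu> A + total_variation \<mu> B \<le> total_variation \<mu> (A \<union> B)"
proof -
  let ?s = "\<lambda>P. \<Sum>A\<in>P. ennreal (cmod (\<mu> A))"
  have ne: "borel_partitions A \<noteq> {}" "borel_partitions B \<noteq> {}"
    using assms singleton_borel_partition by blast+
  have "?s P + ?s Q \<le> total_variation \<mu> (A \<union> B)"
    if P: "P \<in> borel_partitions A" and Q: "Q \<in> borel_partitions B" for P Q
  proof -
    have fin: "finite P" "finite Q"
      using P Q by (auto simp: borel_partitions_def)
    \<comment> \<open>Partitions may contain the empty set, so P and Q need not be disjoint
      families. The empty set is all they can share, and it has mass 0.\<close>
    have "P \<inter> Q \<subseteq> {{}}"
      using P Q assms(4) by (auto simp: borel_partitions_def)
    then have "?s (P \<inter> Q) = 0"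
      using complex_borel_measure_empty[OF \<mu>] by (intro sum.neutral) auto
    then have "?s P + ?s Q = ?s (P \<union> Q)"
      using sum.union_inter[OF fin, of "\<lambda>A. ennreal (cmod (\<mu> A))"] by simp
    also have "P \<union> Q \<in> borel_partitions (A \<union> B)"
      using P Q assms(4) unfolding borel_partitions_def disjoint_def by auto blast+
    then have "?s (P \<union> Q) \<le> total_variation \<mu> (A \<union> B)"
      by (rule total_variation_upper)
    finally show ?thesis .
  qed
  then have "(SUP P\<in>borel_partitions A. (SUP Q\<in>borel_partitions B. ?s P + ?s Q))
      \<le> total_variation \<mu> (A \<union> B)"
    by (intro SUP_least)
  also have "(SUP P\<in>borel_partitions A. (SUP Q\<in>borel_partitions B. ?s P + ?s Q)) =
      (SUP P\<in>borel_partitions A. ?s P + total_variation \<mu> B)"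
    unfolding total_variation_eq by (intro SUP_cong refl ennreal_SUP_add_right[symmetric] ne)
  also have "\<dots> = total_variation \<mu> A + total_variation \<mu> B"
    unfolding total_variation_eq[of \<mu> A] by (intro ennreal_SUP_add_left ne)
  finally show ?thesis .
qed

lemma total_variation_mono:
  assumes "complex_borel_measure \<mu>" "A \<in> sets borel" "B \<in> sets borel" "A \<subseteq> B"
  shows "total_variation \<mu> A \<le> total_variation \<mu> B"
proof -
  have "total_variation \<mu> A + total_variation \<mu> (B - A) \<le> total_variation \<mu> (A \<union> (B - A))"
    using assms by (intro total_variation_superadditive) auto
  moreover have "A \<union> (B - A) = B"
    using assms by auto
  ultimately show ?thesis
    by (metis add_increasing2 order.trans order_refl zero_le)
qed

text \<open>The traces of the cells on A form a partition of A. Distinct cells can have the same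
  trace only if it is empty, so passing to the set of traces loses no mass.\<close>

lemma sum_trace_le_total_variation:
  assumes \<mu>: "complex_borel_measure \<mu>" and P: "P \<in> borel_partitions E"
    and A: "A \<in> sets borel" "A \<subseteq> E"
  shows "(\<Sum>C\<in>P. ennreal (cmod (\<mu> (C \<inter> A)))) \<le> total_variation \<mu> A"
proof -
  have "(\<Sum>C\<in>(\<lambda>C. C \<inter> A) ` P. ennreal (cmod (\<mu> C))) = (\<Sum>C\<in>P. ennreal (cmod (\<mu> (C \<inter> A))))"
  proof (subst sum.reindex_nontrivial)
    show "finite P"
      using P by (auto simp: borel_partitions_def)
    fix C D assume "C \<in> P" "D \<in> P" "C \<noteq> D" "C \<inter> A = D \<inter> A"
    then have "C \<inter> A = {}"
      using P unfolding borel_partitions_def disjoint_def by blast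
    then show "ennreal (cmod (\<mu> (C \<inter> A))) = 0"
      using complex_borel_measure_empty[OF \<mu>] by simp
  qed simp
  moreover have "(\<lambda>C. C \<inter> A) ` P \<in> borel_partitions A"
    using P A unfolding borel_partitions_def disjoint_def by auto blast+
  ultimately show ?thesis
    using total_variation_upper by metis
qed

lemma total_variation_subadditive:
  assumes \<mu>: "complex_borel_measure \<mu>" and AB: "A \<in> sets borel" "B \<in> sets borel" "A \<inter> B = {}"
  shows "total_variation \<mu> (A \<union> B) \<le> total_variation \<mu> A + total_variation \<mu> B"
proof -
  have "(\<Sum>C\<in>P. ennreal (cmod (\<mu> C))) \<le> total_variation \<mu> A + total_variation \<mu> B"
    if P: "P \<in> borel_partitions (A \<union> B)" for P
  proof -
    have "(\<Sum>C\<in>P. ennreal (cmod (\<mu> C)))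
        \<le> (\<Sum>C\<in>P. ennreal (cmod (\<mu> (C \<inter> A))) + ennreal (cmod (\<mu> (C \<inter> B))))"
    proof (rule sum_mono)
      fix C assume "C \<in> P"
      then have C: "C \<in> sets borel" "C = (C \<inter> A) \<union> (C \<inter> B)"
        using P by (auto simp: borel_partitions_def)
      have "\<mu> ((C \<inter> A) \<union> (C \<inter> B)) = \<mu> (C \<inter> A) + \<mu> (C \<inter> B)"
        using C(1) AB by (intro complex_borel_measure_Un[OF \<mu>]) auto
      then have "cmod (\<mu> C) \<le> cmod (\<mu> (C \<inter> A)) + cmod (\<mu> (C \<inter> B))"
        using C(2) norm_triangle_ineq by metis
      then show "ennreal (cmod (\<mu> C)) \<le> ennreal (cmod (\<mu> (C \<inter> A))) + ennreal (cmod (\<mu> (C \<inter> B)))"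
        by (simp add: ennreal_plus[symmetric] del: ennreal_plus)
    qed
    also have "\<dots> = (\<Sum>C\<in>P. ennreal (cmod (\<mu> (C \<inter> A)))) + (\<Sum>C\<in>P. ennreal (cmod (\<mu> (C \<inter> B))))"
      by (rule sum.distrib)
    also have "\<dots> \<le> total_variation \<mu> A + total_variation \<mu> B"
      using AB by (intro add_mono sum_trace_le_total_variation[OF \<mu> P]) auto
    finally show ?thesis .
  qed
  then show ?thesis
    unfolding total_variation_eq[of \<mu> "A \<union> B"] by (rule SUP_least)
qed

lemma total_variation_add_le:
  "total_variation (\<lambda>E. \<mu> E + \<nu> E) E \<le> total_variation \<mu> E + total_variation \<nu> E"
  unfolding total_variation_eq[of "\<lambda>E. \<mu> E + \<nu> E"]
proof (rule SUP_least)
  fix P assume P: "P \<in> borel_partitions E"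
  have "(\<Sum>A\<in>P. ennreal (cmod (\<mu> A + \<nu> A))) \<le> (\<Sum>A\<in>P. ennreal (cmod (\<mu> A)) + ennreal (cmod (\<nu> A)))"
    by (intro sum_mono) (simp add: ennreal_plus[symmetric] norm_triangle_ineq del: ennreal_plus)
  also have "\<dots> \<le> total_variation \<mu> E + total_variation \<nu> E"
    unfolding sum.distrib using P by (intro add_mono total_variation_upper)
  finally show "(\<Sum>A\<in>P. ennreal (cmod (\<mu> A + \<nu> A))) \<le> total_variation \<mu> E + total_variation \<nu> E" .
qed

lemma total_variation_cmult_le:
  "total_variation (\<lambda>E. c * \<mu> E) E \<le> ennreal (cmod c) * total_variation \<mu> E"
  unfolding total_variation_eq[of "\<lambda>E. c * \<mu> E"]
proof (rule SUP_least)
  fix P assume P: "P \<in> borel_partitions E"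
  have "(\<Sum>A\<in>P. ennreal (cmod (c * \<mu> A))) = ennreal (cmod c) * (\<Sum>A\<in>P. ennreal (cmod (\<mu> A)))"
    by (simp add: norm_mult ennreal_mult sum_distrib_left del: sum_ennreal)
  also have "\<dots> \<le> ennreal (cmod c) * total_variation \<mu> E"
    using P by (intro mult_left_mono total_variation_upper) auto
  finally show "(\<Sum>A\<in>P. ennreal (cmod (c * \<mu> A))) \<le> ennreal (cmod c) * total_variation \<mu> E" .
qed

lemma complex_borel_measure_add:
  "complex_borel_measure \<mu> \<Longrightarrow> complex_borel_measure \<nu> \<Longrightarrow> complex_borel_measure (\<lambda>E. \<mu> E + \<nu> E)"
  by (simp add: complex_borel_measure_def sums_add)

lemma complex_borel_measure_cmult:
  "complex_borel_measure \<mu> \<Longrightarrow> complex_borel_measure (\<lambda>E. c * \<mu> E)"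
  by (simp add: complex_borel_measure_def sums_mult)

section \<open>Inner regularity and the linear structure of M(G)\<close>

lemma inner_regular_if_radon:
  assumes r: "radon (m :: 'a::topological_space set \<Rightarrow> ennreal)" and E: "E \<in> sets borel"
    and fin: "m E < \<infinity>" and "e > 0"
  obtains K where "compact K" "K \<subseteq> E" "m E \<le> m K + ennreal e"
proof (cases "m E = 0")
  case True
  then show ?thesis
    using that[of "{}"] by simp
next
  case False
  have sup: "m E = (SUP K\<in>{K. compact K \<and> K \<subseteq> E}. m K)"
    using r E by (simp add: radon_def)
  \<comment> \<open>Subtraction on \<open>ennreal\<close> is truncated at 0, so the strict
    inequality fails for \<open>m E = 0\<close>; hence the case split.\<close>
  have "m E - ennreal e < m E"
    using False fin \<open>e > 0\<close>
    by (intro ennreal_between) (auto simp: zero_less_iff_neq_zero)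
  then obtain K where K: "compact K" "K \<subseteq> E" "m E - ennreal e < m K"
    unfolding sup less_SUP_iff by auto
  have "m E \<le> m K + ennreal e"
    using K(3) by (metis ennreal_minus_le_iff add.commute less_imp_le ennreal_less_top less_top)
  then show ?thesis
    using that K by auto
qed

lemma finite_if_radon_compact:
  "radon m \<Longrightarrow> compact (UNIV :: 'a::topological_space set) \<Longrightarrow> m (UNIV::'a set) < \<infinity>"
  unfolding radon_def by blast

text \<open>Regularity is restated as smallness of the remainder \<open>m (E - K)\<close>. Unlike
  the supremum over compact sets, this form passes directly to sums and multiples, since estimates
  on remainders add up.\<close>

lemma radonI:
  fixes m :: "'a::t2_space set \<Rightarrow> ennreal"
  assumes mono: "\<And>A B. A \<in> sets borel \<Longrightarrow> B \<in> sets borel \<Longrightarrow> A \<subseteq> B \<Longrightarrow> m A \<le> m B"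
    and subadd: "\<And>A B. A \<in> sets borel \<Longrightarrow> B \<in> sets borel \<Longrightarrow> A \<inter> B = {} \<Longrightarrow> m (A \<union> B) \<le> m A + m B"
    and fin: "m UNIV < \<infinity>"
    and reg: "\<And>E e. E \<in> sets borel \<Longrightarrow> e > 0 \<Longrightarrow> \<exists>K. compact K \<and> K \<subseteq> E \<and> m (E - K) \<le> ennreal e"
  shows "radon m"
  unfolding radon_def
proof (intro conjI ballI allI impI)
  fix K :: "'a set" assume "compact K"
  then have "m K \<le> m UNIV"
    by (intro mono) (auto intro: borel_compact)
  then show "m K < \<infinity>"
    using fin by (rule le_less_trans)
next
  fix E :: "'a set" assume E: "E \<in> sets borel"
  show "m E = (SUP K\<in>{K. compact K \<and> K \<subseteq> E}. m K)"
  proof (rule antisym)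
    show "(SUP K\<in>{K. compact K \<and> K \<subseteq> E}. m K) \<le> m E"
      using E by (intro SUP_least mono) (auto intro: borel_compact)
    show "m E \<le> (SUP K\<in>{K. compact K \<and> K \<subseteq> E}. m K)" (is "_ \<le> ?s")
    proof (rule ennreal_le_epsilon)
      fix e :: real assume "0 < e"
      obtain K where K: "compact K" "K \<subseteq> E" "m (E - K) \<le> ennreal e"
        using reg[OF E \<open>0 < e\<close>] by auto
      have "m (K \<union> (E - K)) \<le> m K + m (E - K)"
        using K E by (intro subadd) (auto intro: borel_compact)
      also have "\<dots> \<le> ?s + ennreal e"
        using K by (intro add_mono SUP_upper) auto
      finally show "m E \<le> ?s + ennreal e"
        using K(2) by (simp add: Un_absorb1)
    qed
  qed
qed

lemma radon_measuresI:
  fixes \<mu> :: "'a::t2_space set \<Rightarrow> complex"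
  assumes \<mu>: "complex_borel_measure \<mu>"
    and fin: "total_variation \<mu> UNIV < \<infinity>"
    and reg: "\<And>E e. E \<in> sets borel \<Longrightarrow> e > 0 \<Longrightarrow>
      \<exists>K. compact K \<and> K \<subseteq> E \<and> total_variation \<mu> (E - K) \<le> ennreal e"
  shows "\<mu> \<in> radon_measures"
  unfolding radon_measures_def using \<mu> fin reg
  by (auto intro!: radonI total_variation_mono total_variation_subadditive)

lemma radon_measures_complex_borel_measure:
  "\<mu> \<in> radon_measures \<Longrightarrow> complex_borel_measure \<mu>"
  by (simp add: radon_measures_def)

lemma total_variation_finite:
  fixes \<mu> :: "'a::topological_space set \<Rightarrow> complex"
  assumes "\<mu> \<in> radon_measures" "compact (UNIV :: 'a set)"
  shows "total_variation \<mu> UNIV < \<infinity>"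
  using assms finite_if_radon_compact[of "total_variation \<mu>"] by (simp add: radon_measures_def)

text \<open>The converse of the criterion in \<open>radon_measuresI\<close>. On a compact space the
  variation is finite, so by superadditivity a compact set that nearly exhausts the variation of E
  leaves a remainder of small variation.\<close>

lemma radon_measures_inner_regular:
  fixes \<mu> :: "'a::t2_space set \<Rightarrow> complex"
  assumes \<mu>: "\<mu> \<in> radon_measures" and c: "compact (UNIV :: 'a set)"
    and E: "E \<in> sets borel" and "e > 0"
  obtains K where "compact K" "K \<subseteq> E" "total_variation \<mu> (E - K) \<le> ennreal e"
proof -
  note cbm = radon_measures_complex_borel_measure[OF \<mu>]
  have "total_variation \<mu> E \<le> total_variation \<mu> UNIV"
    using E by (intro total_variation_mono[OF cbm]) auto
  then have fin: "total_variation \<mu> E < \<infinity>"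
    using total_variation_finite[OF \<mu> c] by (rule le_less_trans)
  obtain K where K: "compact K" "K \<subseteq> E" "total_variation \<mu> E \<le> total_variation \<mu> K + ennreal e"
    using inner_regular_if_radon[where m = "total_variation \<mu>", OF _ E fin \<open>e > 0\<close>] \<mu> by (auto simp: radon_measures_def)
  have K': "K \<in> sets borel"
    using K by (auto intro: borel_compact)
  have "total_variation \<mu> K + total_variation \<mu> (E - K) \<le> total_variation \<mu> (K \<union> (E - K))"
    using E K' by (intro total_variation_superadditive[OF cbm]) auto
  also have "K \<union> (E - K) = E"
    using K by auto
  finally have "total_variation \<mu> K + total_variation \<mu> (E - K) \<le> total_variation \<mu> K + ennreal e"
    using K(3) by (rule order.trans)
  moreover have "total_variation \<mu> K \<le> total_variation \<mu> E"
    using E K' K by (intro total_variation_mono[OF cbm]) auto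
  then have "total_variation \<mu> K < \<infinity>"
    using fin by (rule le_less_trans)
  ultimately have "total_variation \<mu> (E - K) \<le> ennreal e"
    by (auto simp: ennreal_add_left_cancel_le)
  then show ?thesis
    using that K by auto
qed

lemma radon_measures_add:
  fixes \<mu> \<nu> :: "'a::t2_space set \<Rightarrow> complex"
  assumes c: "compact (UNIV :: 'a set)" and \<mu>: "\<mu> \<in> radon_measures" and \<nu>: "\<nu> \<in> radon_measures"
  shows "(\<lambda>E. \<mu> E + \<nu> E) \<in> radon_measures"
proof (rule radon_measuresI)
  note cbm = radon_measures_complex_borel_measure[OF \<mu>] radon_measures_complex_borel_measure[OF \<nu>]
  show "complex_borel_measure (\<lambda>E. \<mu> E + \<nu> E)"
    using cbm by (rule complex_borel_measure_add)
  show "total_variation (\<lambda>E. \<mu> E + \<nu> E) UNIV < \<infinity>"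
    using total_variation_add_le[of \<mu> \<nu> UNIV] total_variation_finite[OF \<mu> c]
      total_variation_finite[OF \<nu> c]
    by (metis ennreal_add_less_top infinity_ennreal_def le_less_trans)
  fix E :: "'a set" and e :: real assume E: "E \<in> sets borel" and "e > 0"
  then have e: "e/2 > 0" by simp
  obtain K where K: "compact K" "K \<subseteq> E" "total_variation \<mu> (E - K) \<le> ennreal (e/2)"
    using radon_measures_inner_regular[OF \<mu> c E e] .
  obtain L where L: "compact L" "L \<subseteq> E" "total_variation \<nu> (E - L) \<le> ennreal (e/2)"
    using radon_measures_inner_regular[OF \<nu> c E e] .
  have KL: "K \<in> sets borel" "L \<in> sets borel"
    using K L by (auto intro: borel_compact)
  have "total_variation \<mu> (E - (K \<union> L)) + total_variation \<nu> (E - (K \<union> L))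
      \<le> total_variation \<mu> (E - K) + total_variation \<nu> (E - L)"
    using E KL by (intro add_mono total_variation_mono cbm) auto
  also have "\<dots> \<le> ennreal (e/2) + ennreal (e/2)"
    using K L by (intro add_mono)
  also have "\<dots> = ennreal e"
    using \<open>e > 0\<close> by (simp flip: ennreal_plus)
  finally have "total_variation (\<lambda>E. \<mu> E + \<nu> E) (E - (K \<union> L)) \<le> ennreal e"
    using total_variation_add_le order.trans by blast
  then show "\<exists>K. compact K \<and> K \<subseteq> E \<and> total_variation (\<lambda>E. \<mu> E + \<nu> E) (E - K) \<le> ennreal e"
    using K L by (intro exI[of _ "K \<union> L"]) auto
qed

lemma radon_measures_cmult:
  fixes \<mu> :: "'a::t2_space set \<Rightarrow> complex"
  assumes c: "compact (UNIV :: 'a set)" and \<mu>: "\<mu> \<in> radon_measures"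
  shows "(\<lambda>E. c * \<mu> E) \<in> radon_measures"
proof (rule radon_measuresI)
  show "complex_borel_measure (\<lambda>E. c * \<mu> E)"
    using radon_measures_complex_borel_measure[OF \<mu>] by (rule complex_borel_measure_cmult)
  show "total_variation (\<lambda>E. c * \<mu> E) UNIV < \<infinity>"
    using total_variation_cmult_le[of c \<mu> UNIV] total_variation_finite[OF \<mu> assms(1)]
    by (metis ennreal_less_top ennreal_mult_less_top infinity_ennreal_def le_less_trans)
  fix E :: "'a set" and e :: real assume E: "E \<in> sets borel" and "e > 0"
  \<comment> \<open>The summand 1 covers the case \<open>c = 0\<close>.\<close>
  then have "e / (cmod c + 1) > 0"
    by (intro divide_pos_pos) (auto intro: add_nonneg_pos)
  then obtain K where K: "compact K" "K \<subseteq> E" "total_variation \<mu> (E - K) \<le> ennreal (e / (cmod c + 1))"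
    using radon_measures_inner_regular[OF \<mu> assms(1) E] by blast
  have "ennreal (cmod c) * total_variation \<mu> (E - K) \<le> ennreal (cmod c) * ennreal (e / (cmod c + 1))"
    using K by (intro mult_left_mono) auto
  also have "\<dots> = ennreal (cmod c * (e / (cmod c + 1)))"
    using \<open>e > 0\<close> by (intro ennreal_mult[symmetric]) (auto intro: add_nonneg_pos)
  also have "\<dots> \<le> ennreal e"
  proof (rule ennreal_leI)
    have "cmod c * e \<le> e * (cmod c + 1)"
      using \<open>e > 0\<close> by (simp add: algebra_simps)
    then show "cmod c * (e / (cmod c + 1)) \<le> e"
      by (simp add: pos_divide_le_eq add_nonneg_pos)
  qed
  finally have "total_variation (\<lambda>E. c * \<mu> E) (E - K) \<le> ennreal e"
    using total_variation_cmult_le order.trans by blast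
  then show "\<exists>K. compact K \<and> K \<subseteq> E \<and> total_variation (\<lambda>E. c * \<mu> E) (E - K) \<le> ennreal e"
    using K by blast
qed

lemma radon_measures_diff:
  fixes \<mu> \<nu> :: "'a::t2_space set \<Rightarrow> complex"
  assumes c: "compact (UNIV :: 'a set)" and \<mu>: "\<mu> \<in> radon_measures" and \<nu>: "\<nu> \<in> radon_measures"
  shows "(\<lambda>E. \<mu> E - \<nu> E) \<in> radon_measures"
  using radon_measures_add[OF c \<mu> radon_measures_cmult[OF c \<nu>, of "-1"]] by simp

lemma norm_le_tv_norm:
  fixes \<mu> :: "'a::topological_space set \<Rightarrow> complex"
  assumes \<mu>: "\<mu> \<in> radon_measures" and c: "compact (UNIV :: 'a set)"
  shows "cmod (\<mu> E) \<le> tv_norm \<mu>"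
proof (cases "E \<in> sets borel")
  case True
  note cbm = radon_measures_complex_borel_measure[OF \<mu>]
  have "ennreal (cmod (\<mu> E)) \<le> total_variation \<mu> UNIV"
    using norm_le_total_variation[OF True] total_variation_mono[OF cbm True, of UNIV]
    by (meson order.trans sets.top subset_UNIV borel_open open_UNIV)
  then show ?thesis
    unfolding tv_norm_def using total_variation_finite[OF \<mu> c] enn2real_mono by fastforce
next
  case False
  then show ?thesis
    using complex_borel_measure_not_borel[OF radon_measures_complex_borel_measure[OF \<mu>] False]
    by (simp add: tv_norm_def)
qed

section \<open>Jordan decomposition and integration\<close>

text \<open>The bound B is what makes \<open>upper_variation\<close> a finite measure. For the real
  and imaginary parts of a Radon measure it is supplied by the total variation norm.\<close>

definition signed_borel_measure :: "('a::topological_space set \<Rightarrow> real) \<Rightarrow> bool" where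
  "signed_borel_measure \<nu> \<longleftrightarrow>
     (\<forall>A :: nat \<Rightarrow> 'a set. range A \<subseteq> sets borel \<longrightarrow> disjoint_family A \<longrightarrow>
        (\<lambda>n. \<nu> (A n)) sums \<nu> (\<Union>n. A n)) \<and>
     (\<exists>B. \<forall>E\<in>sets borel. \<bar>\<nu> E\<bar> \<le> B)"

lemma signed_borel_measure_sums:
  "signed_borel_measure \<nu> \<Longrightarrow> range A \<subseteq> sets borel \<Longrightarrow> disjoint_family A \<Longrightarrow>
    (\<lambda>n. \<nu> (A n)) sums \<nu> (\<Union>n. A n)"
  by (simp add: signed_borel_measure_def)

lemma signed_borel_measure_uminus:
  "signed_borel_measure \<nu> \<Longrightarrow> signed_borel_measure (\<lambda>E. - \<nu> E)"
  by (simp add: signed_borel_measure_def sums_minus)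

lemma signed_borel_measure_empty:
  assumes "signed_borel_measure \<nu>"
  shows "\<nu> {} = 0"
proof -
  have "(\<lambda>n::nat. \<nu> {}) sums \<nu> (\<Union>n::nat. {})"
    by (rule signed_borel_measure_sums[OF assms]) (auto simp: disjoint_family_on_def)
  then have "summable (\<lambda>n::nat. \<nu> {})"
    by (rule sums_summable)
  then show ?thesis
    by (simp add: summable_const_iff)
qed

lemma signed_borel_measure_Un:
  assumes "signed_borel_measure \<nu>" "A \<in> sets borel" "B \<in> sets borel" "A \<inter> B = {}"
  shows "\<nu> (A \<union> B) = \<nu> A + \<nu> B"
proof -
  have "(\<lambda>n. \<nu> (binaryset A B n)) sums \<nu> (\<Union>n. binaryset A B n)"
    using assms
    by (intro signed_borel_measure_sums)
       (auto simp: disjoint_family_on_def binaryset_def)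
  moreover have "(\<lambda>n. \<nu> (binaryset A B n)) sums (\<nu> A + \<nu> B)"
    using signed_borel_measure_empty[OF assms(1)] by (rule binaryset_sums)
  ultimately show ?thesis
    by (simp add: UN_binaryset_eq sums_iff)
qed

lemma
  fixes \<mu> :: "'a::topological_space set \<Rightarrow> complex"
  assumes \<mu>: "\<mu> \<in> radon_measures" and c: "compact (UNIV :: 'a set)"
  shows signed_borel_measure_Re: "signed_borel_measure (\<lambda>E. Re (\<mu> E))"
    and signed_borel_measure_Im: "signed_borel_measure (\<lambda>E. Im (\<mu> E))"
proof -
  have "(\<lambda>n. \<mu> (A n)) sums \<mu> (\<Union>n. A n)"
    if "range A \<subseteq> sets borel" "disjoint_family A" for A :: "nat \<Rightarrow> 'a set"
    using radon_measures_complex_borel_measure[OF \<mu>] that by (rule complex_borel_measure_sums)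
  moreover have "\<bar>Re (\<mu> E)\<bar> \<le> tv_norm \<mu>" "\<bar>Im (\<mu> E)\<bar> \<le> tv_norm \<mu>" for E
    using norm_le_tv_norm[OF \<mu> c, of E] abs_Re_le_cmod[of "\<mu> E"] abs_Im_le_cmod[of "\<mu> E"] by auto
  ultimately show "signed_borel_measure (\<lambda>E. Re (\<mu> E))" "signed_borel_measure (\<lambda>E. Im (\<mu> E))"
    unfolding signed_borel_measure_def
    by (intro conjI allI impI exI[of _ "tv_norm \<mu>"] ballI sums_Re sums_Im; assumption?; simp)+
qed

context
  fixes \<nu> :: "'a::topological_space set \<Rightarrow> real"
  assumes \<nu>: "signed_borel_measure \<nu>"
begin

lemma sets_upper_variation [simp]: "sets (upper_variation \<nu>) = sets borel"
  unfolding upper_variation_def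
  by (simp add: sets.sigma_sets_eq[of borel, simplified])

lemma space_upper_variation [simp]: "space (upper_variation \<nu>) = UNIV"
  by (simp add: upper_variation_def space_measure_of_conv)

text \<open>\<open>measure_of\<close> returns the prescribed supremum only once this is known to be
  countably additive. Superadditivity comes from uniting competitors for disjoint sets, countable
  subadditivity from cutting a competitor F along the sets \<open>A i\<close>. No Hahn decomposition
  is involved.\<close>

lemma emeasure_upper_variation:
  assumes "E \<in> sets borel"
  shows "emeasure (upper_variation \<nu>) E = (SUP F\<in>{F\<in>sets borel. F \<subseteq> E}. ennreal (\<nu> F))"
proof -
  define u where "u E = (SUP F\<in>{F\<in>sets borel. F \<subseteq> E}. ennreal (\<nu> F))" for E
  have upper: "ennreal (\<nu> F) \<le> u E" if "F \<in> sets borel" "F \<subseteq> E" for F E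
    unfolding u_def using that by (intro SUP_upper) auto
  have u_mono: "u A \<le> u B" if "A \<subseteq> B" for A B
    unfolding u_def using that by (intro SUP_subset_mono) auto
  have super: "u A + u B \<le> u (A \<union> B)" if "A \<inter> B = {}" for A B
  proof -
    have "ennreal (\<nu> F) + ennreal (\<nu> G) \<le> u (A \<union> B)"
      if "F \<in> sets borel" "F \<subseteq> A" "G \<in> sets borel" "G \<subseteq> B" for F G
    proof -
      have "\<nu> (F \<union> G) = \<nu> F + \<nu> G"
        using that \<open>A \<inter> B = {}\<close> by (intro signed_borel_measure_Un[OF \<nu>]) auto
      moreover have "ennreal (\<nu> (F \<union> G)) \<le> u (A \<union> B)" "ennreal (\<nu> F) \<le> u (A \<union> B)"
        "ennreal (\<nu> G) \<le> u (A \<union> B)"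
        using that by (auto intro!: upper)
      \<comment> \<open>If one of the two values is negative, \<open>ennreal\<close> truncates it to
        0 and the other competitor alone gives the bound.\<close>
      ultimately show ?thesis
        by (cases "\<nu> F \<ge> 0"; cases "\<nu> G \<ge> 0") (auto simp: ennreal_neg)
    qed
    then have "(SUP F\<in>{F\<in>sets borel. F \<subseteq> A}. SUP G\<in>{F\<in>sets borel. F \<subseteq> B}.
        ennreal (\<nu> F) + ennreal (\<nu> G)) \<le> u (A \<union> B)"
      by (intro SUP_least) auto
    also have "(SUP F\<in>{F\<in>sets borel. F \<subseteq> A}. SUP G\<in>{F\<in>sets borel. F \<subseteq> B}.
        ennreal (\<nu> F) + ennreal (\<nu> G)) = (SUP F\<in>{F\<in>sets borel. F \<subseteq> A}. ennreal (\<nu> F) + u B)"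
      unfolding u_def by (intro SUP_cong refl ennreal_SUP_add_right[symmetric]) auto
    also have "\<dots> = u A + u B"
      unfolding u_def[of A] by (intro ennreal_SUP_add_left) auto
    finally show ?thesis .
  qed
  have "emeasure (upper_variation \<nu>) E = u E"
  proof (rule emeasure_measure_of[OF upper_variation_def[of \<nu>, folded u_def]])
    show "positive (sets (upper_variation \<nu>)) u"
    proof -
      have "{F \<in> sets borel. F \<subseteq> {}} = {{} :: 'a set}"
        by auto
      then show ?thesis
        by (simp add: positive_def u_def signed_borel_measure_empty[OF \<nu>])
    qed
    show "countably_additive (sets (upper_variation \<nu>)) u"
    proof (rule countably_additiveI)
      fix A :: "nat \<Rightarrow> 'a set"
      assume A: "range A \<subseteq> sets (upper_variation \<nu>)" "disjoint_family A"
        "\<Union> (range A) \<in> sets (upper_variation \<nu>)"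
      have "(\<Sum>i<n. u (A i)) \<le> u (\<Union>i<n. A i)" for n
      proof (induction n)
        case (Suc n)
        have "(\<Sum>i<Suc n. u (A i)) \<le> u (\<Union>i<n. A i) + u (A n)"
          using Suc by (simp add: add_right_mono)
        also have "\<dots> \<le> u ((\<Union>i<n. A i) \<union> A n)"
        proof (rule super)
          have "A i \<inter> A n = {}" if "i < n" for i
            using A(2) that by (intro disjoint_family_onD) auto
          then show "(\<Union>i<n. A i) \<inter> A n = {}"
            by blast
        qed
        also have "(\<Union>i<n. A i) \<union> A n = (\<Union>i<Suc n. A i)"
          by (auto simp: lessThan_Suc)
        finally show ?case .
      qed simp
      then have "(\<Sum>i<n. u (A i)) \<le> u (\<Union>i. A i)" for n
        by (rule order.trans) (auto intro!: u_mono)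
      then have "(\<Sum>i. u (A i)) \<le> u (\<Union>i. A i)"
        by (intro suminf_le_const) auto
      moreover have "u (\<Union>i. A i) \<le> (\<Sum>i. u (A i))"
        unfolding u_def[of "\<Union>i. A i"]
      proof (rule SUP_least)
        fix F assume F: "F \<in> {F \<in> sets borel. F \<subseteq> (\<Union>i. A i)}"
        have "(\<lambda>i. \<nu> (F \<inter> A i)) sums \<nu> (\<Union>i. F \<inter> A i)"
          using F A by (intro signed_borel_measure_sums[OF \<nu>]) (auto simp: disjoint_family_on_def)
        moreover have "(\<Union>i. F \<inter> A i) = F"
          using F by auto
        ultimately have lim: "(\<lambda>n. ennreal (\<Sum>i<n. \<nu> (F \<inter> A i))) \<longlonglongrightarrow> ennreal (\<nu> F)"
          by (intro tendsto_ennrealI) (simp add: sums_def)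
        have "ennreal (\<Sum>i<n. \<nu> (F \<inter> A i)) \<le> (\<Sum>i. u (A i))" for n
        proof -
          \<comment> \<open>\<open>ennreal\<close> commutes with sums only for non-negative terms,
            so the terms are first replaced by their positive parts.\<close>
          have "ennreal (\<Sum>i<n. \<nu> (F \<inter> A i)) \<le> ennreal (\<Sum>i<n. max 0 (\<nu> (F \<inter> A i)))"
            by (intro ennreal_leI sum_mono) auto
          also have "\<dots> = (\<Sum>i<n. ennreal (\<nu> (F \<inter> A i)))"
          proof -
            have "ennreal (max 0 t) = ennreal t" for t :: real
              by (simp add: max_def ennreal_neg)
            then show ?thesis
              by (simp add: sum_ennreal[symmetric] del: sum_ennreal)
          qed
          also have "\<dots> \<le> (\<Sum>i<n. u (A i))"
            using F A by (intro sum_mono upper) auto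
          also have "\<dots> \<le> (\<Sum>i. u (A i))"
            by (intro sum_le_suminf) auto
          finally show ?thesis .
        qed
        then show "ennreal (\<nu> F) \<le> (\<Sum>i. u (A i))"
          by (intro LIMSEQ_le_const2[OF lim]) auto
      qed
      ultimately show "(\<Sum>i. u (A i)) = u (\<Union> (range A))"
        by (rule antisym)
    qed
  qed (use assms in auto)
  then show ?thesis
    by (simp add: u_def)
qed

lemma finite_measure_upper_variation: "finite_measure (upper_variation \<nu>)"
proof
  obtain B where B: "\<forall>E\<in>sets borel. \<bar>\<nu> E\<bar> \<le> B"
    using \<nu> by (auto simp: signed_borel_measure_def)
  have "emeasure (upper_variation \<nu>) UNIV \<le> ennreal B"
    using B by (subst emeasure_upper_variation) (auto intro!: SUP_least ennreal_leI simp: abs_le_iff)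
  then show "emeasure (upper_variation \<nu>) (space (upper_variation \<nu>)) \<noteq> \<infinity>"
    by (auto simp: top_unique)
qed

lemma le_measure_upper_variation:
  assumes "E \<in> sets borel" "F \<in> sets borel" "F \<subseteq> E"
  shows "\<nu> F \<le> measure (upper_variation \<nu>) E"
proof -
  interpret finite_measure "upper_variation \<nu>"
    by (rule finite_measure_upper_variation)
  have "ennreal (\<nu> F) \<le> emeasure (upper_variation \<nu>) E"
    using assms by (auto simp: emeasure_upper_variation intro!: SUP_upper)
  then show ?thesis
    by (simp add: emeasure_eq_measure ennreal_le_iff)
qed

lemma measure_upper_variation_le:
  assumes "E \<in> sets borel" and le: "\<And>F. F \<in> sets borel \<Longrightarrow> F \<subseteq> E \<Longrightarrow> \<nu> F \<le> c"
  shows "measure (upper_variation \<nu>) E \<le> c"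
proof -
  interpret finite_measure "upper_variation \<nu>"
    by (rule finite_measure_upper_variation)
  have "emeasure (upper_variation \<nu>) E \<le> ennreal c"
    using assms by (auto simp: emeasure_upper_variation intro!: SUP_least ennreal_leI)
  moreover have "0 \<le> c"
    using le[of "{}"] signed_borel_measure_empty[OF \<nu>] by simp
  ultimately show ?thesis
    by (simp add: emeasure_eq_measure ennreal_le_iff)
qed

end

text \<open>For F inside E, the value at F is that at E minus that at E - F, and the last
  contribution is at most the upper variation of the negative. The supremum over F gives one
  inequality; the same argument for the negative gives the other.\<close>

lemma Jordan_decomposition:
  assumes \<nu>: "signed_borel_measure \<nu>" and E: "E \<in> sets borel"
  shows "\<nu> E = measure (upper_variation \<nu>) E - measure (upper_variation (\<lambda>E. - \<nu> E)) E"
proof -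
  have "measure (upper_variation \<nu>) E \<le> \<nu> E + measure (upper_variation (\<lambda>E. - \<nu> E)) E"
    if \<nu>: "signed_borel_measure \<nu>" for \<nu>
  proof (rule measure_upper_variation_le[OF \<nu> E])
    fix F assume F: "F \<in> sets borel" "F \<subseteq> E"
    have "\<nu> (F \<union> (E - F)) = \<nu> F + \<nu> (E - F)"
      using E F by (intro signed_borel_measure_Un[OF \<nu>]) auto
    moreover have "F \<union> (E - F) = E"
      using F by auto
    moreover have "- \<nu> (E - F) \<le> measure (upper_variation (\<lambda>E. - \<nu> E)) E"
      using E F by (intro le_measure_upper_variation signed_borel_measure_uminus \<nu>) auto
    ultimately show "\<nu> F \<le> \<nu> E + measure (upper_variation (\<lambda>E. - \<nu> E)) E"
      by simp
  qed
  from this[OF \<nu>] this[OF signed_borel_measure_uminus[OF \<nu>]] show ?thesis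
    by simp
qed

section \<open>Bounded functionals on bounded Borel functions\<close>

definition bounded_borel_functions :: "('a::topological_space \<Rightarrow> complex) set" where
  "bounded_borel_functions = {f \<in> borel_measurable borel. bounded (range f)}"

text \<open>The estimate is required for every pointwise bound b, which avoids introducing a
  supremum norm. The notion serves to compare integrals: the Jordan parts of a sum of measures are
  not the sums of the Jordan parts, but integrals are functionals, and these can be compared on
  indicators.\<close>

definition bounded_linear_functional ::
    "(('a::topological_space \<Rightarrow> complex) \<Rightarrow> complex) \<Rightarrow> bool" where
  "bounded_linear_functional L \<longleftrightarrow>
     (\<forall>f\<in>bounded_borel_functions. \<forall>g\<in>bounded_borel_functions. L (\<lambda>x. f x + g x) = L f + L g) \<and>
     (\<forall>c. \<forall>f\<in>bounded_borel_functions. L (\<lambda>x. c * f x) = c * L f) \<and>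
     (\<exists>C. \<forall>f\<in>bounded_borel_functions. \<forall>b. (\<forall>x. cmod (f x) \<le> b) \<longrightarrow> cmod (L f) \<le> C * b)"

lemma bounded_linear_functional_add:
  "bounded_linear_functional L \<Longrightarrow> f \<in> bounded_borel_functions \<Longrightarrow> g \<in> bounded_borel_functions \<Longrightarrow>
    L (\<lambda>x. f x + g x) = L f + L g"
  by (simp add: bounded_linear_functional_def)

lemma bounded_linear_functional_cmult:
  "bounded_linear_functional L \<Longrightarrow> f \<in> bounded_borel_functions \<Longrightarrow> L (\<lambda>x. c * f x) = c * L f"
  by (simp add: bounded_linear_functional_def)

lemma bounded_linear_functional_bound:
  assumes "bounded_linear_functional L"
  obtains C where "\<forall>f\<in>bounded_borel_functions. \<forall>b. (\<forall>x. cmod (f x) \<le> b) \<longrightarrow> cmod (L f) \<le> C * b"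
  using assms unfolding bounded_linear_functional_def by blast

lemma bounded_borel_functions_add:
  "f \<in> bounded_borel_functions \<Longrightarrow> g \<in> bounded_borel_functions \<Longrightarrow>
    (\<lambda>x. f x + g x) \<in> bounded_borel_functions"
  unfolding bounded_borel_functions_def by (auto intro: bounded_plus_comp)

lemma bounded_borel_functions_cmult:
  "f \<in> bounded_borel_functions \<Longrightarrow> (\<lambda>x. c * f x) \<in> bounded_borel_functions"
  unfolding bounded_borel_functions_def
  using bounded_linear_image[of "range f" "\<lambda>x. c * x"]
  by (auto simp: image_image bounded_linear_mult_right)

lemma bounded_borel_functions_indicator:
  "E \<in> sets borel \<Longrightarrow> (indicator E :: 'a::topological_space \<Rightarrow> complex) \<in> bounded_borel_functions"
  unfolding bounded_borel_functions_def
  by (auto simp: indicator_def intro!: boundedI[of _ 1])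

lemma bounded_borel_functionsI:
  "f \<in> borel_measurable borel \<Longrightarrow> (\<And>x. cmod (f x) \<le> b) \<Longrightarrow> f \<in> bounded_borel_functions"
  unfolding bounded_borel_functions_def by (auto intro!: boundedI)

lemma continuous_bounded_borel_functions:
  assumes "continuous_on UNIV f" "compact (UNIV :: 'a::topological_space set)"
  shows "(f :: 'a \<Rightarrow> complex) \<in> bounded_borel_functions"
  unfolding bounded_borel_functions_def
  using assms by (auto intro: borel_measurable_continuous_onI compact_imp_bounded compact_continuous_image)

lemma bounded_linear_functional_sum_indicators:
  assumes L: "bounded_linear_functional L"
    and "finite S" and E: "\<And>i. i \<in> S \<Longrightarrow> E i \<in> sets borel"
  shows "(\<lambda>x. \<Sum>i\<in>S. c i * indicator (E i) x) \<in> bounded_borel_functions \<and>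
    L (\<lambda>x. \<Sum>i\<in>S. c i * indicator (E i) x) = (\<Sum>i\<in>S. c i * L (indicator (E i)))"
  using \<open>finite S\<close> E
proof (induction S)
  case empty
  have "(\<lambda>x::'a. 0::complex) \<in> bounded_borel_functions"
    by (rule bounded_borel_functionsI[of _ 0]) auto
  moreover from this have "L (\<lambda>x. 0 * 0) = 0 * L (\<lambda>x. 0)"
    by (rule bounded_linear_functional_cmult[OF L])
  ultimately show ?case by simp
next
  case (insert i S)
  have i: "(\<lambda>x. c i * indicator (E i) x) \<in> bounded_borel_functions"
    using insert by (intro bounded_borel_functions_cmult bounded_borel_functions_indicator) auto
  have "L (\<lambda>x. c i * indicator (E i) x) = c i * L (indicator (E i))"
    using L insert by (auto simp: bounded_linear_functional_def bounded_borel_functions_indicator)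
  moreover have "L (\<lambda>x. c i * indicator (E i) x + (\<Sum>i\<in>S. c i * indicator (E i) x)) =
      L (\<lambda>x. c i * indicator (E i) x) + L (\<lambda>x. \<Sum>i\<in>S. c i * indicator (E i) x)"
    using insert by (intro bounded_linear_functional_add[OF L i]) auto
  ultimately show ?case
    using insert bounded_borel_functions_add[OF i] by (simp del: sum_mult_indicator)
qed

lemma uniform_simple_approximation:
  assumes f: "f \<in> bounded_borel_functions" and "e > 0"
  obtains S and E :: "complex \<Rightarrow> 'a::topological_space set"
  where "finite S" "\<And>p. E p \<in> sets borel"
    "\<And>x. cmod (f x - (\<Sum>p\<in>S. p * indicator (E p) x)) \<le> e"
proof -
  \<comment> \<open>Real and imaginary part are rounded down to a grid of mesh \<open>1 / n\<close>,
    which is e/2, so the two errors add up to at most e. Boundedness of f leaves finitely many grid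
    values, and these index the simple function.\<close>
  define n :: real where "n = 2 / e"
  have n: "n > 0"
    using \<open>e > 0\<close> by (simp add: n_def)
  define r where "r t = of_int \<lfloor>n * t\<rfloor> / n" for t :: real
  define g where "g x = Complex (r (Re (f x))) (r (Im (f x)))" for x
  obtain b where b: "\<And>x. cmod (f x) \<le> b"
    using f by (auto simp: bounded_borel_functions_def bounded_iff)
  have r: "\<bar>t - r t\<bar> \<le> 1 / n" for t
  proof -
    have "t - r t = (n * t - of_int \<lfloor>n * t\<rfloor>) / n"
      using n by (simp add: r_def field_simps)
    moreover have "\<bar>n * t - of_int \<lfloor>n * t\<rfloor>\<bar> \<le> 1"
      by linarith
    ultimately show ?thesis
      using n by (simp add: divide_right_mono)
  qed
  define T where "T = (\<lambda>k::int. of_int k / n) ` {\<lfloor>- (n * b)\<rfloor>..\<lfloor>n * b\<rfloor>}"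
  have T: "r t \<in> T" if "\<bar>t\<bar> \<le> b" for t
  proof -
    have "n * \<bar>t\<bar> \<le> n * b"
      using n that by simp
    moreover have "\<bar>n * t\<bar> = n * \<bar>t\<bar>"
      using n by (simp add: abs_mult)
    ultimately have "n * t \<le> n * b" "- (n * b) \<le> n * t"
      by linarith+
    then show ?thesis
      unfolding T_def r_def by (auto intro!: imageI floor_mono)
  qed
  have "range g \<subseteq> (\<lambda>(s, t). Complex s t) ` (T \<times> T)"
  proof (rule image_subsetI)
    fix x
    have "\<bar>Re (f x)\<bar> \<le> b" "\<bar>Im (f x)\<bar> \<le> b"
      using b[of x] abs_Re_le_cmod[of "f x"] abs_Im_le_cmod[of "f x"] by auto
    then have "(r (Re (f x)), r (Im (f x))) \<in> T \<times> T"
      by (auto intro: T)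
    then show "g x \<in> (\<lambda>(s, t). Complex s t) ` (T \<times> T)"
      by (rule rev_image_eqI) (simp add: g_def)
  qed
  then have fin: "finite (range g)"
    by (rule finite_subset) (auto simp: T_def)
  have [measurable]: "f \<in> borel_measurable borel"
    using f by (simp add: bounded_borel_functions_def)
  have "g = (\<lambda>x. complex_of_real (r (Re (f x))) + \<i> * complex_of_real (r (Im (f x))))"
    by (auto simp: g_def complex_eq_iff)
  then have [measurable]: "g \<in> borel_measurable borel"
    unfolding r_def by simp
  show ?thesis
  proof
    show "finite (range g)" by fact
    show "g -` {p} \<in> sets borel" for p
      using measurable_sets[of g borel borel "{p}"] by simp
    fix x
    have "(\<Sum>p\<in>range g. p * indicator (g -` {p}) x) = (\<Sum>p\<in>{g x}. p * indicator (g -` {p}) x)"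
      using fin by (intro sum.mono_neutral_right) (auto simp: indicator_def)
    then have "(\<Sum>p\<in>range g. p * indicator (g -` {p}) x) = g x"
      by simp
    moreover have "cmod (f x - g x) \<le> \<bar>Re (f x - g x)\<bar> + \<bar>Im (f x - g x)\<bar>"
      by (rule cmod_le)
    moreover have "\<dots> \<le> 1 / n + 1 / n"
      using r by (intro add_mono) (auto simp: g_def)
    ultimately show "cmod (f x - (\<Sum>p\<in>range g. p * indicator (g -` {p}) x)) \<le> e"
      using \<open>e > 0\<close> by (simp add: n_def)
  qed
qed

lemma bounded_linear_functional_diff:
  assumes L: "bounded_linear_functional L"
    and f: "f \<in> bounded_borel_functions" and g: "g \<in> bounded_borel_functions"
  shows "L (\<lambda>x. f x - g x) = L f - L g"
proof -
  have g': "(\<lambda>x. (-1) * g x) \<in> bounded_borel_functions"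
    using g by (rule bounded_borel_functions_cmult)
  have "L (\<lambda>x. f x + (-1) * g x) = L f + L (\<lambda>x. (-1) * g x)"
    by (rule bounded_linear_functional_add[OF L f g'])
  also have "L (\<lambda>x. (-1) * g x) = (-1) * L g"
    by (rule bounded_linear_functional_cmult[OF L g])
  finally show ?thesis by simp
qed

text \<open>Simple functions are uniformly dense in the bounded Borel functions, and both
  functionals are Lipschitz for uniform distance.\<close>

lemma bounded_linear_functional_eqI:
  assumes L: "bounded_linear_functional L" and L': "bounded_linear_functional L'"
    and eq: "\<And>E. E \<in> sets borel \<Longrightarrow> L (indicator E) = L' (indicator E)"
    and f: "f \<in> bounded_borel_functions"
  shows "L f = L' f"
proof -
  obtain C where C: "\<forall>f\<in>bounded_borel_functions. \<forall>b. (\<forall>x. cmod (f x) \<le> b) \<longrightarrow> cmod (L f) \<le> C * b"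
    using bounded_linear_functional_bound[OF L] .
  obtain C' where C': "\<forall>f\<in>bounded_borel_functions. \<forall>b. (\<forall>x. cmod (f x) \<le> b) \<longrightarrow> cmod (L' f) \<le> C' * b"
    using bounded_linear_functional_bound[OF L'] .
  have "cmod (L f - L' f) \<le> 0"
  proof (rule field_le_epsilon)
    fix e :: real assume "e > 0"
    define d where "d = e / (\<bar>C\<bar> + \<bar>C'\<bar> + 1)"
    have "d > 0"
      using \<open>e > 0\<close> by (simp add: d_def)
    then obtain S and E :: "complex \<Rightarrow> 'a set" where S: "finite S" "\<And>p. E p \<in> sets borel"
      and approx: "\<And>x. cmod (f x - (\<Sum>p\<in>S. p * indicator (E p) x)) \<le> d"
      using uniform_simple_approximation[OF f] by blast
    define s where "s x = (\<Sum>p\<in>S. p * indicator (E p) x)" for x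
    have s: "s \<in> bounded_borel_functions" and Ls: "L s = L' s"
      unfolding s_def
      using bounded_linear_functional_sum_indicators[OF L S(1), of E "\<lambda>p. p"]
        bounded_linear_functional_sum_indicators[OF L' S(1), of E "\<lambda>p. p"] S eq
      by auto
    have fs: "(\<lambda>x. f x - s x) \<in> bounded_borel_functions"
      using bounded_borel_functions_add[OF f bounded_borel_functions_cmult[OF s, of "-1"]] by simp
    have "L f - L' f = L (\<lambda>x. f x - s x) - L' (\<lambda>x. f x - s x)"
      using Ls by (simp add: bounded_linear_functional_diff[OF L f s] bounded_linear_functional_diff[OF L' f s])
    also have "cmod \<dots> \<le> C * d + C' * d"
      using C C' fs approx unfolding s_def
      by (intro order.trans[OF norm_triangle_ineq4] add_mono) auto
    also have "\<dots> \<le> (\<bar>C\<bar> + \<bar>C'\<bar> + 1) * d"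
      using \<open>d > 0\<close> by (simp add: distrib_right[symmetric])
    also have "\<dots> = e"
      by (simp add: d_def)
    finally show "cmod (L f - L' f) \<le> 0 + e" by simp
  qed
  then show ?thesis by simp
qed

lemma integrable_bounded_borel:
  assumes \<nu>: "signed_borel_measure \<nu>" and f: "f \<in> bounded_borel_functions"
  shows "integrable (upper_variation \<nu>) f"
proof -
  interpret finite_measure "upper_variation \<nu>"
    by (rule finite_measure_upper_variation[OF \<nu>])
  obtain b where "\<And>x. cmod (f x) \<le> b"
    using f by (auto simp: bounded_borel_functions_def bounded_iff)
  then show ?thesis
    using f by (intro integrable_const_bound[of _ b])
      (auto simp: bounded_borel_functions_def measurable_cong_sets[OF sets_upper_variation[OF \<nu>] refl])
qed

lemma norm_integral_upper_variation_le:
  assumes \<nu>: "signed_borel_measure \<nu>" and f: "f \<in> bounded_borel_functions"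
    and A: "A \<in> sets borel" and b: "\<And>x. cmod (f x) \<le> b * indicator A x"
  shows "cmod (integral\<^sup>L (upper_variation \<nu>) f) \<le> b * measure (upper_variation \<nu>) A"
proof -
  interpret finite_measure "upper_variation \<nu>"
    by (rule finite_measure_upper_variation[OF \<nu>])
  have "cmod (integral\<^sup>L (upper_variation \<nu>) f) \<le> (\<integral>x. cmod (f x) \<partial>upper_variation \<nu>)"
    by (rule integral_norm_bound)
  also have "\<dots> \<le> (\<integral>x. b * indicator A x \<partial>upper_variation \<nu>)"
    using b integrable_bounded_borel[OF \<nu> f] A \<nu>
    by (intro integral_mono integrable_norm integrable_mult_right)
       (auto simp: emeasure_eq_measure intro!: integrable_real_indicator)
  also have "\<dots> = b * measure (upper_variation \<nu>) A"
    using A \<nu> by simp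
  finally show ?thesis .
qed

lemma signed_integral_bounded_linear_functional:
  assumes \<nu>: "signed_borel_measure \<nu>"
  shows "bounded_linear_functional (signed_integral \<nu>)"
  unfolding bounded_linear_functional_def
proof (intro conjI ballI allI impI)
  note \<nu>' = signed_borel_measure_uminus[OF \<nu>]
  note int = integrable_bounded_borel[OF \<nu>] integrable_bounded_borel[OF \<nu>']
  fix f :: "'a \<Rightarrow> complex" assume f: "f \<in> bounded_borel_functions"
  show "signed_integral \<nu> (\<lambda>x. c * f x) = c * signed_integral \<nu> f" for c
    using int f by (simp add: signed_integral_def right_diff_distrib)
  fix g :: "'a \<Rightarrow> complex" assume "g \<in> bounded_borel_functions"
  then show "signed_integral \<nu> (\<lambda>x. f x + g x) = signed_integral \<nu> f + signed_integral \<nu> g"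
    using int f by (simp add: signed_integral_def)
next
  note \<nu>' = signed_borel_measure_uminus[OF \<nu>]
  show "\<exists>C. \<forall>f\<in>bounded_borel_functions. \<forall>b. (\<forall>x. cmod (f x) \<le> b) \<longrightarrow> cmod (signed_integral \<nu> f) \<le> C * b"
  proof (intro exI ballI allI impI)
    fix f :: "'a \<Rightarrow> complex" and b assume "f \<in> bounded_borel_functions" "\<forall>x. cmod (f x) \<le> b"
    then have "cmod (signed_integral \<nu> f) \<le>
        b * measure (upper_variation \<nu>) UNIV + b * measure (upper_variation (\<lambda>E. - \<nu> E)) UNIV"
      unfolding signed_integral_def
      by (intro order.trans[OF norm_triangle_ineq4] add_mono
          norm_integral_upper_variation_le \<nu> \<nu>') auto
    then show "cmod (signed_integral \<nu> f) \<le>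
        (measure (upper_variation \<nu>) UNIV + measure (upper_variation (\<lambda>E. - \<nu> E)) UNIV) * b"
      by (simp add: algebra_simps)
  qed
qed

lemma signed_integral_indicator:
  assumes \<nu>: "signed_borel_measure \<nu>" and E: "E \<in> sets borel"
  shows "signed_integral \<nu> (indicator E) = of_real (\<nu> E)"
proof -
  have "integral\<^sup>L (upper_variation \<nu>) (indicator E) = complex_of_real (measure (upper_variation \<nu>) E)"
    if \<nu>: "signed_borel_measure \<nu>" for \<nu>
  proof -
    interpret finite_measure "upper_variation \<nu>"
      by (rule finite_measure_upper_variation[OF \<nu>])
    have "integral\<^sup>L (upper_variation \<nu>) (indicator E :: 'a \<Rightarrow> complex) =
        (\<integral>x. complex_of_real (indicator E x) \<partial>upper_variation \<nu>)"
      by (intro Bochner_Integration.integral_cong) (auto simp: indicator_def)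
    also have "\<dots> = complex_of_real (\<integral>x. indicator E x \<partial>upper_variation \<nu>)"
      by (rule integral_complex_of_real)
    also have "(\<integral>x. indicator E x \<partial>upper_variation \<nu>) = measure (upper_variation \<nu>) E"
      using E \<nu> by simp
    finally show ?thesis .
  qed
  from this[OF \<nu>] this[OF signed_borel_measure_uminus[OF \<nu>]]
  show ?thesis
    using Jordan_decomposition[OF \<nu> E] by (simp add: signed_integral_def)
qed

lemma bounded_linear_functional_combine:
  assumes L: "bounded_linear_functional L" and L': "bounded_linear_functional L'"
  shows "bounded_linear_functional (\<lambda>f. a * L f + b * L' f)"
proof -
  obtain C where C: "\<forall>f\<in>bounded_borel_functions. \<forall>b. (\<forall>x. cmod (f x) \<le> b) \<longrightarrow> cmod (L f) \<le> C * b"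
    using bounded_linear_functional_bound[OF L] .
  obtain C' where C': "\<forall>f\<in>bounded_borel_functions. \<forall>b. (\<forall>x. cmod (f x) \<le> b) \<longrightarrow> cmod (L' f) \<le> C' * b"
    using bounded_linear_functional_bound[OF L'] .
  have "cmod (a * L f + b * L' f) \<le> (cmod a * C + cmod b * C') * t"
    if "f \<in> bounded_borel_functions" "\<forall>x. cmod (f x) \<le> t" for f t
  proof -
    have "cmod (a * L f + b * L' f) \<le> cmod a * cmod (L f) + cmod b * cmod (L' f)"
      using norm_triangle_ineq[of "a * L f" "b * L' f"] by (simp add: norm_mult)
    also have "\<dots> \<le> cmod a * (C * t) + cmod b * (C' * t)"
      using that C C' by (intro add_mono mult_left_mono) auto
    finally show ?thesis by (simp add: algebra_simps)
  qed
  then have "\<exists>C. \<forall>f\<in>bounded_borel_functions. \<forall>t. (\<forall>x. cmod (f x) \<le> t) \<longrightarrow>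
      cmod (a * L f + b * L' f) \<le> C * t"
    by blast
  then show ?thesis
    unfolding bounded_linear_functional_def
    by (simp add: bounded_linear_functional_add[OF L] bounded_linear_functional_add[OF L']
        bounded_linear_functional_cmult[OF L] bounded_linear_functional_cmult[OF L'] algebra_simps)
qed

lemma complex_integral_bounded_linear_functional:
  fixes \<mu> :: "'a::topological_space set \<Rightarrow> complex"
  assumes \<mu>: "\<mu> \<in> radon_measures" and c: "compact (UNIV :: 'a set)"
  shows "bounded_linear_functional (complex_integral \<mu>)"
  using bounded_linear_functional_combine[where a = 1 and b = \<i>,
      OF signed_integral_bounded_linear_functional[OF signed_borel_measure_Re[OF \<mu> c]]
        signed_integral_bounded_linear_functional[OF signed_borel_measure_Im[OF \<mu> c]]]
  by (simp add: complex_integral_def[abs_def])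

lemma complex_integral_indicator:
  fixes \<mu> :: "'a::topological_space set \<Rightarrow> complex"
  assumes \<mu>: "\<mu> \<in> radon_measures" and c: "compact (UNIV :: 'a set)" and E: "E \<in> sets borel"
  shows "complex_integral \<mu> (indicator E) = \<mu> E"
  using signed_integral_indicator[OF signed_borel_measure_Re[OF \<mu> c] E]
    signed_integral_indicator[OF signed_borel_measure_Im[OF \<mu> c] E]
  by (simp add: complex_integral_def complex_eq_iff)

lemma measure_upper_variation_le_total_variation:
  assumes \<nu>: "signed_borel_measure \<nu>" and \<mu>: "complex_borel_measure \<mu>"
    and le: "\<And>E. \<nu> E \<le> cmod (\<mu> E)"
    and E: "E \<in> sets borel" and e: "total_variation \<mu> E \<le> ennreal e" "0 \<le> e"
  shows "measure (upper_variation \<nu>) E \<le> e"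
proof (rule measure_upper_variation_le[OF \<nu> E])
  fix F assume F: "F \<in> sets borel" "F \<subseteq> E"
  have "ennreal (cmod (\<mu> F)) \<le> ennreal e"
    using norm_le_total_variation[OF F(1)] total_variation_mono[OF \<mu> F(1) E F(2)] e(1)
    by (meson order.trans)
  then show "\<nu> F \<le> e"
    using le[of F] e by simp
qed

text \<open>The factor 4 counts the upper and lower variations of the real and the imaginary part,
  each of mass at most e on A. The estimate is localised to A so that it can be combined with inner
  regularity, where A is a small remainder.\<close>

lemma norm_complex_integral_le:
  fixes \<mu> :: "'a::topological_space set \<Rightarrow> complex"
  assumes \<mu>: "\<mu> \<in> radon_measures" and c: "compact (UNIV :: 'a set)"
    and f: "f \<in> bounded_borel_functions"
    and A: "A \<in> sets borel" and b: "\<And>x. cmod (f x) \<le> b * indicator A x" "0 \<le> b"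
    and e: "total_variation \<mu> A \<le> ennreal e" "0 \<le> e"
  shows "cmod (complex_integral \<mu> f) \<le> 4 * b * e"
proof -
  note cbm = radon_measures_complex_borel_measure[OF \<mu>]
  have *: "cmod (signed_integral \<nu> f) \<le> b * e + b * e"
    if \<nu>: "signed_borel_measure \<nu>" and le: "\<And>E. \<bar>\<nu> E\<bar> \<le> cmod (\<mu> E)" for \<nu>
  proof -
    have le': "\<nu> E \<le> cmod (\<mu> E)" "- \<nu> E \<le> cmod (\<mu> E)" for E
      using le[of E] by linarith+
    have "cmod (signed_integral \<nu> f) \<le>
        b * measure (upper_variation \<nu>) A + b * measure (upper_variation (\<lambda>E. - \<nu> E)) A"
      unfolding signed_integral_def
      by (intro order.trans[OF norm_triangle_ineq4] add_mono norm_integral_upper_variation_le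
            signed_borel_measure_uminus \<nu> f A b)
    also have "\<dots> \<le> b * e + b * e"
      by (intro add_mono mult_left_mono
            measure_upper_variation_le_total_variation[OF _ cbm _ A e]
            signed_borel_measure_uminus \<nu> le' b)
    finally show ?thesis .
  qed
  have "cmod (complex_integral \<mu> f) \<le>
      cmod (signed_integral (\<lambda>E. Re (\<mu> E)) f) + cmod (signed_integral (\<lambda>E. Im (\<mu> E)) f)"
    unfolding complex_integral_def by (rule order.trans[OF norm_triangle_ineq]) (simp add: norm_mult)
  also have "\<dots> \<le> (b * e + b * e) + (b * e + b * e)"
    by (intro add_mono * signed_borel_measure_Re[OF \<mu> c] signed_borel_measure_Im[OF \<mu> c]
          abs_Re_le_cmod abs_Im_le_cmod)
  finally show ?thesis by simp
qed

lemma norm_complex_integral_le_tv_norm: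
  fixes \<mu> :: "'a::topological_space set \<Rightarrow> complex"
  assumes \<mu>: "\<mu> \<in> radon_measures" and c: "compact (UNIV :: 'a set)"
    and f: "f \<in> bounded_borel_functions" and b: "\<And>x. cmod (f x) \<le> b"
  shows "cmod (complex_integral \<mu> f) \<le> 4 * b * tv_norm \<mu>"
proof (rule norm_complex_integral_le[OF \<mu> c f, of UNIV])
  show "0 \<le> b"
    using b[of undefined] by (rule order.trans[OF norm_ge_zero])
  show "total_variation \<mu> UNIV \<le> ennreal (tv_norm \<mu>)"
    using total_variation_finite[OF \<mu> c] by (simp add: tv_norm_def)
qed (use b in \<open>auto simp: tv_norm_def\<close>)

text \<open>Linearity in the measure cannot be read off the Jordan parts. Both sides of each
  identity are bounded functionals of f with the same values on indicators.\<close>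

lemma
  fixes \<mu> \<nu> :: "'a::t2_space set \<Rightarrow> complex"
  assumes c: "compact (UNIV :: 'a set)" and \<mu>: "\<mu> \<in> radon_measures"
    and f: "f \<in> bounded_borel_functions"
  shows complex_integral_cmult: "complex_integral (\<lambda>E. k * \<mu> E) f = k * complex_integral \<mu> f"
    and complex_integral_add: "\<nu> \<in> radon_measures \<Longrightarrow>
      complex_integral (\<lambda>E. \<mu> E + \<nu> E) f = complex_integral \<mu> f + complex_integral \<nu> f"
    and complex_integral_diff: "\<nu> \<in> radon_measures \<Longrightarrow>
      complex_integral (\<lambda>E. \<mu> E - \<nu> E) f = complex_integral \<mu> f - complex_integral \<nu> f"
proof -
  note int = complex_integral_bounded_linear_functional[OF _ c]
  \<comment> \<open>The summand with coefficient 0 gives the right-hand side the shape expected by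
    \<open>bounded_linear_functional_combine\<close>.\<close>
  have "complex_integral (\<lambda>E. k * \<mu> E) f = k * complex_integral \<mu> f + 0 * complex_integral \<mu> f"
    by (rule bounded_linear_functional_eqI[OF int bounded_linear_functional_combine[OF int int] _ f])
       (simp_all add: radon_measures_cmult c \<mu> complex_integral_indicator)
  then show "complex_integral (\<lambda>E. k * \<mu> E) f = k * complex_integral \<mu> f"
    by simp
  assume \<nu>: "\<nu> \<in> radon_measures"
  have "complex_integral (\<lambda>E. \<mu> E + \<nu> E) f = 1 * complex_integral \<mu> f + 1 * complex_integral \<nu> f"
    by (rule bounded_linear_functional_eqI[OF int bounded_linear_functional_combine[OF int int] _ f])
       (simp_all add: radon_measures_add c \<mu> \<nu> complex_integral_indicator)
  then show "complex_integral (\<lambda>E. \<mu> E + \<nu> E) f = complex_integral \<mu> f + complex_integral \<nu> f"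
    by simp
  have "complex_integral (\<lambda>E. \<mu> E - \<nu> E) f = 1 * complex_integral \<mu> f + (- 1) * complex_integral \<nu> f"
    by (rule bounded_linear_functional_eqI[OF int bounded_linear_functional_combine[OF int int] _ f])
       (simp_all add: radon_measures_diff c \<mu> \<nu> complex_integral_indicator)
  then show "complex_integral (\<lambda>E. \<mu> E - \<nu> E) f = complex_integral \<mu> f - complex_integral \<nu> f"
    by simp
qed

section \<open>Continuous functions determine a Radon measure\<close>

lemma Urysohn_compact_t2:
  fixes K C :: "'a::t2_space set"
  assumes c: "compact (UNIV :: 'a set)" and "closed K" "closed C" "K \<inter> C = {}"
  obtains f :: "'a \<Rightarrow> real" where "continuous_on UNIV f" "\<And>x. 0 \<le> f x \<and> f x \<le> 1"
    "\<And>x. x \<in> K \<Longrightarrow> f x = 1" "\<And>x. x \<in> C \<Longrightarrow> f x = 0"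
proof -
  have "normal_space (euclidean :: 'a topology)"
    using c by (intro compact_Hausdorff_or_regular_imp_normal_space)
      (use hausdorff in \<open>fastforce simp: compact_space_def Hausdorff_space_def disjnt_def\<close>)+
  then obtain f :: "'a \<Rightarrow> real" where f: "continuous_map euclidean (top_of_set {0..1}) f"
    "f ` C \<subseteq> {0}" "f ` K \<subseteq> {1}"
    using Urysohn_lemma[of euclidean C K 0 1] assms by (auto simp: disjnt_def)
  have "continuous_on UNIV f" "\<And>x. 0 \<le> f x \<and> f x \<le> 1"
    using f(1) by (auto simp: continuous_map_in_subtopology)
  then show ?thesis
    using that f by (auto simp: image_subset_iff)
qed

text \<open>The uniqueness part of the Riesz representation theorem, proved for the difference
  \<rho>. For compact K, a Urysohn function that is 1 on K and 0 on a compact C nearly exhausting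
  the complement differs from the indicator of K only on the remainder, where \<rho> has small
  variation. Inner regularity passes from compact sets to Borel sets.\<close>

lemma radon_measures_eqI:
  fixes \<mu> \<nu> :: "'a::t2_space set \<Rightarrow> complex"
  assumes c: "compact (UNIV :: 'a set)" and \<mu>: "\<mu> \<in> radon_measures" and \<nu>: "\<nu> \<in> radon_measures"
    and eq: "\<And>f. continuous_on UNIV f \<Longrightarrow> complex_integral \<mu> f = complex_integral \<nu> f"
  shows "\<mu> = \<nu>"
proof -
  define \<rho> where "\<rho> E = \<mu> E - \<nu> E" for E
  have \<rho>: "\<rho> \<in> radon_measures"
    using radon_measures_diff[OF c \<mu> \<nu>] by (simp add: \<rho>_def[abs_def])
  note cbm = radon_measures_complex_borel_measure[OF \<rho>]
  have int0: "complex_integral \<rho> f = 0" if "continuous_on UNIV f" for f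
    using complex_integral_diff[OF c \<mu> _ \<nu>] eq that continuous_bounded_borel_functions[OF that c]
    by (simp add: \<rho>_def[abs_def])
  have compact0: "\<rho> K = 0" if K: "compact K" for K
  proof -
    have Kb: "K \<in> sets borel"
      using K by (rule borel_compact)
    have "cmod (\<rho> K) \<le> 0"
    proof (rule field_le_epsilon)
      fix e :: real assume "e > 0"
      \<comment> \<open>The denominator 4 cancels the factor in
        \<open>norm_complex_integral_le\<close>.\<close>
      then obtain C where C: "compact C" "C \<subseteq> - K" "total_variation \<rho> (- K - C) \<le> ennreal (e / 4)"
        using radon_measures_inner_regular[OF \<rho> c, of "- K" "e / 4"] Kb by auto
      have Cb: "C \<in> sets borel"
        using C(1) by (rule borel_compact)
      obtain f :: "'a \<Rightarrow> real" where f: "continuous_on UNIV f" "\<And>x. 0 \<le> f x \<and> f x \<le> 1"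
        "\<And>x. x \<in> K \<Longrightarrow> f x = 1" "\<And>x. x \<in> C \<Longrightarrow> f x = 0"
        using Urysohn_compact_t2[OF c compact_imp_closed[OF K] compact_imp_closed[OF C(1)]] C(2)
        by blast
      define g where "g x = complex_of_real (f x)" for x
      have g: "continuous_on UNIV g"
        unfolding g_def using f(1) by (intro continuous_intros)
      note gb = continuous_bounded_borel_functions[OF g c]
      have gK: "(\<lambda>x. g x - indicator K x) \<in> bounded_borel_functions"
        using bounded_borel_functions_add[OF gb bounded_borel_functions_cmult[OF
              bounded_borel_functions_indicator[OF Kb], of "-1"]] by simp
      have "cmod (complex_integral \<rho> (\<lambda>x. g x - indicator K x)) \<le> 4 * 1 * (e / 4)"
      proof (rule norm_complex_integral_le[OF \<rho> c gK _ _ _ C(3)])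
        show "cmod (g x - indicator K x) \<le> 1 * indicator (- K - C) x" for x
          using f(2)[of x] f(3)[of x] f(4)[of x] C(2)
          by (cases "x \<in> K"; cases "x \<in> C") (auto simp: g_def)
      qed (use Kb Cb \<open>e > 0\<close> in auto)
      moreover have "complex_integral \<rho> (\<lambda>x. g x - indicator K x) = - \<rho> K"
        using bounded_linear_functional_diff[OF complex_integral_bounded_linear_functional[OF \<rho> c] gb
            bounded_borel_functions_indicator[OF Kb]]
        by (simp add: int0[OF g] complex_integral_indicator[OF \<rho> c Kb])
      ultimately show "cmod (\<rho> K) \<le> 0 + e" by simp
    qed
    then show ?thesis by simp
  qed
  have "\<rho> E = 0" for E
  proof (cases "E \<in> sets borel")
    case True
    have "cmod (\<rho> E) \<le> 0"
    proof (rule field_le_epsilon)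
      fix e :: real assume "e > 0"
      then obtain K where K: "compact K" "K \<subseteq> E" "total_variation \<rho> (E - K) \<le> ennreal e"
        using radon_measures_inner_regular[OF \<rho> c True] by blast
      have Kb: "K \<in> sets borel"
        using K(1) by (rule borel_compact)
      have "\<rho> (E - K) = \<rho> E"
        using complex_borel_measure_Diff[OF cbm True Kb K(2)] compact0[OF K(1)] by simp
      then have "ennreal (cmod (\<rho> E)) \<le> ennreal e"
        using norm_le_total_variation[of "E - K" \<rho>] True Kb K(3) by (auto intro: order.trans)
      then show "cmod (\<rho> E) \<le> 0 + e"
        using \<open>e > 0\<close> by simp
    qed
    then show ?thesis by simp
  qed (rule complex_borel_measure_not_borel[OF cbm])
  then show ?thesis
    by (auto simp: \<rho>_def fun_eq_iff)
qed

section \<open>Orbits in the weak topology\<close>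

lemma continuous_on_right_translation:
  "continuous_on UNIV (\<lambda>x::'a::right_topological_group_add. x + g)"
  by (simp add: continuous_on_open_vimage continuous_right_translation)

lemma measurable_right_translation [measurable]:
  "(\<lambda>x::'a::right_topological_group_add. x + g) \<in> borel_measurable borel"
  by (rule borel_measurable_continuous_onI[OF continuous_on_right_translation])

lemma image_right_translation:
  shows "(\<lambda>x::'a::group_add. x + g) ` E = (\<lambda>x. x - g) -` E"
    and "(\<lambda>x::'a::group_add. x - g) ` E = (\<lambda>x. x + g) -` E"
  by (force simp: image_iff)+

lemma borel_right_translation:
  fixes g :: "'a::right_topological_group_add"
  assumes "E \<in> sets borel"
  shows "(\<lambda>x. x + g) ` E \<in> sets borel" "(\<lambda>x. x + g) -` E \<in> sets borel"
  using measurable_sets[OF measurable_right_translation assms, of g]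
    measurable_sets[OF measurable_right_translation assms, of "- g"]
  by (auto simp: image_right_translation)

lemma right_translation_not_borel:
  fixes g :: "'a::right_topological_group_add"
  assumes "E \<notin> sets borel"
  shows "(\<lambda>x. x + g) ` E \<notin> sets borel"
proof
  assume "(\<lambda>x. x + g) ` E \<in> sets borel"
  then have "(\<lambda>x. x + - g) ` (\<lambda>x. x + g) ` E \<in> sets borel"
    by (rule borel_right_translation)
  then show False
    using assms by (simp add: image_image add.assoc)
qed

lemma right_translate_right_translate:
  "right_translate g (right_translate h \<mu>) = right_translate (g + h) \<mu>"
  by (auto simp: right_translate_def image_image add.assoc fun_eq_iff)

lemma right_translate_0: "right_translate 0 \<mu> = \<mu>"
  by (auto simp: right_translate_def fun_eq_iff)

lemma complex_borel_measure_right_translate: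
  assumes \<mu>: "complex_borel_measure \<mu>"
  shows "complex_borel_measure (right_translate g \<mu>)"
  unfolding complex_borel_measure_def
proof (intro conjI allI impI)
  fix E :: "'a set" assume "E \<notin> sets borel"
  then show "right_translate g \<mu> E = 0"
    using complex_borel_measure_not_borel[OF \<mu>] by (simp add: right_translate_def right_translation_not_borel)
next
  fix A :: "nat \<Rightarrow> 'a set" assume A: "range A \<subseteq> sets borel" "disjoint_family A"
  have "(\<lambda>n. \<mu> ((\<lambda>x. x + g) ` A n)) sums \<mu> (\<Union>n. (\<lambda>x. x + g) ` A n)"
    using A by (intro complex_borel_measure_sums[OF \<mu>])
      (auto simp: borel_right_translation disjoint_family_on_def, blast)
  then show "(\<lambda>n. right_translate g \<mu> (A n)) sums right_translate g \<mu> (\<Union> (range A))"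
    by (simp add: right_translate_def image_UN)
qed

text \<open>Translation carries partitions of E to partitions of its translate. This gives one
  inequality for every g and every measure; translating back by \<open>- g\<close> gives the
  other.\<close>

lemma total_variation_right_translate:
  "total_variation (right_translate g \<mu>) E = total_variation \<mu> ((\<lambda>x. x + g) ` E)"
proof -
  have le: "total_variation (right_translate g \<mu>) E \<le> total_variation \<mu> ((\<lambda>x. x + g) ` E)" for g :: 'a and \<mu> E
    unfolding total_variation_eq[of "right_translate g \<mu>"]
  proof (rule SUP_least)
    fix P assume P: "P \<in> borel_partitions E"
    have inj: "inj (\<lambda>x::'a. x + g)"
      by (intro injI) simp
    have "(\<Sum>A\<in>P. ennreal (cmod (right_translate g \<mu> A))) =
        (\<Sum>A\<in>image (\<lambda>x. x + g) ` P. ennreal (cmod (\<mu> A)))"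
      by (subst sum.reindex) (auto simp: right_translate_def intro!: inj_onI dest: inj_image_eq_iff[OF inj, THEN iffD1])
    also have "disjoint (image (\<lambda>x. x + g) ` P)"
      unfolding disjoint_def
    proof (clarify del: equalityI)
      fix A B assume AB: "A \<in> P" "B \<in> P" "(\<lambda>x. x + g) ` A \<noteq> (\<lambda>x. x + g) ` B"
      then have "A \<noteq> B"
        by blast
      then have "A \<inter> B = {}"
        using P AB(1,2) by (simp add: borel_partitions_def disjoint_def)
      then show "(\<lambda>x. x + g) ` A \<inter> (\<lambda>x. x + g) ` B = {}"
        by (simp add: image_Int[OF inj, symmetric])
    qed
    then have "image (\<lambda>x. x + g) ` P \<in> borel_partitions ((\<lambda>x. x + g) ` E)"
      using P by (auto simp: borel_partitions_def borel_right_translation)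
    then have "(\<Sum>A\<in>image (\<lambda>x. x + g) ` P. ennreal (cmod (\<mu> A))) \<le> total_variation \<mu> ((\<lambda>x. x + g) ` E)"
      by (rule total_variation_upper)
    finally show "(\<Sum>A\<in>P. ennreal (cmod (right_translate g \<mu> A))) \<le> total_variation \<mu> ((\<lambda>x. x + g) ` E)" .
  qed
  show ?thesis
  proof (rule antisym[OF le])
    have "total_variation \<mu> ((\<lambda>x. x + g) ` E) =
        total_variation (right_translate (- g) (right_translate g \<mu>)) ((\<lambda>x. x + g) ` E)"
      by (simp add: right_translate_right_translate right_translate_0)
    also have "\<dots> \<le> total_variation (right_translate g \<mu>) ((\<lambda>x. x + - g) ` (\<lambda>x. x + g) ` E)"
      by (rule le)
    finally show "total_variation \<mu> ((\<lambda>x. x + g) ` E) \<le> total_variation (right_translate g \<mu>) E"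
      by (simp add: image_image add.assoc)
  qed
qed

lemma compact_right_translation:
  "compact K \<Longrightarrow> compact ((\<lambda>x. x + g) ` (K :: 'a::right_topological_group_add set))"
  by (intro compact_continuous_image continuous_on_subset[OF continuous_on_right_translation]) auto

lemma right_translate_radon_measures:
  fixes \<mu> :: "'a::{right_topological_group_add, t2_space} set \<Rightarrow> complex"
  assumes c: "compact (UNIV :: 'a set)" and \<mu>: "\<mu> \<in> radon_measures"
  shows "right_translate g \<mu> \<in> radon_measures"
proof (rule radon_measuresI)
  show "complex_borel_measure (right_translate g \<mu>)"
    by (intro complex_borel_measure_right_translate radon_measures_complex_borel_measure \<mu>)
  have "range (\<lambda>x. x + g) = UNIV"
    by (simp add: image_right_translation)
  then show "total_variation (right_translate g \<mu>) UNIV < \<infinity>"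
    using total_variation_finite[OF \<mu> c] by (simp add: total_variation_right_translate)
  fix E :: "'a set" and e :: real assume E: "E \<in> sets borel" and "e > 0"
  then obtain K where K: "compact K" "K \<subseteq> (\<lambda>x. x + g) ` E"
    "total_variation \<mu> ((\<lambda>x. x + g) ` E - K) \<le> ennreal e"
    using radon_measures_inner_regular[OF \<mu> c borel_right_translation(1)] by blast
  define K' where "K' = (\<lambda>x. x + - g) ` K"
  have "K = (\<lambda>x. x + g) ` K'"
    by (simp add: K'_def image_image add.assoc)
  moreover have "(\<lambda>x. x + g) ` E - (\<lambda>x. x + g) ` K' = (\<lambda>x. x + g) ` (E - K')"
    by (auto simp: image_right_translation)
  moreover have "compact K'"
    unfolding K'_def by (rule compact_right_translation[OF K(1)])
  moreover have "K' \<subseteq> E"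
    using K(2) by (auto simp: K'_def add.assoc)
  ultimately show "\<exists>K. compact K \<and> K \<subseteq> E \<and> total_variation (right_translate g \<mu>) (E - K) \<le> ennreal e"
    using K(3) by (intro exI[of _ K']) (simp add: total_variation_right_translate)
qed

text \<open>Identifies membership in \<open>M_cont\<close> with weak-* continuity of the orbit map
  that sends y to \<open>right_translate (- y) \<mu>\<close>: integrals of continuous functions
  along this map are continuous in y.\<close>

lemma convolve_eq_complex_integral:
  fixes \<mu> :: "'a::{right_topological_group_add, t2_space} set \<Rightarrow> complex"
  assumes c: "compact (UNIV :: 'a set)" and \<mu>: "\<mu> \<in> radon_measures"
    and f: "continuous_on UNIV f"
  shows "convolve f \<mu> y = complex_integral (right_translate (- y) \<mu>) f"
  unfolding convolve_def
proof (rule bounded_linear_functional_eqI[where f = f])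
  note L = complex_integral_bounded_linear_functional[OF \<mu> c]
  have trans: "(\<lambda>x. h (x + y)) \<in> bounded_borel_functions" if "h \<in> bounded_borel_functions" for h
    using that unfolding bounded_borel_functions_def
    by (auto intro: bounded_subset measurable_compose[OF measurable_right_translation])
  obtain C where "\<forall>h\<in>bounded_borel_functions. \<forall>b. (\<forall>x. cmod (h x) \<le> b) \<longrightarrow>
      cmod (complex_integral \<mu> h) \<le> C * b"
    using bounded_linear_functional_bound[OF L] .
  then have "\<exists>C. \<forall>h\<in>bounded_borel_functions. \<forall>b. (\<forall>x. cmod (h x) \<le> b) \<longrightarrow>
      cmod (complex_integral \<mu> (\<lambda>x. h (x + y))) \<le> C * b"
    using trans by (intro exI[of _ C]) auto
  then show "bounded_linear_functional (\<lambda>f. complex_integral \<mu> (\<lambda>x. f (x + y)))"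
    unfolding bounded_linear_functional_def
    using bounded_linear_functional_add[OF L trans trans] bounded_linear_functional_cmult[OF L trans]
    by simp
  show "bounded_linear_functional (complex_integral (right_translate (- y) \<mu>))"
    by (intro complex_integral_bounded_linear_functional right_translate_radon_measures c \<mu>)
  fix E :: "'a set" assume E: "E \<in> sets borel"
  have "(\<lambda>x. indicator E (x + y) :: complex) = indicator ((\<lambda>x. x + y) -` E)"
    by (auto simp: indicator_def)
  then show "complex_integral \<mu> (\<lambda>x. indicator E (x + y)) =
      complex_integral (right_translate (- y) \<mu>) (indicator E)"
    using E by (simp add: complex_integral_indicator borel_right_translation
        right_translate_radon_measures c \<mu>) (simp add: right_translate_def image_right_translation)
qed (rule continuous_bounded_borel_functions[OF f c])

section \<open>The weak topology of M(G)\<close>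

lemma topspace_weak_topology: "topspace weak_topology = radon_measures"
proof -
  have "(\<lambda>\<mu>. 0) \<in> radon_measures_dual"
    by (auto simp: radon_measures_dual_def intro: exI[of _ 0])
  then have "\<exists>\<phi> U. radon_measures = {\<mu> \<in> radon_measures. \<phi> \<mu> \<in> U} \<and> \<phi> \<in> radon_measures_dual \<and> open U"
    by (intro exI[of _ "\<lambda>\<mu>. 0"] exI[of _ UNIV]) auto
  then show ?thesis
    unfolding weak_topology_def topology_generated_by_topspace by blast
qed

lemma openin_weak_topology:
  "\<phi> \<in> radon_measures_dual \<Longrightarrow> open U \<Longrightarrow> openin weak_topology {\<mu> \<in> radon_measures. \<phi> \<mu> \<in> U}"
  unfolding weak_topology_def by (rule topology_generated_by_Basis) blast

text \<open>Evaluations at Borel sets are the functionals that matter below: they separate measures,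
  and weak continuity of an orbit is used only through them.\<close>

lemma evaluation_in_dual:
  assumes "compact (UNIV :: 'a::topological_space set)"
  shows "(\<lambda>\<mu>. \<mu> (E :: 'a set)) \<in> radon_measures_dual"
  unfolding radon_measures_dual_def
  using norm_le_tv_norm[OF _ assms] by (auto intro!: exI[of _ 1])

lemma complex_integral_in_dual:
  assumes c: "compact (UNIV :: 'a::t2_space set)" and f: "(f :: 'a \<Rightarrow> complex) \<in> bounded_borel_functions"
  shows "(\<lambda>\<mu>. complex_integral \<mu> f) \<in> radon_measures_dual"
proof -
  obtain b where "\<And>x. cmod (f x) \<le> b"
    using f by (auto simp: bounded_borel_functions_def bounded_iff)
  then have "\<forall>\<mu>\<in>radon_measures. cmod (complex_integral \<mu> f) \<le> (4 * b) * tv_norm \<mu>"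
    using norm_complex_integral_le_tv_norm[OF _ c f] by auto
  then show ?thesis
    unfolding radon_measures_dual_def
    using complex_integral_add[OF c _ f] complex_integral_cmult[OF c _ f] by auto
qed

lemma Hausdorff_weak_topology:
  assumes "compact (UNIV :: 'a::topological_space set)"
  shows "Hausdorff_space (weak_topology :: ('a set \<Rightarrow> complex) topology)"
  unfolding Hausdorff_space_def topspace_weak_topology
proof (intro allI impI, elim conjE)
  fix \<mu> \<nu> :: "'a set \<Rightarrow> complex"
  assume "\<mu> \<in> radon_measures" "\<nu> \<in> radon_measures" "\<mu> \<noteq> \<nu>"
  then obtain E where E: "\<mu> E \<noteq> \<nu> E" by auto
  then obtain U V where "open U" "open V" "\<mu> E \<in> U" "\<nu> E \<in> V" "U \<inter> V = {}"
    using hausdorff[OF E] by auto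
  moreover have "openin weak_topology {\<mu> \<in> radon_measures. \<mu> E \<in> U}" if "open U" for U
    using openin_weak_topology[OF evaluation_in_dual[OF assms] that] .
  ultimately show "\<exists>U V. openin weak_topology U \<and> openin weak_topology V \<and> \<mu> \<in> U \<and> \<nu> \<in> V \<and> disjnt U V"
    using \<open>\<mu> \<in> radon_measures\<close> \<open>\<nu> \<in> radon_measures\<close>
    by (intro exI[of _ "{\<mu> \<in> radon_measures. \<mu> E \<in> U}"] exI[of _ "{\<mu> \<in> radon_measures. \<mu> E \<in> V}"])
       (auto simp: disjnt_def)
qed

lemma L_cont_dual_continuous:
  fixes \<mu> :: "'a::{right_topological_group_add, t2_space} set \<Rightarrow> complex"
  assumes c: "compact (UNIV :: 'a set)" and \<mu>: "\<mu> \<in> L_cont" and \<phi>: "\<phi> \<in> radon_measures_dual"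
  shows "continuous_on UNIV (\<lambda>y. \<phi> (right_translate (- y) \<mu>))"
  unfolding continuous_on_def
proof
  fix x
  have \<mu>': "\<mu> \<in> radon_measures"
    using \<mu> by (simp add: L_cont_def)
  note rad = right_translate_radon_measures[OF c \<mu>']
  obtain B where B: "\<And>\<nu>. \<nu> \<in> radon_measures \<Longrightarrow> cmod (\<phi> \<nu>) \<le> B * tv_norm \<nu>"
    using \<phi> unfolding radon_measures_dual_def by blast
  have add: "\<phi> (\<lambda>E. a E + b E) = \<phi> a + \<phi> b" if "a \<in> radon_measures" "b \<in> radon_measures" for a b
    using \<phi> that by (simp add: radon_measures_dual_def)
  have diff: "\<phi> (\<lambda>E. a E - b E) = \<phi> a - \<phi> b" if "a \<in> radon_measures" "b \<in> radon_measures" for a b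
  proof -
    have "\<phi> (\<lambda>E. a E + (-1) * b E) = \<phi> a + \<phi> (\<lambda>E. (-1) * b E)"
      by (rule add[OF that(1) radon_measures_cmult[OF c that(2)]])
    also have "\<phi> (\<lambda>E. (-1) * b E) = (-1) * \<phi> b"
      using \<phi> that(2) by (simp only: radon_measures_dual_def mem_Collect_eq)
    finally show ?thesis by simp
  qed
  have "((\<lambda>y. \<phi> (right_translate (- y) \<mu>) - \<phi> (right_translate (- x) \<mu>)) \<longlongrightarrow> 0) (at x)"
  proof (rule Lim_null_comparison)
    show "\<forall>\<^sub>F y in at x. cmod (\<phi> (right_translate (- y) \<mu>) - \<phi> (right_translate (- x) \<mu>)) \<le>
        B * tv_norm (\<lambda>E. right_translate (- y) \<mu> E - right_translate (- x) \<mu> E)"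
      using B[OF radon_measures_diff[OF c rad rad]] diff[OF rad rad] by simp
    show "((\<lambda>y. B * tv_norm (\<lambda>E. right_translate (- y) \<mu> E - right_translate (- x) \<mu> E)) \<longlongrightarrow> 0) (at x)"
      using \<mu> by (intro tendsto_mult_right_zero) (simp add: L_cont_def)
  qed
  then show "((\<lambda>y. \<phi> (right_translate (- y) \<mu>)) \<longlongrightarrow> \<phi> (right_translate (- x) \<mu>)) (at x)"
    by (simp add: LIM_zero_iff)
qed

text \<open>Norm continuity of the orbit map implies weak continuity, so the orbit is a weakly
  compact image of G. As the weak topology is Hausdorff, the orbit equals its weak closure.
  Integrals of continuous functions are among the functionals covered, which yields
  \<open>M_cont\<close>.\<close>

lemma L_cont_subset_M_weak:
  assumes c: "compact (UNIV :: 'a::{right_topological_group_add, t2_space} set)"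
  shows "(L_cont :: ('a set \<Rightarrow> complex) set) \<subseteq> M_weak"
proof
  fix \<mu> :: "'a set \<Rightarrow> complex" assume \<mu>: "\<mu> \<in> L_cont"
  then have \<mu>': "\<mu> \<in> radon_measures"
    by (simp add: L_cont_def)
  note rad = right_translate_radon_measures[OF c \<mu>']
  have "continuous_on UNIV (convolve f \<mu>)" if "continuous_on UNIV f" for f
    using L_cont_dual_continuous[OF c \<mu> complex_integral_in_dual[OF c continuous_bounded_borel_functions[OF that c]]]
      convolve_eq_complex_integral[OF c \<mu>' that] by (simp add: continuous_on_def)
  then have "\<mu> \<in> M_cont"
    using \<mu>' by (simp add: M_cont_def)
  \<comment> \<open>Inversion is a bijection of G but need not be continuous, so the orbit is
    reparametrised by \<open>- y\<close>, for which continuity is assumed.\<close>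
  moreover have orbit: "range (\<lambda>g. right_translate g \<mu>) = (\<lambda>y. right_translate (- y) \<mu>) ` UNIV"
    by (metis (no_types, lifting) minus_minus rangeI image_eqI subset_antisym image_subsetI)
  have "continuous_map euclidean weak_topology (\<lambda>y. right_translate (- y) \<mu>)"
    unfolding weak_topology_def
  proof (rule continuous_on_generated_topo)
    fix W :: "('a set \<Rightarrow> complex) set" assume "W \<in> {{\<mu> \<in> radon_measures. \<phi> \<mu> \<in> U} |\<phi> U. \<phi> \<in> radon_measures_dual \<and> open U}"
    then obtain \<phi> U where W: "W = {\<mu> \<in> radon_measures. \<phi> \<mu> \<in> U}" "\<phi> \<in> radon_measures_dual" "open U"
      by blast
    have "(\<lambda>y. right_translate (- y) \<mu>) -` W = (\<lambda>y. \<phi> (right_translate (- y) \<mu>)) -` U"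
      using rad by (auto simp: W(1))
    moreover have "open ((\<lambda>y. \<phi> (right_translate (- y) \<mu>)) -` U)"
      using L_cont_dual_continuous[OF c \<mu> W(2)] W(3) by (simp add: continuous_on_open_vimage)
    ultimately show "openin euclidean ((\<lambda>y. right_translate (- y) \<mu>) -` W \<inter> topspace euclidean)"
      by simp
  next
    have "(\<lambda>y. right_translate (- y) \<mu>) ` topspace euclidean \<subseteq> topspace weak_topology"
      using rad by (auto simp: topspace_weak_topology)
    then show "(\<lambda>y. right_translate (- y) \<mu>) ` topspace euclidean
        \<subseteq> \<Union> {{\<mu> \<in> radon_measures. \<phi> \<mu> \<in> U} |\<phi> U. \<phi> \<in> radon_measures_dual \<and> open U}"
      by (simp only: weak_topology_def topology_generated_by_topspace)
  qed
  then have cpt: "compactin weak_topology (range (\<lambda>g. right_translate g \<mu>))"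
    unfolding orbit using c by (intro image_compactin) auto
  then have "weak_topology closure_of (range (\<lambda>g. right_translate g \<mu>)) = range (\<lambda>g. right_translate g \<mu>)"
    by (intro closure_of_closedin compactin_imp_closedin Hausdorff_weak_topology c)
  then have "relatively_weakly_compact (range (\<lambda>g. right_translate g \<mu>))"
    using cpt rad by (auto simp: relatively_weakly_compact_def)
  ultimately show "\<mu> \<in> M_weak"
    by (simp add: M_weak_def)
qed

text \<open>
  On the weak closure of the orbit the weak topology is compact, so it coincides with the coarser
  Hausdorff topology given by integration of continuous functions.
\<close>

lemma M_weak_orbit_continuous:
  fixes \<mu> :: "'a::{right_topological_group_add, t2_space} set \<Rightarrow> complex"
  assumes c: "compact (UNIV :: 'a set)" and \<mu>: "\<mu> \<in> M_weak"
  shows "continuous_on UNIV (\<lambda>y. \<mu> ((\<lambda>x. x + y) -` E))"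
proof -
  have \<mu>': "\<mu> \<in> radon_measures"
    using \<mu> by (simp add: M_weak_def M_cont_def)
  note rad = right_translate_radon_measures[OF c \<mu>']
  define S where "S = weak_topology closure_of (range (\<lambda>g. right_translate g \<mu>))"
  have S: "compactin weak_topology S" "\<And>g. right_translate g \<mu> \<in> S"
    using \<mu> closure_of_subset[of "range (\<lambda>g. right_translate g \<mu>)" weak_topology] rad
    by (auto simp: M_weak_def relatively_weakly_compact_def S_def topspace_weak_topology)
  have cont: "continuous_on UNIV (\<lambda>y. complex_integral (right_translate (- y) \<mu>) f)"
    if f: "continuous_on UNIV f" for f
    using \<mu> f by (simp add: M_weak_def M_cont_def convolve_eq_complex_integral[OF c \<mu>' f, symmetric, abs_def])
  have "continuous_on UNIV (\<lambda>y. right_translate (- y) \<mu> E)"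
    unfolding continuous_on_def
  proof (intro ballI topological_tendstoI)
    fix y0 U assume U: "open U" "right_translate (- y0) \<mu> E \<in> U"
    define \<nu>0 where "\<nu>0 = right_translate (- y0) \<mu>"
    \<comment> \<open>The compact part of S on which evaluation at E misses U. It suffices to find
      finitely many continuous functions whose integrals keep all of \<open>S'\<close> away from
      \<nu>0, because the integrals along the orbit are continuous at \<open>y0\<close>.\<close>
    define S' where "S' = {\<nu> \<in> radon_measures. \<nu> E \<in> - U} \<inter> S"
    have "closedin weak_topology {\<nu> \<in> radon_measures. \<nu> E \<in> - U}"
    proof -
      have "topspace weak_topology - {\<nu> \<in> radon_measures. \<nu> E \<in> - U} = {\<nu> \<in> radon_measures. \<nu> E \<in> U}"
        by (auto simp: topspace_weak_topology)
      then show ?thesis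
        using openin_weak_topology[OF evaluation_in_dual[OF c] U(1)]
        by (auto simp: closedin_def topspace_weak_topology)
    qed
    then have S': "compactin weak_topology S'"
      unfolding S'_def using S(1) by (rule closed_Int_compactin)
    have "\<exists>f. continuous_on UNIV f \<and> complex_integral \<nu> f \<noteq> complex_integral \<nu>0 f" if "\<nu> \<in> S'" for \<nu>
      using radon_measures_eqI[OF c _ rad, of \<nu>] that U(2) by (auto simp: S'_def \<nu>0_def)
    then obtain f where f: "\<And>\<nu>. \<nu> \<in> S' \<Longrightarrow> continuous_on UNIV (f \<nu>)"
      "\<And>\<nu>. \<nu> \<in> S' \<Longrightarrow> complex_integral \<nu> (f \<nu>) \<noteq> complex_integral \<nu>0 (f \<nu>)"
      by metis
    \<comment> \<open>Half the distance, so that \<nu> lies outside the closed ball of radius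
      \<open>r \<nu>\<close> around the value at \<nu>0 and hence in \<open>W \<nu>\<close>.\<close>
    define r where "r \<nu> = dist (complex_integral \<nu> (f \<nu>)) (complex_integral \<nu>0 (f \<nu>)) / 2" for \<nu>
    have r: "r \<nu> > 0" if "\<nu> \<in> S'" for \<nu>
      using f(2)[OF that] by (simp add: r_def)
    define W where "W \<nu> = {\<nu>' \<in> radon_measures. complex_integral \<nu>' (f \<nu>) \<in>
      - cball (complex_integral \<nu>0 (f \<nu>)) (r \<nu>)}" for \<nu>
    have "openin weak_topology (W \<nu>)" if "\<nu> \<in> S'" for \<nu>
      unfolding W_def
      by (intro openin_weak_topology complex_integral_in_dual c continuous_bounded_borel_functions f that) auto
    moreover have "\<nu> \<in> W \<nu>" if "\<nu> \<in> S'" for \<nu>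
      using r[OF that] that by (auto simp: W_def S'_def r_def dist_commute)
    then have "S' \<subseteq> \<Union> (W ` S')"
      by blast
    ultimately have "\<exists>\<F>. finite \<F> \<and> \<F> \<subseteq> W ` S' \<and> S' \<subseteq> \<Union> \<F>"
      using S' unfolding compactin_def by (metis (no_types, lifting) imageE)
    then obtain F where F: "finite F" "F \<subseteq> S'" "S' \<subseteq> \<Union> (W ` F)"
      by (metis finite_subset_image)
    have "\<forall>\<nu>\<in>F. \<forall>\<^sub>F y in at y0. complex_integral (right_translate (- y) \<mu>) (f \<nu>) \<in> ball (complex_integral \<nu>0 (f \<nu>)) (r \<nu>)"
    proof
      fix \<nu> assume "\<nu> \<in> F"
      then have \<nu>: "\<nu> \<in> S'" using F by auto
      have "((\<lambda>y. complex_integral (right_translate (- y) \<mu>) (f \<nu>)) \<longlongrightarrow> complex_integral \<nu>0 (f \<nu>)) (at y0)"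
        using cont[OF f(1)[OF \<nu>]] by (simp add: continuous_on_def \<nu>0_def)
      then show "\<forall>\<^sub>F y in at y0. complex_integral (right_translate (- y) \<mu>) (f \<nu>) \<in> ball (complex_integral \<nu>0 (f \<nu>)) (r \<nu>)"
        using r[OF \<nu>] by (intro topological_tendstoD) auto
    qed
    then have "\<forall>\<^sub>F y in at y0. \<forall>\<nu>\<in>F. complex_integral (right_translate (- y) \<mu>) (f \<nu>) \<in> ball (complex_integral \<nu>0 (f \<nu>)) (r \<nu>)"
      by (rule eventually_ball_finite[OF F(1)])
    then show "\<forall>\<^sub>F y in at y0. right_translate (- y) \<mu> E \<in> U"
    proof (rule eventually_mono)
      fix y assume y: "\<forall>\<nu>\<in>F. complex_integral (right_translate (- y) \<mu>) (f \<nu>) \<in> ball (complex_integral \<nu>0 (f \<nu>)) (r \<nu>)"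
      show "right_translate (- y) \<mu> E \<in> U"
      proof (rule ccontr)
        assume "right_translate (- y) \<mu> E \<notin> U"
        then have "right_translate (- y) \<mu> \<in> S'"
          using rad S(2) by (auto simp: S'_def)
        then obtain \<nu> where "\<nu> \<in> F" "right_translate (- y) \<mu> \<in> W \<nu>"
          using F(3) by blast
        then show False
          using y by (force simp: W_def)
      qed
    qed
  qed
  then show ?thesis
    by (simp add: right_translate_def image_right_translation)
qed

section \<open>Weakly continuous orbits of positive measures\<close>

text \<open>Setwise continuity of the orbit on Borel sets is all that is retained of weak
  compactness. The locale is entered with \<kappa> a normalised upper variation, for which this
  continuity is proved separately.\<close>

locale continuous_orbit = prob_space \<kappa>
  for \<kappa> :: "'a::{right_topological_group_add, t2_space} measure" +
  assumes compact_UNIV: "compact (UNIV :: 'a set)"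
    and sets_eq [simp, measurable_cong]: "sets \<kappa> = sets borel"
    and inner_regular: "\<And>E e. E \<in> sets borel \<Longrightarrow> e > 0 \<Longrightarrow>
      \<exists>K. compact K \<and> K \<subseteq> E \<and> measure \<kappa> (E - K) \<le> e"
    and orbit_continuous: "\<And>E. E \<in> sets borel \<Longrightarrow>
      continuous_on UNIV (\<lambda>y. measure \<kappa> ((\<lambda>x. x + y) -` E))"
begin

text \<open>Corresponds to \<open>right_translate (- y)\<close>: the measure of E is that of its
  preimage under translation by y. With this sign a further translation by g leads to
  \<open>y + g\<close>.\<close>

definition translate :: "'a \<Rightarrow> 'a measure" where
  "translate y = distr \<kappa> borel (\<lambda>x. x + y)"

definition orbit_fun :: "'a set \<Rightarrow> 'a \<Rightarrow> real" where
  "orbit_fun E y = measure (translate y) E"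

definition iterate :: "'a \<Rightarrow> 'a set \<Rightarrow> real" where
  "iterate z E = (\<integral>y. orbit_fun E y \<partial>translate z)"

lemma space_eq [simp]: "space \<kappa> = UNIV"
  using sets_eq_imp_space_eq[OF sets_eq] by simp

lemma sets_translate [simp, measurable_cong]: "sets (translate y) = sets borel"
  by (simp add: translate_def)

lemma space_translate [simp]: "space (translate y) = UNIV"
  by (simp add: translate_def)

lemma prob_space_translate: "prob_space (translate y)"
  unfolding translate_def by (rule prob_space_distr) measurable

lemma orbit_fun_eq: "E \<in> sets borel \<Longrightarrow> orbit_fun E y = measure \<kappa> ((\<lambda>x. x + y) -` E)"
  by (simp add: orbit_fun_def translate_def measure_distr)

lemma orbit_fun_nonneg: "0 \<le> orbit_fun E y"
  by (simp add: orbit_fun_def)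

lemma orbit_fun_le_1: "orbit_fun E y \<le> 1"
  unfolding orbit_fun_def by (rule prob_space.prob_le_1[OF prob_space_translate])

lemma continuous_orbit_fun:
  assumes "E \<in> sets borel"
  shows "continuous_on UNIV (orbit_fun E)"
proof -
  have "orbit_fun E = (\<lambda>y. measure \<kappa> ((\<lambda>x. x + y) -` E))"
    by (rule ext) (rule orbit_fun_eq[OF assms])
  then show ?thesis
    using orbit_continuous[OF assms] by simp
qed

lemma measurable_orbit_fun: "E \<in> sets borel \<Longrightarrow> orbit_fun E \<in> borel_measurable borel"
  by (intro borel_measurable_continuous_onI continuous_orbit_fun)

lemma integrable_orbit_fun:
  assumes "E \<in> sets borel"
  shows "integrable (translate z) (orbit_fun E)"
proof -
  interpret t: prob_space "translate z" by (rule prob_space_translate)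
  show ?thesis
    using measurable_orbit_fun[OF assms] orbit_fun_nonneg orbit_fun_le_1
    by (intro t.integrable_const_bound[of _ 1]) (auto simp: measurable_cong_sets[OF sets_translate refl])
qed

lemma orbit_fun_mono:
  assumes "A \<in> sets borel" "B \<in> sets borel" "A \<subseteq> B"
  shows "orbit_fun A y \<le> orbit_fun B y"
proof -
  interpret t: prob_space "translate y" by (rule prob_space_translate)
  show ?thesis
    unfolding orbit_fun_def using assms by (intro t.finite_measure_mono) auto
qed

text \<open>The functions \<open>orbit_fun (A n)\<close> are continuous and decrease pointwise to 0,
  because each translate is continuous from above. Compactness of G makes the convergence
  uniform.\<close>

lemma uniform_continuity_from_above:
  assumes A: "range A \<subseteq> sets borel" "decseq A" "(\<Inter>n. A n) = {}" and "e > 0"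
  shows "\<exists>n. \<forall>y. orbit_fun (A n) y < e"
proof -
  define V where "V n = {y. orbit_fun (A n) y < e}" for n :: nat
  have op: "open (V n)" for n
    unfolding V_def using A(1) by (intro open_Collect_less continuous_orbit_fun continuous_on_const) auto
  have "\<exists>n. y \<in> V n" for y
  proof -
    interpret t: prob_space "translate y" by (rule prob_space_translate)
    have "(\<lambda>n. orbit_fun (A n) y) \<longlonglongrightarrow> 0"
      unfolding orbit_fun_def using t.finite_Lim_measure_decseq[of A] A by simp
    then have "\<forall>\<^sub>F n in sequentially. orbit_fun (A n) y < e"
      using \<open>e > 0\<close> by (rule order_tendstoD)
    then show ?thesis
      unfolding V_def using eventually_happens by fastforce
  qed
  then have cover: "UNIV \<subseteq> (\<Union>n\<in>UNIV. V n)"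
    by blast
  obtain F where F: "F \<subseteq> UNIV" "finite F" "UNIV \<subseteq> (\<Union>n\<in>F. V n)"
    by (rule compactE_image[OF compact_UNIV op cover])
  have "y \<in> V (Max F)" for y
  proof -
    obtain n where n: "n \<in> F" "y \<in> V n"
      using F by blast
    then have "A (Max F) \<subseteq> A n"
      using F by (intro decseqD[OF A(2)] Max_ge) auto
    then have "orbit_fun (A (Max F)) y \<le> orbit_fun (A n) y"
      using A(1) by (intro orbit_fun_mono) auto
    then show ?thesis
      using n by (simp add: V_def)
  qed
  then show ?thesis
    unfolding V_def by blast
qed

text \<open>A compact set that works at y also works near y by continuity, so a finite union of such
  sets works for all translates. The uniformity is needed because points of the hull below are
  controlled only through bounds valid for every y.\<close>

lemma translate_inner_regular:
  assumes E: "E \<in> sets borel" and "e > 0"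
  shows "\<exists>K. compact K \<and> K \<subseteq> E \<and> (\<forall>y. orbit_fun (E - K) y < e)"
proof -
  have "\<exists>K. compact K \<and> K \<subseteq> E \<and> orbit_fun (E - K) y < e" for y
  proof -
    \<comment> \<open>Half of e turns the weak inequality of \<open>inner_regular\<close> into the
      strict one that defines an open set of y.\<close>
    obtain K where K: "compact K" "K \<subseteq> (\<lambda>x. x + y) -` E" "measure \<kappa> ((\<lambda>x. x + y) -` E - K) \<le> e / 2"
      using inner_regular[OF borel_right_translation(2)[OF E] half_gt_zero[OF \<open>e > 0\<close>]] by blast
    define K' where "K' = (\<lambda>x. x + y) ` K"
    have K': "compact K'"
      unfolding K'_def by (rule compact_right_translation[OF K(1)])
    have "(\<lambda>x. x + y) -` (E - K') = (\<lambda>x. x + y) -` E - K"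
      unfolding K'_def by auto
    then have "orbit_fun (E - K') y < e"
      using K(3) \<open>e > 0\<close> borel_compact[OF K'] E by (simp add: orbit_fun_eq)
    then show ?thesis
      using K' K(2) by (intro exI[of _ K']) (auto simp: K'_def)
  qed
  then obtain K where K: "\<And>y. compact (K y)" "\<And>y. K y \<subseteq> E" "\<And>y. orbit_fun (E - K y) y < e"
    by metis
  have Kb: "E - K y \<in> sets borel" for y
    using E borel_compact[OF K(1)] by auto
  define V where "V y = {y'. orbit_fun (E - K y) y' < e}" for y
  have op: "open (V y)" for y
    unfolding V_def using Kb by (intro open_Collect_less continuous_orbit_fun continuous_on_const)
  have cover: "UNIV \<subseteq> (\<Union>y\<in>UNIV. V y)"
    using K(3) by (auto simp: V_def)
  obtain F where F: "F \<subseteq> UNIV" "finite F" "UNIV \<subseteq> (\<Union>y\<in>F. V y)"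
    by (rule compactE_image[OF compact_UNIV op cover])
  have cpt: "compact (\<Union>y\<in>F. K y)"
    using F(2) K(1) by (intro compact_UN) auto
  have "orbit_fun (E - (\<Union>y\<in>F. K y)) y < e" for y
  proof -
    obtain y' where y': "y' \<in> F" "y \<in> V y'"
      using F(3) by blast
    then have "orbit_fun (E - (\<Union>y\<in>F. K y)) y \<le> orbit_fun (E - K y') y"
      using E borel_compact[OF cpt] by (intro orbit_fun_mono Kb) auto
    then show ?thesis
      using y' by (simp add: V_def)
  qed
  then show ?thesis
    using cpt K(2) by (intro exI[of _ "\<Union>y\<in>F. K y"]) auto
qed

lemma translate_distr: "distr (translate y) borel (\<lambda>x. x + g) = translate (y + g)"
  by (simp add: translate_def distr_distr comp_def add.assoc)

lemma orbit_fun_translate: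
  assumes "E \<in> sets borel"
  shows "orbit_fun ((\<lambda>x. x + g) -` E) y = orbit_fun E (y + g)"
  using assms by (simp add: orbit_fun_eq borel_right_translation vimage_def add.assoc)

text \<open>Moving E moves the base point z, so the iterates form a single orbit under right
  translation.\<close>

lemma iterate_translate:
  assumes "E \<in> sets borel"
  shows "iterate z ((\<lambda>x. x + g) -` E) = iterate (z + g) E"
proof -
  have "iterate (z + g) E = (\<integral>y. orbit_fun E y \<partial>distr (translate z) borel (\<lambda>x. x + g))"
    by (simp add: iterate_def translate_distr)
  also have "\<dots> = (\<integral>y. orbit_fun E (y + g) \<partial>translate z)"
    by (rule integral_distr) (use measurable_orbit_fun[OF assms] in auto)
  finally show ?thesis
    by (simp add: iterate_def orbit_fun_translate[OF assms])
qed

lemma iterate_Un: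
  assumes "A \<in> sets borel" "B \<in> sets borel" "A \<inter> B = {}"
  shows "iterate z (A \<union> B) = iterate z A + iterate z B"
proof -
  have "orbit_fun (A \<union> B) y = orbit_fun A y + orbit_fun B y" for y
  proof -
    interpret t: prob_space "translate y" by (rule prob_space_translate)
    show ?thesis
      unfolding orbit_fun_def using assms by (intro t.finite_measure_Union) auto
  qed
  then show ?thesis
    using assms by (simp add: iterate_def integrable_orbit_fun)
qed

lemma iterate_UNIV: "iterate z UNIV = 1"
proof -
  have "orbit_fun UNIV y = 1" for y
    using prob_space.prob_space[OF prob_space_translate] by (simp add: orbit_fun_def)
  then show ?thesis
    using prob_space.prob_space[OF prob_space_translate] by (simp add: iterate_def)
qed

lemma iterate_nonneg: "0 \<le> iterate z E"
  unfolding iterate_def by (intro integral_nonneg_AE) (simp add: orbit_fun_nonneg)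

lemma iterate_le:
  assumes "E \<in> sets borel" "\<And>y. orbit_fun E y \<le> c"
  shows "iterate z E \<le> c"
proof -
  interpret t: prob_space "translate z" by (rule prob_space_translate)
  have "iterate z E \<le> (\<integral>y. c \<partial>translate z)"
    unfolding iterate_def using assms by (intro integral_mono integrable_orbit_fun) auto
  then show ?thesis
    using t.prob_space by simp
qed

end

section \<open>Extraction of setwise convergent subsequences\<close>

lemma uniformly_approximable_convergent:
  fixes x :: "nat \<Rightarrow> real"
  assumes "\<And>e. e > 0 \<Longrightarrow> \<exists>y. convergent y \<and> (\<forall>k. \<bar>x k - y k\<bar> \<le> e)"
  shows "convergent x"
proof -
  have "Cauchy x"
    unfolding Cauchy_def
  proof (intro allI impI)
    fix e :: real assume "e > 0"
    then obtain y where y: "convergent y" "\<And>k. \<bar>x k - y k\<bar> \<le> e / 4"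
      using assms[of "e / 4"] by auto
    then obtain M where M: "\<And>m n. m \<ge> M \<Longrightarrow> n \<ge> M \<Longrightarrow> dist (y m) (y n) < e / 4"
      using convergent_Cauchy[OF y(1)] \<open>e > 0\<close> unfolding Cauchy_def by (meson divide_pos_pos zero_less_numeral)
    have "dist (x m) (x n) < e" if "m \<ge> M" "n \<ge> M" for m n
      using M[OF that] y(2)[of m] y(2)[of n] \<open>e > 0\<close> unfolding dist_real_def by linarith
    then show "\<exists>M. \<forall>m\<ge>M. \<forall>n\<ge>M. dist (x m) (x n) < e"
      by blast
  qed
  then show ?thesis
    by (rule Cauchy_convergent)
qed

text \<open>A Dynkin system argument: the sets A for which convergence holds contain an
  \<inter>-stable generator. For a disjoint union, the error of a finite partial union is at most
  the measure of the tail, whatever \<open>E k\<close> is, so the approximation is uniform in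
  k.\<close>

lemma convergent_measure_Int:
  assumes "prob_space M" and sets: "sets M = sigma_sets UNIV (range P)"
    and Int: "Int_stable (range P)" and UNIV: "UNIV \<in> range P"
    and E: "\<And>k::nat. E k \<in> sets M"
    and conv: "\<And>l. convergent (\<lambda>k. measure M (P l \<inter> E k))"
    and A: "A \<in> sets M"
  shows "convergent (\<lambda>k. measure M (A \<inter> E k))"
proof -
  interpret prob_space M by fact
  have A': "A \<in> sigma_sets UNIV (range P)"
    using A sets by simp
  have "range P \<subseteq> Pow UNIV"
    by simp
  from Int this A' show ?thesis
  proof (induction rule: sigma_sets_induct_disjoint)
    case (basic A)
    then show ?case using conv by auto
  next
    case empty
    then show ?case by (simp add: convergent_const)
  next
    case (compl A)
    then have A: "A \<in> sets M" using sets by simp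
    have "measure M ((UNIV - A) \<inter> E k) = measure M (UNIV \<inter> E k) - measure M (A \<inter> E k)" for k
    proof -
      have "(UNIV - A) \<inter> E k = UNIV \<inter> E k - A \<inter> E k" by auto
      then show ?thesis
        using finite_measure_Diff[of "UNIV \<inter> E k" "A \<inter> E k"] A E by auto
    qed
    moreover have "convergent (\<lambda>k. measure M (UNIV \<inter> E k))"
      using conv UNIV by (metis imageE)
    ultimately show ?case
      using compl.IH by (simp add: convergent_diff)
  next
    case (union A)
    then have A: "range A \<subseteq> sets M" using sets by simp
    show ?case
    proof (rule uniformly_approximable_convergent)
      fix e :: real assume "e > 0"
      have "(\<lambda>i. measure M (A i)) sums measure M (\<Union>i. A i)"
        using A union.hyps by (intro finite_measure_UNION) auto
      then have "(\<lambda>n. \<Sum>i<n. measure M (A i)) \<longlonglongrightarrow> measure M (\<Union>i. A i)"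
        by (simp add: sums_def)
      then have "\<forall>\<^sub>F n in sequentially. measure M (\<Union>i. A i) - e < (\<Sum>i<n. measure M (A i))"
        using \<open>e > 0\<close> by (intro order_tendstoD(1)) auto
      then obtain n where n: "measure M (\<Union>i. A i) - e < (\<Sum>i<n. measure M (A i))"
        using eventually_happens by fastforce
      have disj: "disjoint_family_on A {..<n}"
        using union.hyps(1) by (rule disjoint_family_on_mono[rotated]) simp
      have sum_eq: "(\<Sum>i<n. measure M (A i \<inter> B)) = measure M (\<Union>i<n. A i \<inter> B)" if "B \<in> sets M" for B
        using A that disj
        by (intro finite_measure_finite_Union[symmetric]) (auto simp: disjoint_family_on_def)
      have "\<bar>measure M (\<Union> (range A) \<inter> E k) - (\<Sum>i<n. measure M (A i \<inter> E k))\<bar> \<le> e" for k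
      proof -
        have sub: "(\<Union>i<n. A i \<inter> E k) \<subseteq> \<Union> (range A) \<inter> E k" by auto
        have m1: "(\<Union>i<n. A i \<inter> E k) \<in> sets M" "\<Union> (range A) \<inter> E k \<in> sets M"
            "(\<Union>i<n. A i) \<in> sets M" "\<Union> (range A) \<in> sets M"
          using A E by auto
        have "measure M (\<Union> (range A) \<inter> E k) - (\<Sum>i<n. measure M (A i \<inter> E k)) =
            measure M (\<Union> (range A) \<inter> E k - (\<Union>i<n. A i \<inter> E k))"
          using finite_measure_Diff[OF m1(2) m1(1) sub] sum_eq[OF E] by simp
        moreover have "\<dots> \<le> measure M (\<Union> (range A) - (\<Union>i<n. A i))"
          using m1 by (intro finite_measure_mono) auto
        moreover have "\<dots> = measure M (\<Union> (range A)) - measure M (\<Union>i<n. A i)"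
          using m1 by (intro finite_measure_Diff) auto
        moreover have "measure M (\<Union>i<n. A i) = (\<Sum>i<n. measure M (A i))"
          using A disj by (intro finite_measure_finite_Union) auto
        ultimately show ?thesis
          using n by (simp add: measure_nonneg)
      qed
      moreover have "convergent (\<lambda>k. \<Sum>i<n. measure M (A i \<inter> E k))"
        using union.IH by (intro convergent_sum) auto
      ultimately show "\<exists>y. convergent y \<and> (\<forall>k. \<bar>measure M (\<Union> (range A) \<inter> E k) - y k\<bar> \<le> e)"
        by (intro exI[of _ "\<lambda>k. \<Sum>i<n. measure M (A i \<inter> E k)"]) auto
    qed
  qed
qed

text \<open>Weak-* convergence of the indicators of \<open>E k\<close> in L^\<infinity>: test
  functions pass from indicators to all integrable functions, since simple functions are dense in
  L^1 and indicators are bounded by 1.\<close>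

lemma convergent_integral_indicator:
  fixes f :: "'a \<Rightarrow> real"
  assumes "finite_measure M" and E: "\<And>k::nat. E k \<in> sets M"
    and conv: "\<And>A. A \<in> sets M \<Longrightarrow> convergent (\<lambda>k. measure M (A \<inter> E k))"
    and f: "integrable M f"
  shows "convergent (\<lambda>k. \<integral>x. indicator (E k) x * f x \<partial>M)"
proof -
  have int: "integrable M (\<lambda>x. indicator (E k) x * g x)" if "integrable M g" for k and g :: "'a \<Rightarrow> real"
    using integrable_mult_indicator[OF E that] by simp
  show ?thesis
    using f
  proof (induction rule: integrable_induct)
    case (base A c)
    interpret finite_measure M by fact
    have "(\<integral>x. indicator (E k) x * (indicator A x *\<^sub>R c) \<partial>M) = measure M (A \<inter> E k) * c" for k
    proof -
      have "(\<integral>x. indicator (E k) x * (indicator A x *\<^sub>R c) \<partial>M) = (\<integral>x. indicator (A \<inter> E k) x * c \<partial>M)"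
        by (intro Bochner_Integration.integral_cong) (auto simp: indicator_def)
      also have "\<dots> = measure M ((A \<inter> E k) \<inter> space M) * c"
        by (simp add: Bochner_Integration.integral_mult_left_zero)
      also have "(A \<inter> E k) \<inter> space M = A \<inter> E k"
        using sets.sets_into_space[OF base(1)] by auto
      finally show ?thesis .
    qed
    then show ?case
      using conv[OF base(1)] by (simp add: convergent_mult convergent_const)
  next
    case (add f g)
    have "(\<integral>x. indicator (E k) x * (f x + g x) \<partial>M) =
        (\<integral>x. indicator (E k) x * f x \<partial>M) + (\<integral>x. indicator (E k) x * g x \<partial>M)" for k
      unfolding distrib_left
      by (intro Bochner_Integration.integral_add int add)
    then show ?case
      using add by (simp add: convergent_add)
  next
    case (lim f s)
    show ?case
    proof (rule uniformly_approximable_convergent)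
      fix e :: real assume "e > 0"
      have "(\<lambda>i. \<integral>x. \<bar>s i x - f x\<bar> \<partial>M) \<longlonglongrightarrow> (\<integral>x. 0 \<partial>M)"
      \<comment> \<open>The simple functions are bounded by twice \<open>\<bar>f x\<bar>\<close>, so
        their distance to f is at most three times it.\<close>
      proof (rule integral_dominated_convergence[where w = "\<lambda>x. 3 * \<bar>f x\<bar>"])
        show "AE x in M. (\<lambda>i. \<bar>s i x - f x\<bar>) \<longlonglongrightarrow> 0"
        proof (rule AE_I2)
          fix x assume "x \<in> space M"
          then show "(\<lambda>i. \<bar>s i x - f x\<bar>) \<longlonglongrightarrow> 0"
            by (intro tendsto_rabs_zero LIM_zero lim.hyps(2))
        qed
        show "AE x in M. norm \<bar>s i x - f x\<bar> \<le> 3 * \<bar>f x\<bar>" for i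
        proof (rule AE_I2)
          fix x assume "x \<in> space M"
          then have "\<bar>s i x\<bar> \<le> 2 * \<bar>f x\<bar>"
            using lim.hyps(3)[of x i] by simp
          then show "norm \<bar>s i x - f x\<bar> \<le> 3 * \<bar>f x\<bar>"
            unfolding real_norm_def by linarith
        qed
        show "integrable M (\<lambda>x. 3 * \<bar>f x\<bar>)"
          using lim.hyps(4) by simp
      qed (use lim.hyps(1,4) in measurable)
      then have "\<forall>\<^sub>F i in sequentially. (\<integral>x. \<bar>s i x - f x\<bar> \<partial>M) < e"
        using \<open>e > 0\<close> by (intro order_tendstoD(2)) auto
      then obtain i where i: "(\<integral>x. \<bar>s i x - f x\<bar> \<partial>M) < e"
        using eventually_happens by fastforce
      have "\<bar>(\<integral>x. indicator (E k) x * f x \<partial>M) - (\<integral>x. indicator (E k) x * s i x \<partial>M)\<bar> \<le> e" for k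
      proof -
        note int = int[OF lim.hyps(4), of k] int[OF lim.hyps(1), of k i]
        have "\<bar>(\<integral>x. indicator (E k) x * f x \<partial>M) - (\<integral>x. indicator (E k) x * s i x \<partial>M)\<bar>
            = \<bar>\<integral>x. indicator (E k) x * f x - indicator (E k) x * s i x \<partial>M\<bar>"
          using int by simp
        also have "\<dots> \<le> (\<integral>x. \<bar>indicator (E k) x * f x - indicator (E k) x * s i x\<bar> \<partial>M)"
          by (rule integral_abs_bound)
        also have "\<dots> \<le> (\<integral>x. \<bar>s i x - f x\<bar> \<partial>M)"
          using int lim.hyps(1)[of i] lim.hyps(4) by (intro integral_mono integrable_abs Bochner_Integration.integrable_diff)
            (auto simp: indicator_def)
        finally show ?thesis using i by simp
      qed
      then show "\<exists>y. convergent y \<and> (\<forall>k. \<bar>(\<integral>x. indicator (E k) x * f x \<partial>M) - y k\<bar> \<le> e)"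
        using lim.IH[of i] by (intro exI[of _ "\<lambda>k. \<integral>x. indicator (E k) x * s i x \<partial>M"]) auto
    qed
  qed
qed

text \<open>The Radon-Nikodym density of N is an integrable test function for M.\<close>

lemma convergent_absolutely_continuous:
  assumes M: "finite_measure M" and N: "finite_measure N"
    and ac: "absolutely_continuous M N" and sets: "sets N = sets M"
    and E: "\<And>k::nat. E k \<in> sets M"
    and conv: "\<And>A. A \<in> sets M \<Longrightarrow> convergent (\<lambda>k. measure M (A \<inter> E k))"
  shows "convergent (\<lambda>k. measure N (E k))"
proof -
  interpret finite_measure M by fact
  interpret N: finite_measure N by fact
  obtain D where D: "D \<in> borel_measurable M" "AE x in M. RN_deriv M N x = ennreal (D x)" "\<And>x. 0 \<le> D x"
    using real_RN_deriv[OF N ac sets] by metis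
  have "N = density M (RN_deriv M N)"
    using density_RN_deriv[OF ac sets] by simp
  also have "\<dots> = density M (\<lambda>x. ennreal (D x))"
    using D(1,2) by (intro density_cong) auto
  finally have N_eq: "N = density M (\<lambda>x. ennreal (D x))" .
  have "integrable N (\<lambda>x. 1 :: real)"
    by simp
  then have intD: "integrable M D"
    using D by (subst (asm) N_eq) (simp add: integrable_density)
  have "measure N (E k) = (\<integral>x. indicator (E k) x * D x \<partial>M)" for k
  proof -
    have "measure N (E k) = (\<integral>x. indicator (E k) x \<partial>N)"
      using E[of k] sets by simp
    also have "\<dots> = (\<integral>x. D x * indicator (E k) x \<partial>M)"
      unfolding N_eq using D E[of k] by (subst integral_density) auto
    finally show ?thesis
      by (simp add: mult.commute)
  qed
  then show ?thesis
    using convergent_integral_indicator[OF M E conv intD] by simp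
qed

text \<open>Tychonoff's theorem, used twice: with a countable index type to extract subsequences,
  and with all subsets of G as indices to make the hull compact.\<close>

lemma compact_unit_cube: "compact {x :: 'i \<Rightarrow> real. \<forall>i. 0 \<le> x i \<and> x i \<le> 1}"
proof -
  have "compactin (product_topology (\<lambda>i::'i. euclideanreal) UNIV) (PiE UNIV (\<lambda>i. {0..1}))"
    by (simp add: compactin_PiE)
  moreover have "PiE UNIV (\<lambda>i::'i. {0..1::real}) = {x. \<forall>i. 0 \<le> x i \<and> x i \<le> 1}"
    by (auto simp: PiE_def)
  ultimately show ?thesis
    by (simp add: euclidean_product_topology)
qed

context continuous_orbit
begin

text \<open>
  The orbit map of the countable $\cap$-stable family \<open>P\<close> has separable range, so the translates by
  a countable set determine the null sets of the $\sigma$-algebra generated by \<open>P\<close>.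
\<close>

lemma countable_dominating_translates:
  fixes P :: "'i::countable \<Rightarrow> 'a set"
  assumes P: "range P \<subseteq> sets borel" "Int_stable (range P)" "UNIV \<in> range P"
  obtains d :: "nat \<Rightarrow> 'a" where
    "\<forall>A\<in>sigma_sets UNIV (range P). (\<forall>n. orbit_fun A (d n) = 0) \<longrightarrow> (\<forall>y. orbit_fun A y = 0)"
proof -
  \<comment> \<open>The index type is countable, so the values lie in a separable metrizable
    product.\<close>
  define \<Phi> where "\<Phi> y = (\<lambda>i. orbit_fun (P i) y)" for y
  have cont: "continuous_on UNIV \<Phi>"
    unfolding \<Phi>_def using P(1) by (intro continuous_on_coordinatewise_then_product continuous_orbit_fun) auto
  obtain T where T: "countable T" "T \<subseteq> range \<Phi>" "range \<Phi> \<subseteq> closure T"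
    using separable[of "range \<Phi>"] by blast
  then obtain D where D: "countable D" "T = \<Phi> ` D"
    using countable_subset_image[of T \<Phi> UNIV] by auto
  have "D \<noteq> {}"
    using T D by auto
  then have range: "range (from_nat_into D) = D"
    using D(1) by (rule range_from_nat_into)
  have sub: "sigma_sets UNIV (range P) \<subseteq> sets borel"
    using sets.sigma_sets_subset[OF P(1)] by simp
  show ?thesis
  proof (rule that[of "from_nat_into D"], intro ballI impI allI)
    fix A y assume A: "A \<in> sigma_sets UNIV (range P)" and 0: "\<forall>n. orbit_fun A (from_nat_into D n) = 0"
    have Ab: "A \<in> sets borel"
      using A sub by auto
    \<comment> \<open>Z is compact and contains the chosen points, so its image under \<Phi> is
      closed and contains a dense subset of the range. Every y thus shares its value of \<Phi> with
      a point of Z.\<close>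
    define Z where "Z = {y. orbit_fun A y = 0}"
    have "closed Z"
      unfolding Z_def using continuous_orbit_fun[OF Ab] by (intro closed_Collect_eq continuous_on_const)
    then have "compact Z"
      using compact_Int_closed[OF compact_UNIV] by simp
    then have "compact (\<Phi> ` Z)"
      by (intro compact_continuous_image continuous_on_subset[OF cont]) auto
    then have "closed (\<Phi> ` Z)"
      by (rule compact_imp_closed)
    moreover have "D \<subseteq> Z"
      unfolding Z_def using 0 range by (metis (mono_tags, lifting) imageE mem_Collect_eq subsetI)
    then have "T \<subseteq> \<Phi> ` Z"
      using D by auto
    ultimately have "range \<Phi> \<subseteq> \<Phi> ` Z"
      using T(3) closure_minimal by blast
    then obtain y' where y': "orbit_fun A y' = 0" "\<Phi> y = \<Phi> y'"
      unfolding Z_def by blast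
    \<comment> \<open>Equal values of \<Phi> mean that the translates at y and \<open>y'\<close>
      agree on the \<inter>-stable family, hence on the generated \<sigma>-algebra, which contains
      A.\<close>
    define R where "R y = restr_to_subalg (translate y) (sigma UNIV (range P))" for y
    have subalg: "subalgebra (translate y) (sigma UNIV (range P))" for y
      using sub by (simp add: subalgebra_def)
    have sets_R: "sets (R y) = sigma_sets UNIV (range P)" for y
      unfolding R_def by (simp add: sets_restr_to_subalg[OF subalg])
    have em: "emeasure (R y) B = ennreal (orbit_fun B y)" if "B \<in> sigma_sets UNIV (range P)" for B y
    proof -
      interpret t: prob_space "translate y" by (rule prob_space_translate)
      show ?thesis
        using that by (simp add: R_def emeasure_restr_to_subalg[OF subalg] orbit_fun_def t.emeasure_eq_measure)
    qed
    have "R y = R y'"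
    proof (rule measure_eqI_generator_eq[OF P(2)])
      fix B assume "B \<in> range P"
      then obtain i where "B = P i" by auto
      moreover have "\<Phi> y i = \<Phi> y' i"
        using y' by simp
      ultimately show "emeasure (R y) B = emeasure (R y') B"
        by (simp add: em sigma_sets.Basic \<Phi>_def)
    next
      show "range (\<lambda>n::nat. UNIV) \<subseteq> range P"
        using P(3) by auto
      show "emeasure (R y) UNIV \<noteq> \<infinity>"
        using P(3) by (simp add: em sigma_sets.Basic)
    qed (simp_all add: sets_R)
    then have "ennreal (orbit_fun A y) = ennreal (orbit_fun A y')"
      using em[OF A] by metis
    then show "orbit_fun A y = 0"
      using y' by (simp add: orbit_fun_nonneg)
  qed
qed

lemma convergent_subsequence:
  assumes E: "\<And>k::nat. E k \<in> sets borel"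
  obtains r :: "nat \<Rightarrow> nat" where "strict_mono r" "\<forall>y. convergent (\<lambda>k. orbit_fun (E (r k)) y)"
proof -
  \<comment> \<open>Finite lists form a countable index type. Appending lists gives intersections,
    and the empty list gives \<open>UNIV\<close>.\<close>
  define P where "P l = (\<Inter>i\<in>set l. E i)" for l
  have P: "range P \<subseteq> sets borel" "Int_stable (range P)" "UNIV \<in> range P"
  proof -
    show "range P \<subseteq> sets borel"
      unfolding P_def using E by (auto intro!: sets.countable_INT'')
    show "Int_stable (range P)"
    proof (rule Int_stableI)
      fix A B assume "A \<in> range P" "B \<in> range P"
      then obtain l l' where "A = P l" "B = P l'" by auto
      then have "A \<inter> B = P (l @ l')"
        by (auto simp: P_def)
      then show "A \<inter> B \<in> range P" by simp
    qed
    have "UNIV = P []"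
      by (simp add: P_def)
    then show "UNIV \<in> range P" by blast
  qed
  have E_P: "E k = P [k]" for k
    by (simp add: P_def)
  obtain d :: "nat \<Rightarrow> 'a" where d:
    "\<forall>A\<in>sigma_sets UNIV (range P). (\<forall>n. orbit_fun A (d n) = 0) \<longrightarrow> (\<forall>y. orbit_fun A y = 0)"
    by (rule countable_dominating_translates[OF P])
  \<comment> \<open>The geometric distribution gives every index positive weight, so a null set of L
    is null for every translate by \<open>d n\<close>.\<close>
  define L where "L = measure_pmf (geometric_pmf (1/2)) \<bind> (\<lambda>n. translate (d n))"
  have meas: "(\<lambda>n. translate (d n)) \<in> measurable (measure_pmf (geometric_pmf (1/2))) (subprob_algebra borel)"
    using prob_space_translate prob_space_imp_subprob_space by (auto simp: space_subprob_algebra)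
  have sets_L: "sets L = sets borel"
    unfolding L_def by (rule sets_bind[OF sets_translate]) auto
  have em_L: "emeasure L A = (\<integral>\<^sup>+n. emeasure (translate (d n)) A \<partial>measure_pmf (geometric_pmf (1/2)))"
    if "A \<in> sets borel" for A
    unfolding L_def using meas that by (intro emeasure_bind) auto
  have prob_L: "prob_space L"
  proof
    have "space L = UNIV"
      using sets_eq_imp_space_eq[OF sets_L] by simp
    moreover have "emeasure (translate y) UNIV = 1" for y
      using prob_space.emeasure_space_1[OF prob_space_translate[of y]] by simp
    ultimately show "emeasure L (space L) = 1"
      by (simp add: em_L)
  qed
  define F where "F = sigma UNIV (range P)"
  have sets_F: "sets F = sigma_sets UNIV (range P)"
    by (simp add: F_def)
  have F_borel: "sets F \<subseteq> sets borel"
    using sets.sigma_sets_subset[OF P(1)] by (simp add: sets_F)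
  have subL: "subalgebra L F" and subT: "subalgebra (translate y) F" for y
    using F_borel sets_L sets_eq_imp_space_eq[OF sets_L] by (simp_all add: subalgebra_def F_def)
  \<comment> \<open>Countably many translates dominate the others only on the \<sigma>-algebra
    generated by the given sets, so all measures are restricted to it.\<close>
  define L' where "L' = restr_to_subalg L F"
  define T where "T y = restr_to_subalg (translate y) F" for y
  have sets': "sets L' = sigma_sets UNIV (range P)" "sets (T y) = sigma_sets UNIV (range P)" for y
    by (simp_all add: L'_def T_def sets_restr_to_subalg[OF subL] sets_restr_to_subalg[OF subT] sets_F)
  have prob_L': "prob_space L'"
    unfolding L'_def by (rule prob_space_restr_to_subalg[OF subL prob_L])
  have prob_T: "prob_space (T y)" for y
    unfolding T_def by (rule prob_space_restr_to_subalg[OF subT prob_space_translate])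
  have meas_T: "measure (T y) A = orbit_fun A y" if "A \<in> sets F" for A y
    using that by (simp add: T_def orbit_fun_def measure_def emeasure_restr_to_subalg[OF subT])
  have E_F: "E k \<in> sets F" for k
    unfolding sets_F E_P by (rule sigma_sets.Basic) simp
  \<comment> \<open>The cube indexed by lists is metrizable, so its sequential compactness takes the
    place of a diagonal argument.\<close>
  define X where "X k l = measure L' (P l \<inter> E k)" for k l
  have "\<forall>k. X k \<in> {x. \<forall>i. 0 \<le> x i \<and> x i \<le> 1}"
    unfolding X_def using prob_space.prob_le_1[OF prob_L'] by auto
  moreover have "seq_compact {x :: nat list \<Rightarrow> real. \<forall>i. 0 \<le> x i \<and> x i \<le> 1}"
    using compact_unit_cube[where ?'i = "nat list"] by (simp add: compact_eq_seq_compact_metric)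
  ultimately obtain x and r :: "nat \<Rightarrow> nat" where r: "strict_mono r" "(X \<circ> r) \<longlonglongrightarrow> x"
    using seq_compactE[where f = X] by blast
  have conv: "convergent (\<lambda>k. measure L' (P l \<inter> E (r k)))" for l
    using continuous_on_tendsto_compose[OF continuous_on_product_coordinates r(2), of l] by (auto simp: X_def comp_def convergent_def)
  have E_L': "E (r k) \<in> sets L'" for k
    using E_F[of "r k"] by (simp only: sets'(1) sets_F)
  have conv': "convergent (\<lambda>k. measure L' (A \<inter> E (r k)))" if "A \<in> sets L'" for A
    by (rule convergent_measure_Int[where P = P, OF prob_L' sets'(1) P(2,3) E_L' conv that])
  have "convergent (\<lambda>k. orbit_fun (E (r k)) y)" for y
  proof -
    have ac: "absolutely_continuous L' (T y)"
      unfolding absolutely_continuous_def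
    proof
      fix A assume "A \<in> null_sets L'"
      then have "A \<in> sets L'" "emeasure L' A = 0"
        by auto
      then have A: "A \<in> sets F" "emeasure L A = 0"
        using emeasure_restr_to_subalg[OF subL, of A] by (simp_all add: sets'(1) sets_F L'_def[symmetric])
      then have "A \<in> sets borel"
        using F_borel by auto
      then have "emeasure (translate (d n)) A = 0" for n
        using A(2) by (simp add: em_L nn_integral_0_iff_AE AE_measure_pmf_iff set_pmf_geometric)
      then have "orbit_fun A (d n) = 0" for n
        by (simp add: orbit_fun_def measure_def)
      then have "orbit_fun A y = 0"
        using d A(1) by (simp add: sets_F)
      moreover interpret T: prob_space "T y" by (rule prob_T)
      have "emeasure (T y) A = ennreal (orbit_fun A y)"
        using meas_T[OF A(1)] by (simp add: T.emeasure_eq_measure)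
      ultimately show "A \<in> null_sets (T y)"
        using A(1) by (auto simp: null_sets_def sets' sets_F)
    qed
    have "sets (T y) = sets L'"
      by (simp only: sets')
    then have "convergent (\<lambda>k. measure (T y) (E (r k)))"
      by (intro convergent_absolutely_continuous[where M = L', OF _ _ ac _ E_L' conv']
          prob_space.axioms(1) prob_L' prob_T)
    then show ?thesis
      using meas_T[OF E_F] by simp
  qed
  then show ?thesis
    by (intro that[OF r(1)] allI)
qed

end

section \<open>The invariant measure\<close>

context continuous_orbit
begin

section \<open>Total boundedness of the iterates\<close>

lemma abs_iterate_diff_le:
  assumes A: "A \<in> sets borel" and B: "B \<in> sets borel" and W: "W \<in> sets borel"
    and near: "\<And>y. y \<notin> W \<Longrightarrow> \<bar>orbit_fun A y - orbit_fun B y\<bar> \<le> c"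
    and small: "orbit_fun W z \<le> c'" and "0 \<le> c"
  shows "\<bar>iterate z A - iterate z B\<bar> \<le> c + c'"
proof -
  interpret t: prob_space "translate z" by (rule prob_space_translate)
  have int: "integrable (translate z) (\<lambda>y. orbit_fun A y - orbit_fun B y)"
    using integrable_orbit_fun[OF A] integrable_orbit_fun[OF B] by simp
  have intW: "integrable (translate z) (\<lambda>y. c + indicator W y)"
    using W by (intro Bochner_Integration.integrable_add) (auto simp: t.emeasure_eq_measure)
  have "\<bar>iterate z A - iterate z B\<bar> = \<bar>\<integral>y. orbit_fun A y - orbit_fun B y \<partial>translate z\<bar>"
    unfolding iterate_def using integrable_orbit_fun[OF A] integrable_orbit_fun[OF B] by simp
  also have "\<dots> \<le> (\<integral>y. \<bar>orbit_fun A y - orbit_fun B y\<bar> \<partial>translate z)"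
    by (rule integral_abs_bound)
  also have "\<dots> \<le> (\<integral>y. c + indicator W y \<partial>translate z)"
  proof (rule integral_mono[OF integrable_abs[OF int] intW])
    \<comment> \<open>On W the difference is at most 1, because \<open>orbit_fun\<close> takes
      values between 0 and 1. The integral of the indicator of W is
      \<open>orbit_fun W z\<close>.\<close>
    fix y
    show "\<bar>orbit_fun A y - orbit_fun B y\<bar> \<le> c + indicator W y"
    proof (cases "y \<in> W")
      case True
      then show ?thesis
        using orbit_fun_nonneg[of A y] orbit_fun_nonneg[of B y] orbit_fun_le_1[of A y]
          orbit_fun_le_1[of B y] \<open>0 \<le> c\<close> by simp
    qed (use near in auto)
  qed
  also have "\<dots> = c + orbit_fun W z"
    using W t.prob_space by (subst Bochner_Integration.integral_add) (auto simp: t.emeasure_eq_measure orbit_fun_def)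
  finally show ?thesis
    using small by linarith
qed

text \<open>Along a convergent subsequence, the sets \<open>A n\<close> of points where some later
  term is far from the limit decrease to the empty set. By uniform countable additivity their mass
  is eventually small for all translates at once, so the choice of n does not depend on z.\<close>

lemma iterate_close_pair:
  assumes E: "\<And>k::nat. E k \<in> sets borel" and "e > 0"
  shows "\<exists>i j. i < j \<and> (\<forall>z. \<bar>iterate z (E i) - iterate z (E j)\<bar> \<le> e)"
proof -
  obtain r :: "nat \<Rightarrow> nat" where r: "strict_mono r" and conv: "\<forall>y. convergent (\<lambda>k. orbit_fun (E (r k)) y)"
    by (rule convergent_subsequence[of E, OF E])
  define l where "l y = lim (\<lambda>k. orbit_fun (E (r k)) y)" for y
  have lim: "(\<lambda>k. orbit_fun (E (r k)) y) \<longlonglongrightarrow> l y" for y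
    using conv by (simp add: l_def convergent_LIMSEQ_iff)
  have [measurable]: "orbit_fun (E k) \<in> borel_measurable borel" for k
    by (rule measurable_orbit_fun[OF E])
  have [measurable]: "l \<in> borel_measurable borel"
    by (rule borel_measurable_LIMSEQ_real[OF lim]) measurable
  define A where "A n = (\<Union>k\<in>{n..}. {y. \<bar>orbit_fun (E (r k)) y - l y\<bar> > e / 4})" for n
  have A: "A n \<in> sets borel" for n
    unfolding A_def by (intro sets.countable_UN') auto
  have "decseq A"
    unfolding decseq_def A_def by (intro allI impI UN_mono) auto
  moreover have "(\<Inter>n. A n) = {}"
  proof -
    have "\<exists>n. y \<notin> A n" for y
    proof -
      have "\<forall>\<^sub>F k in sequentially. dist (orbit_fun (E (r k)) y) (l y) < e / 4"
        using lim[of y] \<open>e > 0\<close> by (intro tendstoD) auto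
      then obtain n where "\<And>k. k \<ge> n \<Longrightarrow> dist (orbit_fun (E (r k)) y) (l y) < e / 4"
        by (auto simp: eventually_sequentially)
      then show ?thesis
        by (intro exI[of _ n]) (auto simp: A_def dist_real_def not_less less_imp_le)
    qed
    then show ?thesis by auto
  qed
  ultimately obtain n where n: "\<And>y. orbit_fun (A n) y < e / 4"
    using uniform_continuity_from_above[of A "e / 4"] A \<open>e > 0\<close> by auto
  \<comment> \<open>Off \<open>A n\<close>, two deviations of e/4 from the limit; on
    \<open>A n\<close>, mass at most e/4.\<close>
  have le: "\<bar>iterate z (E (r n)) - iterate z (E (r (Suc n)))\<bar> \<le> e / 2 + e / 4" for z
  proof (rule abs_iterate_diff_le[OF E E A])
    fix y assume "y \<notin> A n"
    then have "\<bar>orbit_fun (E (r n)) y - l y\<bar> \<le> e / 4" "\<bar>orbit_fun (E (r (Suc n))) y - l y\<bar> \<le> e / 4"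
      unfolding A_def by (auto simp: not_less)
    then show "\<bar>orbit_fun (E (r n)) y - orbit_fun (E (r (Suc n))) y\<bar> \<le> e / 2"
      by linarith
  qed (use n[of z] \<open>e > 0\<close> in auto)
  have "\<bar>iterate z (E (r n)) - iterate z (E (r (Suc n)))\<bar> \<le> e" for z
    using le[of z] \<open>e > 0\<close> by linarith
  moreover have "r n < r (Suc n)"
    using r by (simp add: strict_mono_Suc_iff)
  ultimately show ?thesis by blast
qed

text \<open>Without a finite net, one could keep choosing a Borel set far from all earlier ones;
  \<open>S n\<close> collects the first n choices. The resulting sequence contradicts
  \<open>iterate_close_pair\<close>.\<close>

lemma iterate_finite_net:
  assumes "e > 0"
  shows "\<exists>F. finite F \<and> F \<subseteq> sets borel \<and>
    (\<forall>E\<in>sets borel. \<exists>E'\<in>F. \<forall>z. \<bar>iterate z E - iterate z E'\<bar> \<le> e)"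
proof (rule ccontr)
  assume contr: "\<not> ?thesis"
  have "\<exists>E. E \<in> sets borel \<and> (\<forall>E'\<in>F. \<not> (\<forall>z. \<bar>iterate z E - iterate z E'\<bar> \<le> e))"
    if "finite F" "F \<subseteq> sets borel" for F
  proof (rule ccontr)
    assume "\<not> ?thesis"
    then have "\<forall>E\<in>sets borel. \<exists>E'\<in>F. \<forall>z. \<bar>iterate z E - iterate z E'\<bar> \<le> e"
      by blast
    with contr that show False
      by (auto simp only: not_ex)
  qed
  then obtain c where c: "\<And>F. finite F \<Longrightarrow> F \<subseteq> sets borel \<Longrightarrow> c F \<in> sets borel"
    "\<And>F E'. finite F \<Longrightarrow> F \<subseteq> sets borel \<Longrightarrow> E' \<in> F \<Longrightarrow> \<not> (\<forall>z. \<bar>iterate z (c F) - iterate z E'\<bar> \<le> e)"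
    by metis
  define S where "S n = ((\<lambda>F. insert (c F) F) ^^ n) {}" for n
  have S_Suc: "S (Suc n) = insert (c (S n)) (S n)" for n
    by (simp add: S_def)
  have S: "finite (S n) \<and> S n \<subseteq> sets borel" for n
    by (induction n) (auto simp: S_Suc c(1), simp_all add: S_def)
  have mono: "S m \<subseteq> S n" if "m \<le> n" for m n
    using that by (induction rule: dec_induct) (auto simp: S_Suc)
  obtain i j where ij: "i < j" "\<forall>z. \<bar>iterate z (c (S i)) - iterate z (c (S j))\<bar> \<le> e"
    using iterate_close_pair[of "\<lambda>k. c (S k)", OF _ assms] c(1) S by blast
  have "c (S i) \<in> S j"
    using mono[of "Suc i" j] ij(1) by (auto simp: S_Suc)
  then show False
    using c(2)[of "S j" "c (S i)"] S[of j] ij(2) by (auto simp: abs_minus_commute)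
qed

text \<open>
  The closed convex hull of the orbit of the iterate, described by linear inequalities so that it
  is visibly closed for the topology of setwise convergence.
\<close>

definition orbit_hull :: "('a set \<Rightarrow> real) set" where
  "orbit_hull = {a. (\<forall>E. E \<notin> sets borel \<longrightarrow> a E = 0) \<and> a UNIV = 1 \<and>
     (\<forall>A B. A \<in> sets borel \<longrightarrow> B \<in> sets borel \<longrightarrow> A \<inter> B = {} \<longrightarrow> a (A \<union> B) = a A + a B) \<and>
     (\<forall>A B t. A \<in> sets borel \<longrightarrow> B \<in> sets borel \<longrightarrow> (\<forall>z. iterate z A - iterate z B \<le> t) \<longrightarrow>
        a A - a B \<le> t)}"

lemma hullD:
  assumes "a \<in> orbit_hull"
  shows "E \<notin> sets borel \<Longrightarrow> a E = 0" "a UNIV = 1"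
    "A \<in> sets borel \<Longrightarrow> B \<in> sets borel \<Longrightarrow> A \<inter> B = {} \<Longrightarrow> a (A \<union> B) = a A + a B"
    "A \<in> sets borel \<Longrightarrow> B \<in> sets borel \<Longrightarrow> (\<And>z. iterate z A - iterate z B \<le> t) \<Longrightarrow> a A - a B \<le> t"
  using assms unfolding orbit_hull_def by blast+

lemma hull_empty: "a \<in> orbit_hull \<Longrightarrow> a {} = 0"
  using hullD(3)[of a "{}" "{}"] by simp

lemma iterate_empty: "iterate z {} = 0"
  using iterate_Un[of "{}" "{}" z] by simp

lemma hull_nonneg: "a \<in> orbit_hull \<Longrightarrow> 0 \<le> a E"
  using hullD(4)[of a "{}" E 0] hullD(1)[of a E] hull_empty[of a] iterate_nonneg[of _ E]
  by (cases "E \<in> sets borel") (auto simp: iterate_empty)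

text \<open>Comparison with the empty set transfers bounds that are uniform in y from the translates
  to all points of the hull.\<close>

lemma hull_le:
  assumes "a \<in> orbit_hull" "E \<in> sets borel" "\<And>y. orbit_fun E y \<le> c"
  shows "a E \<le> c"
  using hullD(4)[OF assms(1,2), of "{}" c] iterate_le[OF assms(2,3)] hull_empty[OF assms(1)]
  by (simp add: iterate_empty)

lemma hull_le_1: "a \<in> orbit_hull \<Longrightarrow> a E \<le> 1"
  using hull_le[of a E 1] hullD(1)[of a E] orbit_fun_le_1 by (cases "E \<in> sets borel") auto

text \<open>The product topology on functions of sets is that of setwise convergence, and every
  defining condition involves only finitely many coordinates. The hull is therefore a closed subset
  of a cube.\<close>

lemma compact_hull: "compact orbit_hull"
proof -
  have "closed orbit_hull"
    unfolding orbit_hull_def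
    by (intro closed_Collect_conj closed_Collect_all closed_Collect_imp open_Collect_const
        closed_Collect_eq closed_Collect_le continuous_intros continuous_on_product_coordinates)
  moreover have "orbit_hull \<subseteq> {x. \<forall>i. 0 \<le> x i \<and> x i \<le> 1}"
    using hull_nonneg hull_le_1 by auto
  ultimately show ?thesis
    using compact_Int_closed[OF compact_unit_cube, of orbit_hull] by (simp add: inf.absorb2)
qed

lemma iterate_in_hull: "(\<lambda>E. if E \<in> sets borel then iterate 0 E else 0) \<in> orbit_hull"
  unfolding orbit_hull_def by (auto simp: iterate_UNIV iterate_Un)

lemma vimage_right_translation_borel_iff:
  "(\<lambda>x. x + g) -` E \<in> sets borel \<longleftrightarrow> E \<in> sets (borel :: 'a measure)"
  using right_translation_not_borel[of E "- g"] borel_right_translation(2)[of E g]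
  by (auto simp: image_right_translation)

text \<open>The defining inequalities quantify over all z, and translating A and B only permutes the
  base points.\<close>

lemma translate_hull:
  assumes a: "a \<in> orbit_hull"
  shows "(\<lambda>E. a ((\<lambda>x. x + g) -` E)) \<in> orbit_hull"
  unfolding orbit_hull_def
proof (intro CollectI conjI allI impI)
  show "a ((\<lambda>x. x + g) -` E) = 0" if "E \<notin> sets borel" for E
    using hullD(1)[OF a] that by (simp add: vimage_right_translation_borel_iff)
  show "a ((\<lambda>x. x + g) -` UNIV) = 1"
    using hullD(2)[OF a] by simp
  show "a ((\<lambda>x. x + g) -` (A \<union> B)) = a ((\<lambda>x. x + g) -` A) + a ((\<lambda>x. x + g) -` B)"
    if "A \<in> sets borel" "B \<in> sets borel" "A \<inter> B = {}" for A B
    unfolding vimage_Un using that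
    by (intro hullD(3)[OF a]) (auto simp: vimage_right_translation_borel_iff)
  show "a ((\<lambda>x. x + g) -` A) - a ((\<lambda>x. x + g) -` B) \<le> t"
    if "A \<in> sets borel" "B \<in> sets borel" "\<forall>z. iterate z A - iterate z B \<le> t" for A B t
    using that by (intro hullD(4)[OF a]) (auto simp: vimage_right_translation_borel_iff iterate_translate)
qed

lemma average_hull:
  assumes "finite G" "G \<noteq> {}" and b: "\<And>g. g \<in> G \<Longrightarrow> b g \<in> orbit_hull"
  shows "(\<lambda>E. (\<Sum>g\<in>G. b g E) / card G) \<in> orbit_hull"
  unfolding orbit_hull_def
proof (intro CollectI conjI allI impI)
  have card: "real (card G) > 0"
    using assms(1,2) by (simp add: card_gt_0_iff)
  show "(\<Sum>g\<in>G. b g E) / card G = 0" if "E \<notin> sets borel" for E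
    using hullD(1)[OF b that] by simp
  show "(\<Sum>g\<in>G. b g UNIV) / card G = 1"
    using hullD(2)[OF b] card by simp
  show "(\<Sum>g\<in>G. b g (A \<union> B)) / card G = (\<Sum>g\<in>G. b g A) / card G + (\<Sum>g\<in>G. b g B) / card G"
    if "A \<in> sets borel" "B \<in> sets borel" "A \<inter> B = {}" for A B
    using hullD(3)[OF b that] by (simp add: sum.distrib add_divide_distrib)
  show "(\<Sum>g\<in>G. b g A) / card G - (\<Sum>g\<in>G. b g B) / card G \<le> t"
    if "A \<in> sets borel" "B \<in> sets borel" "\<forall>z. iterate z A - iterate z B \<le> t" for A B t
  proof -
    have "(\<Sum>g\<in>G. b g A - b g B) \<le> (\<Sum>g\<in>G. t)"
      using hullD(4)[OF b that(1,2)] that(3) by (intro sum_mono) auto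
    then show ?thesis
      using card by (simp add: sum_subtractf field_simps)
  qed
qed

text \<open>
  Averaging over finitely many orbit points that form a net of radius half the orbit diameter
  makes the orbit diameter strictly smaller.
\<close>

lemma smaller_orbit_diameter:
  assumes a: "a \<in> orbit_hull" and I: "\<And>g E. \<bar>a ((\<lambda>x. x + g) -` E) - a E\<bar> \<le> I" and "I > 0"
  shows "\<exists>b\<in>orbit_hull. \<exists>r<I. \<forall>g E. \<bar>b ((\<lambda>x. x + g) -` E) - b E\<bar> \<le> r"
proof -
  define T where "T g E = a ((\<lambda>x. x + g) -` E)" for g E
  have T: "T g \<in> orbit_hull" for g
    unfolding T_def[abs_def] by (rule translate_hull[OF a])
  have T_T: "T g ((\<lambda>x. x + h) -` E) = T (g + h) E" for g h E
    by (simp add: T_def vimage_def add.assoc)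
  have diam: "\<bar>T g E - T h E\<bar> \<le> I" for g h E
    using I[of "g - h" "(\<lambda>x. x + h) -` E"] T_T[of "g - h" h E] by (simp add: T_def)
  \<comment> \<open>Two replacements of E by a net set and one comparison inside a cell cost I/8
    each; their sum is below the required I/2.\<close>
  have "I / 8 > 0" using \<open>I > 0\<close> by simp
  then obtain F where F: "finite F" "F \<subseteq> sets borel"
    "\<And>E. E \<in> sets borel \<Longrightarrow> \<exists>E'\<in>F. \<forall>z. \<bar>iterate z E - iterate z E'\<bar> \<le> I / 8"
    using iterate_finite_net[of "I / 8"] by auto
  \<comment> \<open>The cell records the values of an orbit point on the net sets up to I/8. These
    values lie between 0 and 1, so there are finitely many cells, and G picks a representative of
    each.\<close>
  define cell where "cell g = restrict (\<lambda>E. \<lfloor>8 * T g E / I\<rfloor>) F" for g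
  have "range cell \<subseteq> PiE F (\<lambda>_. {0..\<lfloor>8 / I\<rfloor>})"
  proof (rule image_subsetI)
    fix g
    have "0 \<le> \<lfloor>8 * T g E / I\<rfloor> \<and> \<lfloor>8 * T g E / I\<rfloor> \<le> \<lfloor>8 / I\<rfloor>" for E
      using hull_nonneg[OF T, of g E] hull_le_1[OF T, of g E] \<open>I > 0\<close>
      by (auto intro!: floor_mono divide_right_mono)
    then show "cell g \<in> PiE F (\<lambda>_. {0..\<lfloor>8 / I\<rfloor>})"
      unfolding cell_def by auto
  qed
  then have "finite (range cell)"
    using F(1) by (rule finite_subset[OF _ finite_PiE]) auto
  then obtain G where G: "finite G" "range cell = cell ` G"
    using finite_subset_image[of "range cell" cell UNIV] by auto
  then have "G \<noteq> {}" by auto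
  define n where "n = card G"
  have n: "n > 0"
    using G(1) \<open>G \<noteq> {}\<close> by (simp add: n_def card_gt_0_iff)
  define b where "b E = (\<Sum>g\<in>G. T g E) / n" for E
  have b: "b \<in> orbit_hull"
    unfolding b_def[abs_def] n_def by (rule average_hull[OF G(1) \<open>G \<noteq> {}\<close> T])
  \<comment> \<open>Among the n terms of the average at least one is within I/2 of a given orbit
    point and the others are within I, so the mean distance is at most (I/2 + (n - 1) I)/n.\<close>
  define r where "r = I * (1 - 1 / (2 * n))"
  have near: "\<bar>b E - T h E\<bar> \<le> r" for h E
  proof -
    obtain g0 where g0: "g0 \<in> G" "cell g0 = cell h"
      using G(2) by (metis imageE rangeI)
    have half: "\<bar>T g0 E - T h E\<bar> \<le> I / 2"
    proof (cases "E \<in> sets borel")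
      case True
      then obtain E' where E': "E' \<in> F" "\<forall>z. \<bar>iterate z E - iterate z E'\<bar> \<le> I / 8"
        using F(3) by blast
      have E'b: "E' \<in> sets borel"
        using E'(1) F(2) by auto
      have close: "\<bar>T g E - T g E'\<bar> \<le> I / 8" for g
      proof -
        have le: "iterate z E - iterate z E' \<le> I / 8" "iterate z E' - iterate z E \<le> I / 8" for z
          using E'(2)[rule_format, of z] by linarith+
        show ?thesis
          using hullD(4)[OF T True E'b le(1), of g] hullD(4)[OF T E'b True le(2), of g] by linarith
      qed
      have "\<lfloor>8 * T g0 E' / I\<rfloor> = \<lfloor>8 * T h E' / I\<rfloor>"
        using fun_cong[OF g0(2), of E'] E'(1) by (simp add: cell_def)
      then have "8 * T g0 E' / I - 8 * T h E' / I \<le> 1" "-1 \<le> 8 * T g0 E' / I - 8 * T h E' / I"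
        by linarith+
      then have "(8 * T g0 E' - 8 * T h E') / I \<le> 1" "-1 \<le> (8 * T g0 E' - 8 * T h E') / I"
        by (simp_all only: diff_divide_distrib)
      then have "8 * T g0 E' - 8 * T h E' \<le> I" "- I \<le> 8 * T g0 E' - 8 * T h E'"
        using \<open>I > 0\<close> by (simp_all add: pos_divide_le_eq pos_le_divide_eq)
      then have "\<bar>T g0 E' - T h E'\<bar> \<le> I / 8"
        by linarith
      then show ?thesis
        using close[of g0] close[of h] \<open>I > 0\<close> by linarith
    next
      case False
      then show ?thesis
        using hullD(1)[OF T False] \<open>I > 0\<close> by simp
    qed
    have "b E - T h E = (\<Sum>g\<in>G. T g E - T h E) / n"
      using n by (simp add: b_def sum_subtractf n_def[symmetric] field_simps)
    then have "\<bar>b E - T h E\<bar> = \<bar>\<Sum>g\<in>G. T g E - T h E\<bar> / n"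
      by simp
    also have "\<dots> \<le> (\<Sum>g\<in>G. \<bar>T g E - T h E\<bar>) / n"
      by (intro divide_right_mono sum_abs) simp
    also have "(\<Sum>g\<in>G. \<bar>T g E - T h E\<bar>) = \<bar>T g0 E - T h E\<bar> + (\<Sum>g\<in>G - {g0}. \<bar>T g E - T h E\<bar>)"
      by (rule sum.remove[OF G(1) g0(1)])
    also have "\<dots> / n \<le> (I / 2 + (\<Sum>g\<in>G - {g0}. I)) / n"
      by (intro divide_right_mono add_mono half sum_mono diam) simp
    also have "(\<Sum>g\<in>G - {g0}. I) = (real n - 1) * I"
      using G(1) g0(1) n by (simp add: n_def of_nat_diff Suc_leI)
    also have "(I / 2 + (real n - 1) * I) / n = r"
      using n by (simp add: r_def field_simps)
    finally show ?thesis .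
  qed
  have "\<bar>b ((\<lambda>x. x + h) -` E) - b E\<bar> \<le> r" for h E
  proof -
    \<comment> \<open>A translate of b is again an average of orbit points of a, each of which is
      within r of b by \<open>near\<close>.\<close>
    have "b ((\<lambda>x. x + h) -` E) - b E = (\<Sum>g\<in>G. T (g + h) E - b E) / n"
      using n by (simp add: b_def[of "(\<lambda>x. x + h) -` E"] T_T sum_subtractf n_def[symmetric] field_simps)
    then have "\<bar>b ((\<lambda>x. x + h) -` E) - b E\<bar> = \<bar>\<Sum>g\<in>G. T (g + h) E - b E\<bar> / n"
      by simp
    also have "\<dots> \<le> (\<Sum>g\<in>G. \<bar>T (g + h) E - b E\<bar>) / n"
      by (intro divide_right_mono sum_abs) simp
    also have "\<dots> \<le> (\<Sum>g\<in>G. r) / n"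
      using near by (intro divide_right_mono sum_mono) (auto simp: abs_minus_commute)
    also have "\<dots> = r"
      using n by (simp add: n_def)
    finally show ?thesis .
  qed
  moreover have "r < I"
    using n \<open>I > 0\<close> by (simp add: r_def field_simps)
  ultimately show ?thesis
    using b by blast
qed

text \<open>Each \<open>C r\<close> is closed for setwise convergence, so compactness of the hull
  makes the infimum I of the admissible bounds attained; \<open>smaller_orbit_diameter\<close> then
  excludes I > 0. Bounding the distance from a to its translates bounds the whole diameter, since
  two orbit points differ as a does from one of its translates, evaluated at a moved set.\<close>

lemma invariant_in_hull:
  obtains a where "a \<in> orbit_hull" "\<And>g E. a ((\<lambda>x. x + g) -` E) = a E"
proof -
  define C where "C r = {a :: 'a set \<Rightarrow> real. \<forall>g E. \<bar>a ((\<lambda>x. x + g) -` E) - a E\<bar> \<le> r}" for r :: real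
  define R where "R = {r. orbit_hull \<inter> C r \<noteq> {}}"
  define I where "I = Inf R"
  have C_mono: "C r \<subseteq> C s" if "r \<le> s" for r s
    unfolding C_def using that by (fastforce intro: order.trans)
  have closed: "closed (C r)" for r
    unfolding C_def
    by (intro closed_Collect_all closed_Collect_le continuous_intros continuous_on_product_coordinates)
  have R_nonneg: "0 \<le> r" if "r \<in> R" for r
    using that unfolding R_def C_def by (force intro: order.trans[OF abs_ge_zero])
  have "\<bar>a A - a B\<bar> \<le> 1" if "a \<in> orbit_hull" for a A B
    using hull_nonneg[OF that, of A] hull_nonneg[OF that, of B] hull_le_1[OF that, of A]
      hull_le_1[OF that, of B] by linarith
  then have "1 \<in> R"
    using iterate_in_hull unfolding R_def C_def by blast
  then have "R \<noteq> {}" by auto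
  have bdd: "bdd_below R"
    using R_nonneg by (rule bdd_belowI)
  have "0 \<le> I"
    unfolding I_def using \<open>R \<noteq> {}\<close> R_nonneg by (intro cInf_greatest)
  have above: "orbit_hull \<inter> C r \<noteq> {}" if r: "r > I" for r
  proof -
    obtain s where "s \<in> R" "s < r"
      using cInf_less_iff[OF \<open>R \<noteq> {}\<close> bdd, THEN iffD1, OF r[unfolded I_def]] by auto
    then show ?thesis
      using C_mono[of s r] by (auto simp: R_def)
  qed
  have "orbit_hull \<inter> \<Inter> (C ` {I<..}) \<noteq> {}"
  proof (rule compact_imp_fip_image[OF compact_hull])
    fix S assume S: "finite S" "S \<subseteq> {I<..}"
    \<comment> \<open>Inserting \<open>I + 1\<close> keeps the minimum defined when S is
      empty.\<close>
    define s where "s = Min (insert (I + 1) S)"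
    have "I < s"
      using S unfolding s_def by (subst Min_gr_iff) auto
    moreover have "C s \<subseteq> \<Inter> (C ` S)"
      using S(1) unfolding s_def by (intro INT_greatest C_mono Min_le) auto
    ultimately show "orbit_hull \<inter> \<Inter> (C ` S) \<noteq> {}"
      using above[of s] by blast
  qed (rule closed)
  then obtain a where a: "a \<in> orbit_hull" and a_C: "a \<in> \<Inter> (C ` {I<..})"
    by blast
  have diam: "\<bar>a ((\<lambda>x. x + g) -` E) - a E\<bar> \<le> I" for g E
  proof (rule dense_ge)
    fix r assume "I < r"
    then have "a \<in> C r"
      using a_C by simp
    then show "\<bar>a ((\<lambda>x. x + g) -` E) - a E\<bar> \<le> r"
      by (simp add: C_def)
  qed
  have "I = 0"
  proof (rule ccontr)
    assume "I \<noteq> 0"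
    then have "I > 0"
      using \<open>0 \<le> I\<close> by simp
    then obtain b r where "b \<in> orbit_hull" "r < I" "\<forall>g E. \<bar>b ((\<lambda>x. x + g) -` E) - b E\<bar> \<le> r"
      using smaller_orbit_diameter[OF a diam] by blast
    then have "r \<in> R"
      by (auto simp: R_def C_def)
    then have "I \<le> r"
      unfolding I_def by (intro cInf_lower bdd)
    then show False
      using \<open>r < I\<close> by simp
  qed
  then show ?thesis
    using that[of a] a diam by simp
qed

text \<open>An invariant point of the hull is so far only finitely additive. Countable additivity
  and regularity follow through \<open>hull_le\<close> from the uniform estimates
  \<open>uniform_continuity_from_above\<close> and \<open>translate_inner_regular\<close>.\<close>

lemma ex_right_haar_measure: "\<exists>M :: 'a measure. right_haar_measure M"
proof -
  obtain a where a: "a \<in> orbit_hull" and inv: "\<And>g E. a ((\<lambda>x. x + g) -` E) = a E"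
    using invariant_in_hull by blast
  define M where "M = measure_of UNIV (sets borel) (\<lambda>E. ennreal (a E))"
  have sets: "sets M = sets borel"
    unfolding M_def by (simp add: sets.sigma_sets_eq[of borel, simplified])
  have em: "emeasure M E = ennreal (a E)" if "E \<in> sets borel" for E
  proof (rule emeasure_measure_of[OF M_def])
    show "positive (sets M) (\<lambda>E. ennreal (a E))"
      by (simp add: positive_def hull_empty[OF a])
    show "countably_additive (sets M) (\<lambda>E. ennreal (a E))"
    proof (rule sets.empty_continuous_imp_countably_additive)
      show "positive (sets M) (\<lambda>E. ennreal (a E))"
        by (simp add: positive_def hull_empty[OF a])
      show "additive (sets M) (\<lambda>E. ennreal (a E))"
        using hullD(3)[OF a] hull_nonneg[OF a] by (auto simp: additive_def sets)
      show "\<forall>E\<in>sets M. ennreal (a E) \<noteq> \<infinity>"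
        by simp
      fix A :: "nat \<Rightarrow> 'a set" assume A: "range A \<subseteq> sets M" "decseq A" "(\<Inter>i. A i) = {}"
      have "(\<lambda>i. a (A i)) \<longlonglongrightarrow> 0"
      proof (rule order_tendstoI)
        fix e :: real assume "0 < e"
        then obtain n where n: "\<forall>y. orbit_fun (A n) y < e / 2"
          using uniform_continuity_from_above[of A "e / 2"] A sets by auto
        have "a (A i) < e" if "i \<ge> n" for i
        proof -
          have "orbit_fun (A i) y \<le> e / 2" for y
            using orbit_fun_mono[of "A i" "A n" y] decseqD[OF A(2) that] A(1) sets n[rule_format, of y] by auto
          then have "a (A i) \<le> e / 2"
            using A(1) sets by (intro hull_le[OF a]) auto
          then show ?thesis
            using \<open>0 < e\<close> by simp
        qed
        then show "\<forall>\<^sub>F i in sequentially. a (A i) < e"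
          by (auto simp: eventually_sequentially)
      next
        fix e :: real assume "e < 0"
        then show "\<forall>\<^sub>F i in sequentially. e < a (A i)"
          using hull_nonneg[OF a] by (auto intro: always_eventually less_le_trans)
      qed
      then show "(\<lambda>i. ennreal (a (A i))) \<longlonglongrightarrow> 0"
        using tendsto_ennrealI by fastforce
    qed
  qed (use that sets in auto)
  have "space M = UNIV"
    using sets_eq_imp_space_eq[OF sets] by simp
  then have "prob_space M"
    by (intro prob_spaceI) (simp add: em hullD(2)[OF a])
  moreover have "radon (emeasure M)"
  proof (rule radonI)
    show "emeasure M A \<le> emeasure M B" if "A \<in> sets borel" "B \<in> sets borel" "A \<subseteq> B" for A B
      using that by (intro emeasure_mono) (auto simp: sets)
    show "emeasure M (A \<union> B) \<le> emeasure M A + emeasure M B" if "A \<in> sets borel" "B \<in> sets borel" for A B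
      using that by (intro emeasure_subadditive) (auto simp: sets)
    show "emeasure M UNIV < \<infinity>"
      by (simp add: em)
    fix E :: "'a set" and e :: real assume E: "E \<in> sets borel" and "e > 0"
    then obtain K where K: "compact K" "K \<subseteq> E" "\<forall>y. orbit_fun (E - K) y < e"
      using translate_inner_regular[of E e] by auto
    have "a (E - K) \<le> e"
      using E borel_compact[OF K(1)] K(3) by (intro hull_le[OF a]) (auto intro: less_imp_le)
    then show "\<exists>K. compact K \<and> K \<subseteq> E \<and> emeasure M (E - K) \<le> ennreal e"
      using K(1,2) E borel_compact[OF K(1)] by (intro exI[of _ K]) (auto simp: em ennreal_leI)
  qed
  moreover have "emeasure M ((\<lambda>x. x + g) ` E) = emeasure M E" if "E \<in> sets borel" for g E
    using em[OF that] em[OF borel_right_translation(1)[OF that, of g]] inv[of "- g" E]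
    by (simp add: image_right_translation)
  ultimately show ?thesis
    using sets by (auto simp: right_haar_measure_def)
qed

end

text \<open>
  The upper variations of the translates of \<open>\<nu>\<close> are lower semicontinuous as suprema of continuous
  functions; they are also upper semicontinuous because all translates have the same total mass.
\<close>

lemma upper_variation_orbit_continuous:
  fixes \<nu> :: "'a::right_topological_group_add set \<Rightarrow> real"
  assumes \<nu>: "signed_borel_measure \<nu>"
    and cont: "\<And>F. F \<in> sets borel \<Longrightarrow> continuous_on UNIV (\<lambda>y. \<nu> ((\<lambda>x. x + y) -` F))"
    and E: "E \<in> sets borel"
  shows "continuous_on UNIV (\<lambda>y. measure (upper_variation \<nu>) ((\<lambda>x. x + y) -` E))"
proof -
  interpret finite_measure "upper_variation \<nu>"
    by (rule finite_measure_upper_variation[OF \<nu>])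
  define g where "g E y = measure (upper_variation \<nu>) ((\<lambda>x. x + y) -` E)" for E y
  have lower: "\<forall>\<^sub>F y in at y0. a < g E y" if E: "E \<in> sets borel" and a: "a < g E y0" for E a y0
  proof -
    have "\<exists>F. F \<in> sets borel \<and> F \<subseteq> (\<lambda>x. x + y0) -` E \<and> a < \<nu> F"
    proof (rule ccontr)
      assume "\<not> ?thesis"
      then have "g E y0 \<le> a"
        unfolding g_def by (intro measure_upper_variation_le[OF \<nu> borel_right_translation(2)[OF E]])
          (auto simp: not_less)
      then show False using a by simp
    qed
    then obtain F where F: "F \<in> sets borel" "F \<subseteq> (\<lambda>x. x + y0) -` E" "a < \<nu> F"
      by blast
    \<comment> \<open>F competes for the preimage of E at \<open>y0\<close> only. The moved set lies
      in E, so its preimages compete at every y, and at \<open>y0\<close> its preimage is F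
      again.\<close>
    define F' where "F' = (\<lambda>x. x + y0) ` F"
    have F': "F' \<in> sets borel" "F' \<subseteq> E" "(\<lambda>x. x + y0) -` F' = F"
      using F(1,2) by (auto simp: F'_def borel_right_translation)
    have "((\<lambda>y. \<nu> ((\<lambda>x. x + y) -` F')) \<longlongrightarrow> \<nu> F) (at y0)"
      using cont[OF F'(1)] F'(3) by (metis UNIV_I continuous_on_def)
    then have "\<forall>\<^sub>F y in at y0. a < \<nu> ((\<lambda>x. x + y) -` F')"
      using F(3) by (rule order_tendstoD)
    then show ?thesis
    proof (rule eventually_mono)
      fix y assume "a < \<nu> ((\<lambda>x. x + y) -` F')"
      also have "\<dots> \<le> g E y"
        unfolding g_def using F'(2)
        by (intro le_measure_upper_variation[OF \<nu>] borel_right_translation E F'(1)) auto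
      finally show "a < g E y" .
    qed
  qed
  have compl: "g (- E) y = measure (upper_variation \<nu>) UNIV - g E y" for y
  proof -
    have "(\<lambda>x. x + y) -` (- E) = UNIV - (\<lambda>x. x + y) -` E"
      by auto
    then show ?thesis
      using finite_measure_compl[of "(\<lambda>x. x + y) -` E"] \<nu> borel_right_translation(2)[OF E, of y]
      by (simp add: g_def)
  qed
  have "(g E \<longlongrightarrow> g E y0) (at y0)" for y0
  proof (rule order_tendstoI)
    show "\<forall>\<^sub>F y in at y0. a < g E y" if "a < g E y0" for a
      using lower[OF E that] .
    show "\<forall>\<^sub>F y in at y0. g E y < a" if "g E y0 < a" for a
      using lower[of "- E" "measure (upper_variation \<nu>) UNIV - a" y0] E that by (simp add: compl)
  qed
  then have "continuous_on UNIV (g E)"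
    by (simp add: continuous_on_def)
  then show ?thesis
    by (simp add: g_def[abs_def])
qed

text \<open>At a set where \<mu> does not vanish, its real or imaginary part, up to sign, is
  positive. That part has an upper variation of positive mass, which can be normalised; it is
  dominated by the total variation of \<mu> and inherits inner regularity from it.\<close>

lemma right_haar_measure_if_M_weak:
  fixes \<mu> :: "'a::{right_topological_group_add, t2_space} set \<Rightarrow> complex"
  assumes c: "compact (UNIV :: 'a set)" and \<mu>: "\<mu> \<in> M_weak" and ne: "\<mu> \<noteq> (\<lambda>E. 0)"
  shows "\<exists>M :: 'a measure. right_haar_measure M"
proof -
  have \<mu>': "\<mu> \<in> radon_measures"
    using \<mu> by (simp add: M_weak_def M_cont_def)
  note cbm = radon_measures_complex_borel_measure[OF \<mu>']
  note cont = M_weak_orbit_continuous[OF c \<mu>]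
  obtain E0 where E0: "\<mu> E0 \<noteq> 0"
    using ne by auto
  then have E0_borel: "E0 \<in> sets borel"
    using complex_borel_measure_not_borel[OF cbm] by blast
  have *: "\<exists>M :: 'a measure. right_haar_measure M"
    if \<nu>: "signed_borel_measure \<nu>" and le: "\<And>E. \<nu> E \<le> cmod (\<mu> E)"
      and cont: "\<And>E. continuous_on UNIV (\<lambda>y. \<nu> ((\<lambda>x. x + y) -` E))"
      and pos: "\<nu> E0 > 0" for \<nu>
  proof -
    interpret U: finite_measure "upper_variation \<nu>"
      by (rule finite_measure_upper_variation[OF \<nu>])
    define m where "m = measure (upper_variation \<nu>) UNIV"
    have "\<nu> E0 \<le> m"
      unfolding m_def by (rule le_measure_upper_variation[OF \<nu> _ E0_borel]) auto
    then have m: "m > 0"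
      using pos by simp
    define \<kappa> where "\<kappa> = scale_measure (ennreal (1 / m)) (upper_variation \<nu>)"
    have measure_\<kappa>: "measure \<kappa> A = measure (upper_variation \<nu>) A / m" for A
      using m by (simp add: \<kappa>_def measure_def enn2real_mult)
    interpret continuous_orbit \<kappa>
    proof (intro continuous_orbit.intro continuous_orbit_axioms.intro prob_spaceI)
      have "emeasure \<kappa> (space \<kappa>) = ennreal (1 / m) * ennreal m"
        by (simp add: \<kappa>_def space_scale_measure \<nu> m_def U.emeasure_eq_measure)
      also have "\<dots> = 1"
        using m by (simp flip: ennreal_mult)
      finally show "emeasure \<kappa> (space \<kappa>) = 1" .
      show "compact (UNIV :: 'a set)" by (rule c)
      show "sets \<kappa> = sets borel"
        by (simp add: \<kappa>_def \<nu>)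
      show "continuous_on UNIV (\<lambda>y. measure \<kappa> ((\<lambda>x. x + y) -` E))" if "E \<in> sets borel" for E
        unfolding measure_\<kappa> using m
        by (intro continuous_intros upper_variation_orbit_continuous[OF \<nu> cont that]) auto
      fix E :: "'a set" and e :: real assume E: "E \<in> sets borel" and "e > 0"
      then have em: "e * m > 0"
        using m by simp
      obtain K where K: "compact K" "K \<subseteq> E" "total_variation \<mu> (E - K) \<le> ennreal (e * m)"
        using radon_measures_inner_regular[OF \<mu>' c E em] .
      have "measure (upper_variation \<nu>) (E - K) \<le> e * m"
        using E borel_compact[OF K(1)] em
        by (intro measure_upper_variation_le_total_variation[OF \<nu> cbm le _ K(3)]) auto
      then show "\<exists>K. compact K \<and> K \<subseteq> E \<and> measure \<kappa> (E - K) \<le> e"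
        using K m by (intro exI[of _ K]) (simp add: measure_\<kappa> pos_divide_le_eq)
    qed
    show ?thesis
      by (rule ex_right_haar_measure)
  qed
  note Re = signed_borel_measure_Re[OF \<mu>' c] and Im = signed_borel_measure_Im[OF \<mu>' c]
  consider "Re (\<mu> E0) > 0" | "- Re (\<mu> E0) > 0" | "Im (\<mu> E0) > 0" | "- Im (\<mu> E0) > 0"
    using E0 complex_eq_iff[of "\<mu> E0" 0] by fastforce
  then show ?thesis
  proof cases
    case 1
    show ?thesis
      by (rule *[OF Re _ _ 1]) (auto intro!: complex_Re_le_cmod continuous_intros cont)
  next
    case 2
    show ?thesis
      by (rule *[OF signed_borel_measure_uminus[OF Re] _ _ 2])
        (auto intro!: continuous_intros cont order.trans[OF abs_ge_minus_self abs_Re_le_cmod])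
  next
    case 3
    show ?thesis
      by (rule *[OF Im _ _ 3])
        (auto intro!: continuous_intros cont order.trans[OF abs_ge_self abs_Im_le_cmod])
  next
    case 4
    show ?thesis
      by (rule *[OF signed_borel_measure_uminus[OF Im] _ _ 4])
        (auto intro!: continuous_intros cont order.trans[OF abs_ge_minus_self abs_Im_le_cmod])
  qed
qed

text \<open>Invariance makes the orbit map constant, so norm continuity is immediate. The remaining
  content is that the total variation of the complex measure is M itself, which transfers the Radon
  condition.\<close>

lemma L_cont_if_right_haar_measure:
  fixes M :: "'a::{right_topological_group_add, t2_space} measure"
  assumes M: "right_haar_measure M"
  shows "(\<lambda>E. complex_of_real (measure M E)) \<in> L_cont"
proof -
  interpret prob_space M
    using M by (simp add: right_haar_measure_def)
  have sets: "sets M = sets borel"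
    using M by (simp add: right_haar_measure_def)
  let ?\<mu> = "\<lambda>E. complex_of_real (measure M E)"
  have cbm: "complex_borel_measure ?\<mu>"
    unfolding complex_borel_measure_def
  proof (intro conjI allI impI)
    show "?\<mu> E = 0" if "E \<notin> sets borel" for E
      using that sets by (simp add: measure_notin_sets)
    fix A :: "nat \<Rightarrow> 'a set" assume "range A \<subseteq> sets borel" "disjoint_family A"
    then show "(\<lambda>n. ?\<mu> (A n)) sums ?\<mu> (\<Union>n. A n)"
      using sets by (intro sums_of_real finite_measure_UNION) auto
  qed
  have tv: "total_variation ?\<mu> E = emeasure M E" for E
  proof (cases "E \<in> sets borel")
    case True
    have "(\<Sum>A\<in>P. ennreal (cmod (?\<mu> A))) = emeasure M E" if P: "P \<in> borel_partitions E" for P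
    proof -
      have "(\<Sum>A\<in>P. ennreal (cmod (?\<mu> A))) = (\<Sum>A\<in>P. emeasure M A)"
        by (simp add: emeasure_eq_measure)
      also have "\<dots> = emeasure M (\<Union>A\<in>P. A)"
        using P sets by (intro sum_emeasure)
          (auto simp: borel_partitions_def disjoint_family_on_def disjoint_def)
      finally show ?thesis
        using P by (simp add: borel_partitions_def)
    qed
    moreover have "borel_partitions E \<noteq> {}"
      using singleton_borel_partition[OF True] by blast
    ultimately show ?thesis
      by (simp add: total_variation_eq)
  next
    case False
    \<comment> \<open>A non-Borel set has no Borel partition, and the supremum of the empty set is
      0, the value of \<open>emeasure\<close> there.\<close>
    then show ?thesis
      using sets by (simp add: total_variation_eq borel_partitions_not_borel emeasure_notin_sets bot_ennreal)
  qed
  have inv: "right_translate g ?\<mu> = ?\<mu>" for g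
  proof
    fix E show "right_translate g ?\<mu> E = ?\<mu> E"
      using M sets right_translation_not_borel[of E g]
      by (cases "E \<in> sets borel")
        (simp_all add: right_haar_measure_def right_translate_def measure_def emeasure_notin_sets)
  qed
  have "radon (total_variation ?\<mu>)"
    using M tv by (simp add: right_haar_measure_def fun_eq_iff[symmetric] ext[of "total_variation ?\<mu>" "emeasure M"])
  then have "?\<mu> \<in> radon_measures"
    using cbm by (simp add: radon_measures_def)
  moreover have "total_variation (\<lambda>E::'a set. 0) UNIV \<le> 0"
    unfolding total_variation_def by (rule SUP_least) simp
  then have "tv_norm (\<lambda>E::'a set. 0) = 0"
    by (simp add: tv_norm_def)
  ultimately show ?thesis
    by (simp add: L_cont_def inv)
qed

theorem proposition4p8:
  assumes "compact (UNIV :: 'a::{right_topological_group_add, t2_space} set)"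
  shows "((\<exists>M :: 'a measure. right_haar_measure M) \<longleftrightarrow>
            (\<exists>\<mu> :: 'a set \<Rightarrow> complex. \<mu> \<in> L_cont \<and> \<mu> \<noteq> (\<lambda>E. 0))) \<and>
         ((\<exists>\<mu> :: 'a set \<Rightarrow> complex. \<mu> \<in> L_cont \<and> \<mu> \<noteq> (\<lambda>E. 0)) \<longleftrightarrow>
            (\<exists>\<mu> :: 'a set \<Rightarrow> complex. \<mu> \<in> M_weak \<and> \<mu> \<noteq> (\<lambda>E. 0)))"
proof -
  have 1: "\<exists>\<mu> :: 'a set \<Rightarrow> complex. \<mu> \<in> L_cont \<and> \<mu> \<noteq> (\<lambda>E. 0)" if "right_haar_measure M" for M :: "'a measure"
  proof (intro exI conjI)
    show "(\<lambda>E. complex_of_real (measure M E)) \<in> L_cont"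
      by (rule L_cont_if_right_haar_measure[OF that])
    have "measure M (space M) = 1"
      using that by (simp add: right_haar_measure_def prob_space.prob_space)
    then show "(\<lambda>E. complex_of_real (measure M E)) \<noteq> (\<lambda>E. 0)"
      by (metis of_real_eq_0_iff zero_neq_one)
  qed
  show ?thesis
    using 1 L_cont_subset_M_weak[OF assms] right_haar_measure_if_M_weak[OF assms] by blast
qed

end
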